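(* Let $s>0$ be an integer, $M=\binom{s+2}{2}-1$, and let $q$ be a power of a prime $p>M$. Let $$\phi_s=(Z^s:XZ^{s-1}:YZ^{s-1}:X^2Z^{s-2}:\cdots:X^iY^jZ^k:\cdots:Y^s):\mathbb{P}^2\hookrightarrow\mathbb{P}^M,\qquad i+j+k=s,$$ be the Veronese embedding. Let $\mathcal{S}\subset\mathbb{P}^M(\overline{\mathbb{F}}_q)$ be an absolutely irreducible $\mathbb{F}_q$-Frobenius nonclassical hypersurface, defined over $\mathbb{F}_q$ by $F(X_0,\dots,X_M)=0$, with Gauss map $\Gamma$, such that $p\nmid\deg(\mathcal{S})$ and $\sum_{i=0}^M\frac{\partial F}{\partial X_i}X_i^q$ is a nonzero polynomial. Assume that there exists an absolutely irreducible component $\mathcal{X}$ of $\mathcal{S}\cap\phi_s(\mathbb{P}^2)$ defined over $\mathbb{F}_q$ such that: $\mathcal{X}$ is nondegenerate; $\mathcal{X}$ is not contained in the singular locus of $\mathcal{S}$; and $\Gamma|_{\mathcal{X}}$ is inseparable. Set $\mathcal{F}:=\phi_s^{-1}(\mathcal{X})\subset\mathbb{P}^2(\overline{\mathbb{F}}_q)$. Then: (i) $\mathcal{F}$ is defined over $\mathbb{F}_q$ by an absolutely irreducible factor of $F(Z^s,XZ^{s-1},YZ^{s-1},X^2Z^{s-2},\dots,X^iY^jZ^k,\dots,Y^s)\in\mathbb{F}_q[X,Y,Z]$; (ii) if $\deg\mathcal{F}>s$, then $\mathcal{F}$ is $\mathbb{F}_q$-Frobenius nonclassical with respect to the linear system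 of all plane curves of degree $s$.
   Context: $\Phi_q$ is the $\mathbb{F}_q$-Frobenius map (raising coordinates to the $q$-th power). For a hypersurface $\mathcal{S}\subset\mathbb{P}^M$ over $\mathbb{F}_q$ defined by a homogeneous polynomial $F$, with nonsingular locus $\mathcal{S}_{\operatorname{reg}}$ and tangent hyperplanes $T_P(\mathcal{S})$, $\mathcal{S}$ is $\mathbb{F}_q$-Frobenius nonclassical if $\Phi_q(P)\in T_P(\mathcal{S})$ for all $P\in\mathcal{S}_{\operatorname{reg}}$, equivalently if $F$ divides $\sum_i\frac{\partial F}{\partial X_i}X_i^q$. The Gauss map $\Gamma$ of $\mathcal{S}$ is the rational map to the dual projective space sending $P\in\mathcal{S}_{\operatorname{reg}}$ to the dual of $T_P(\mathcal{S})$, given by the partial derivatives of $F$. A rational map is inseparable if the extension of function fields of the source over that of the closure of the image is not separable. Nondegenerate means not contained in any hyperplane. For a nondegenerate irreducible curve $\mathcal{X}\subset\mathbb{P}^M$ over $\mathbb{F}_q$ with coordinate functions $y_0,\dots,y_M\in\mathbb{F}_q(\mathcal{X})$, separating element $\zeta$ and Hasse derivatives $D_\zeta^{(k)}$, the $\mathbb{F}_q$-Frobenius order sequence is the lexicographically minimal sequence $0\le\nu_0<\dots<\nu_{M-1}$ such that the determinant of the matrix with rows $(y_0^q,\dots,y_M^q)$ and $(D_\zeta^{(\nu_i)}y_0,\dots,D_\zeta^{(\nu_i)}y_M)$, $i=0,\dots,M-1$, is nonzero; $\mathcal{X}$ is $\mathbb{F}_q$-Frobenius nonclassical if $(\nu_0,\dots,\nu_{M-1})\ne(0,1,\dots,M-1)$.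 A plane curve $\mathcal{F}$ over $\mathbb{F}_q$ of degree $>s$ is $\mathbb{F}_q$-Frobenius nonclassical with respect to the linear system of all plane curves of degree $s$ if its model in $\mathbb{P}^M$ given by the linear series cut out on $\mathcal{F}$ by plane curves of degree $s$ (i.e. the image of $\mathcal{F}$ under $\phi_s$) is $\mathbb{F}_q$-Frobenius nonclassical. *)

theory Defs
  imports
    "HOL-Algebra.Algebraic_Closure_Type"
    "HOL-Algebra.Finite_Extensions"
    "HOL-Algebra.Generated_Fields"
    "HOL-Combinatorics.Permutations"
    "HOL-Computational_Algebra.Primes"
    "HOL-Library.Cardinality"
    "HOL-Library.Nat_Bijection"
    "HOL-Library.Poly_Mapping"
begin

text \<open>
  Throughout, the finite field \<open>F_q\<close> is a type \<open>'a\<close> of class \<open>finite_field\<close>, with \<open>q = CARD('a)\<close> and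
  \<open>p = CHAR('a)\<close>, and its algebraic closure is the type \<open>'a alg_closure\<close>.
\<close>

section \<open>Forms\<close>

text \<open>
  A polynomial has variables \<open>X_i\<close> for all natural numbers \<open>i\<close>; the subring \<open>k[X_0, ..., X_n]\<close> is
  singled out by a condition on the variables that occur. Over a field, factors of a polynomial
  involve only variables of that polynomial, so divisibility and irreducibility do not depend
  on the surrounding set of variables.
\<close>

type_synonym 'c mpoly = "(nat \<Rightarrow>\<^sub>0 nat) \<Rightarrow>\<^sub>0 'c"

definition mp_const :: "'c::zero \<Rightarrow> 'c mpoly"
  where "mp_const c = Poly_Mapping.single 0 c"

definition mp_var :: "nat \<Rightarrow> 'c::zero_neq_one mpoly"
  where "mp_var i = Poly_Mapping.single (Poly_Mapping.single i 1) 1"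

definition mp_subst :: "('c::zero \<Rightarrow> 'd::comm_semiring_1) \<Rightarrow> (nat \<Rightarrow> 'd) \<Rightarrow> 'c mpoly \<Rightarrow> 'd"
  where "mp_subst h v G =
    (\<Sum>m\<in>Poly_Mapping.keys G. h (Poly_Mapping.lookup G m) *
      (\<Prod>i\<in>Poly_Mapping.keys m. v i ^ Poly_Mapping.lookup m i))"

abbreviation mp_eval :: "(nat \<Rightarrow> 'c::comm_semiring_1) \<Rightarrow> 'c mpoly \<Rightarrow> 'c"
  where "mp_eval \<equiv> mp_subst (\<lambda>c. c)"

definition mp_pderiv :: "nat \<Rightarrow> 'c::comm_semiring_1 mpoly \<Rightarrow> 'c mpoly"
  where "mp_pderiv i G =
    (\<Sum>m\<in>Poly_Mapping.keys G. Poly_Mapping.single (m - Poly_Mapping.single i 1)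
      (of_nat (Poly_Mapping.lookup m i) * Poly_Mapping.lookup G m))"

definition base_change :: "'a::field mpoly \<Rightarrow> 'a alg_closure mpoly"
  where "base_change = Poly_Mapping.map to_ac"

text \<open>The zero polynomial is a form of every degree.\<close>

definition forms :: "nat \<Rightarrow> nat \<Rightarrow> 'c::zero mpoly set"
  where "forms n d = {G. \<forall>m\<in>Poly_Mapping.keys G.
    Poly_Mapping.keys m \<subseteq> {..n} \<and> (\<Sum>i\<in>Poly_Mapping.keys m. Poly_Mapping.lookup m i) = d}"

section \<open>Projective space\<close>

text \<open>
  A point of \<open>P^n\<close> is the set of all its homogeneous coordinate vectors \<open>(v 0, ..., v n)\<close>, these being
  extended by \<open>0\<close> to functions on the natural numbers.
\<close>

type_synonym 'k point = "(nat \<Rightarrow> 'k) set"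

definition coord_vecs :: "nat \<Rightarrow> (nat \<Rightarrow> 'k::field) set"
  where "coord_vecs n = {v. v \<noteq> (\<lambda>_. 0) \<and> (\<forall>i>n. v i = 0)}"

definition proj_pt :: "(nat \<Rightarrow> 'k::field) \<Rightarrow> 'k point"
  where "proj_pt v = {(\<lambda>i. c * v i) | c. c \<noteq> 0}"

definition proj_space :: "nat \<Rightarrow> 'k::field point set"
  where "proj_space n = proj_pt ` coord_vecs n"

definition zero_locus :: "nat \<Rightarrow> 'k::field mpoly set \<Rightarrow> 'k point set"
  where "zero_locus n T = {P \<in> proj_space n. \<forall>G\<in>T. \<forall>v\<in>P. mp_eval v G = 0}"

definition zariski_closed :: "nat \<Rightarrow> 'k::field point set \<Rightarrow> bool"
  where "zariski_closed n A \<longleftrightarrow> (\<exists>T \<subseteq> (\<Union>d. forms n d). A = zero_locus n T)"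

definition closed_over_Fq :: "nat \<Rightarrow> 'a::finite_field alg_closure point set \<Rightarrow> bool"
  where "closed_over_Fq n A \<longleftrightarrow>
    (\<exists>T :: 'a mpoly set. T \<subseteq> (\<Union>d. forms n d) \<and> A = zero_locus n (base_change ` T))"

definition irreducible_closed :: "nat \<Rightarrow> 'k::field point set \<Rightarrow> bool"
  where "irreducible_closed n A \<longleftrightarrow> zariski_closed n A \<and> A \<noteq> {} \<and>
    (\<forall>B C. zariski_closed n B \<and> zariski_closed n C \<and> A \<subseteq> B \<union> C \<longrightarrow> A \<subseteq> B \<or> A \<subseteq> C)"

definition irreducible_component :: "nat \<Rightarrow> 'k::field point set \<Rightarrow> 'k point set \<Rightarrow> bool"
  where "irreducible_component n A V \<longleftrightarrow> irreducible_closed n V \<and> V \<subseteq> A \<and>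
    (\<forall>Y. irreducible_closed n Y \<and> V \<subseteq> Y \<and> Y \<subseteq> A \<longrightarrow> Y = V)"

text \<open>Irreducible closed sets of Krull dimension one.\<close>

definition irreducible_curve :: "nat \<Rightarrow> 'k::field point set \<Rightarrow> bool"
  where "irreducible_curve n V \<longleftrightarrow> irreducible_closed n V \<and> (\<nexists>P. V = {P}) \<and>
    (\<forall>Y. irreducible_closed n Y \<and> Y \<subset> V \<longrightarrow> (\<exists>P. Y = {P}))"

definition nondegenerate :: "nat \<Rightarrow> 'k::field point set \<Rightarrow> bool"
  where "nondegenerate n V \<longleftrightarrow>
    \<not> (\<exists>a \<in> coord_vecs n. \<forall>P\<in>V. \<forall>v\<in>P. (\<Sum>i\<le>n. a i * v i) = 0)"

definition frobenius_map :: "nat \<Rightarrow> 'k::field point \<Rightarrow> 'k point"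
  where "frobenius_map q P = (\<Union>v\<in>P. proj_pt (\<lambda>i. v i ^ q))"

section \<open>Hypersurfaces over the finite field\<close>

definition hypersurface :: "nat \<Rightarrow> 'a::field mpoly \<Rightarrow> 'a alg_closure point set"
  where "hypersurface n F = zero_locus n {base_change F}"

definition sing_locus :: "nat \<Rightarrow> 'a::field mpoly \<Rightarrow> 'a alg_closure point set"
  where "sing_locus n F = {P \<in> hypersurface n F.
    \<forall>v\<in>P. \<forall>i\<le>n. mp_eval v (base_change (mp_pderiv i F)) = 0}"

definition reg_locus :: "nat \<Rightarrow> 'a::field mpoly \<Rightarrow> 'a alg_closure point set"
  where "reg_locus n F = hypersurface n F - sing_locus n F"

definition tangent_hyperplane ::
    "nat \<Rightarrow> 'a::field mpoly \<Rightarrow> 'a alg_closure point \<Rightarrow> 'a alg_closure point set"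
  where "tangent_hyperplane n F P = {Q \<in> proj_space n.
    \<forall>v\<in>P. \<forall>w\<in>Q. (\<Sum>i\<le>n. mp_eval v (base_change (mp_pderiv i F)) * w i) = 0}"

definition frobenius_nonclassical_hypersurface :: "nat \<Rightarrow> 'a::finite_field mpoly \<Rightarrow> bool"
  where "frobenius_nonclassical_hypersurface n F \<longleftrightarrow>
    (\<forall>P \<in> reg_locus n F. frobenius_map CARD('a) P \<in> tangent_hyperplane n F P)"

section \<open>Function fields\<close>

text \<open>
  For an irreducible closed set \<open>V\<close> defined over \<open>F_q\<close>, the elements of the function field \<open>F_q(V)\<close>
  are the classes of fractions \<open>A/B\<close> of forms over \<open>F_q\<close> of equal degree, \<open>B\<close> not vanishing
  identically on \<open>V\<close>, where \<open>A/B\<close> and \<open>C/D\<close> are identified if \<open>A D - C B\<close> vanishes on \<open>V\<close>.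
\<close>

type_synonym 'a ratfun = "('a mpoly \<times> 'a mpoly) set"

definition vanishes_on :: "'a::field alg_closure point set \<Rightarrow> 'a mpoly \<Rightarrow> bool"
  where "vanishes_on V G \<longleftrightarrow> (\<forall>P\<in>V. \<forall>v\<in>P. mp_eval v (base_change G) = 0)"

definition fractions :: "nat \<Rightarrow> 'a::field alg_closure point set \<Rightarrow> ('a mpoly \<times> 'a mpoly) set"
  where "fractions n V = {(A, B). (\<exists>d. A \<in> forms n d \<and> B \<in> forms n d) \<and> \<not> vanishes_on V B}"

definition ratfun ::
    "nat \<Rightarrow> 'a::field alg_closure point set \<Rightarrow> 'a mpoly \<Rightarrow> 'a mpoly \<Rightarrow> 'a ratfun"
  where "ratfun n V A B = {(C, D) \<in> fractions n V. vanishes_on V (A * D - C * B)}"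

definition function_field :: "nat \<Rightarrow> 'a::field alg_closure point set \<Rightarrow> 'a ratfun ring"
  where "function_field n V = \<lparr>
    carrier = {ratfun n V A B | A B. (A, B) \<in> fractions n V},
    monoid.mult = (\<lambda>f g. \<Union>(A, B)\<in>f. \<Union>(C, D)\<in>g. ratfun n V (A * C) (B * D)),
    one = ratfun n V 1 1,
    zero = ratfun n V 0 1,
    add = (\<lambda>f g. \<Union>(A, B)\<in>f. \<Union>(C, D)\<in>g. ratfun n V (A * D + C * B) (B * D))\<rparr>"

definition constants :: "nat \<Rightarrow> 'a::field alg_closure point set \<Rightarrow> 'a ratfun set"
  where "constants n V = {ratfun n V (mp_const c) 1 | c. True}"

text \<open>
  Coordinate functions \<open>y_i = X_i / X_0\<close>; for nondegenerate \<open>V\<close> the form \<open>X_0\<close> does not vanish on \<open>V\<close>.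
\<close>

definition coord_fun :: "nat \<Rightarrow> 'a::field alg_closure point set \<Rightarrow> nat \<Rightarrow> 'a ratfun"
  where "coord_fun n V i = ratfun n V (mp_var i) (mp_var 0)"

section \<open>Separability\<close>

text \<open>
  An algebraic element is separable if it is a simple root of its minimal polynomial. A finitely
  generated extension \<open>K/L\<close> is separable if it has a transcendence basis \<open>B\<close> such that \<open>K\<close> is
  separable algebraic over \<open>L(B)\<close>; for algebraic \<open>K/L\<close> the only choice is \<open>B = {}\<close>.
\<close>

definition separable_element :: "('e, 'f) ring_scheme \<Rightarrow> 'e set \<Rightarrow> 'e \<Rightarrow> bool"
  where "separable_element K L x \<longleftrightarrow>
    ring.algebraic K L x \<and> ring.alg_mult K (ring.Irr K L x) x = 1"

definition alg_independent :: "('e, 'f) ring_scheme \<Rightarrow> 'e set \<Rightarrow> 'e set \<Rightarrow> bool"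
  where "alg_independent K L B \<longleftrightarrow>
    (\<forall>b\<in>B. ring.transcendental K (generate_field K (L \<union> (B - {b}))) b)"

definition separable_extension :: "('e, 'f) ring_scheme \<Rightarrow> 'e set \<Rightarrow> bool"
  where "separable_extension K L \<longleftrightarrow>
    (\<exists>B \<subseteq> carrier K. alg_independent K L B \<and>
      (\<forall>x \<in> carrier K. separable_element K (generate_field K (L \<union> B)) x))"

text \<open>
  The function field of the closure of the image of \<open>V\<close> under the Gauss map of \<open>F = 0\<close>, as a
  subfield of \<open>F_q(V)\<close>: the pullbacks of fractions \<open>A/B\<close> of forms in the dual coordinates, with \<open>B\<close>
  not vanishing identically on the image.
\<close>

definition gauss_image_field ::
    "nat \<Rightarrow> 'a::field mpoly \<Rightarrow> 'a alg_closure point set \<Rightarrow> 'a ratfun set"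
  where "gauss_image_field n F V =
    (let pullback = mp_subst mp_const (\<lambda>i. mp_pderiv i F) in
      {ratfun n V (pullback A) (pullback B) | A B.
        (\<exists>e. A \<in> forms n e \<and> B \<in> forms n e) \<and> \<not> vanishes_on V (pullback B)})"

definition gauss_map_inseparable_on ::
    "nat \<Rightarrow> 'a::field mpoly \<Rightarrow> 'a alg_closure point set \<Rightarrow> bool"
  where "gauss_map_inseparable_on n F V \<longleftrightarrow>
    \<not> separable_extension (function_field n V) (gauss_image_field n F V)"

section \<open>Frobenius orders of curves\<close>

definition separating :: "nat \<Rightarrow> 'a::field alg_closure point set \<Rightarrow> 'a ratfun \<Rightarrow> bool"
  where "separating n V \<zeta> \<longleftrightarrow> \<zeta> \<in> carrier (function_field n V) \<and>
    (\<forall>f \<in> carrier (function_field n V).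
      separable_element (function_field n V)
        (generate_field (function_field n V) (insert \<zeta> (constants n V))) f)"

text \<open>
  The Hasse derivatives with respect to a separating element \<open>\<zeta>\<close> of \<open>K\<close> over the constant field
  \<open>k\<close>: the unique Hasse-Schmidt derivation of \<open>K/k\<close> sending \<open>\<zeta>\<close> to \<open>\<zeta>\<close>, \<open>1\<close>, \<open>0\<close>, \<open>0\<close>, and so on.
\<close>

definition hasse_derivatives ::
    "('e, 'f) ring_scheme \<Rightarrow> 'e set \<Rightarrow> 'e \<Rightarrow> (nat \<Rightarrow> 'e \<Rightarrow> 'e) \<Rightarrow> bool"
  where "hasse_derivatives K k \<zeta> D \<longleftrightarrow>
    (\<forall>n. D n \<in> carrier K \<rightarrow> carrier K) \<and>
    (\<forall>f \<in> carrier K. D 0 f = f) \<and>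
    (\<forall>n. \<forall>f \<in> carrier K. \<forall>g \<in> carrier K. D n (f \<oplus>\<^bsub>K\<^esub> g) = D n f \<oplus>\<^bsub>K\<^esub> D n g) \<and>
    (\<forall>n. \<forall>c \<in> k. \<forall>f \<in> carrier K. D n (c \<otimes>\<^bsub>K\<^esub> f) = c \<otimes>\<^bsub>K\<^esub> D n f) \<and>
    (\<forall>n. \<forall>f \<in> carrier K. \<forall>g \<in> carrier K.
      D n (f \<otimes>\<^bsub>K\<^esub> g) = (\<Oplus>\<^bsub>K\<^esub>i\<in>{..n}. D i f \<otimes>\<^bsub>K\<^esub> D (n - i) g)) \<and>
    D 1 \<zeta> = \<one>\<^bsub>K\<^esub> \<and> (\<forall>n\<ge>2. D n \<zeta> = \<zero>\<^bsub>K\<^esub>)"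

definition ring_det :: "('e, 'f) ring_scheme \<Rightarrow> nat \<Rightarrow> (nat \<Rightarrow> nat \<Rightarrow> 'e) \<Rightarrow> 'e"
  where "ring_det K n A =
    (\<Oplus>\<^bsub>K\<^esub>\<pi>\<in>{\<pi>. \<pi> permutes {..<n}}. [sign \<pi>] \<cdot>\<^bsub>K\<^esub> (\<Otimes>\<^bsub>K\<^esub>i\<in>{..<n}. A i (\<pi> i)))"

text \<open>
  \<open>frobenius_det n V D \<mu>\<close> is the determinant of the \<open>(n + 1) \<times> (n + 1)\<close> matrix with rows
  \<open>(y_0^q, ..., y_n^q)\<close> and \<open>(D \<mu>_i y_0, ..., D \<mu>_i y_n)\<close> for \<open>i < n\<close>.
\<close>

definition frobenius_det ::
    "nat \<Rightarrow> 'a::finite_field alg_closure point set \<Rightarrow> (nat \<Rightarrow> 'a ratfun \<Rightarrow> 'a ratfun) \<Rightarrow>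
      nat list \<Rightarrow> 'a ratfun"
  where "frobenius_det n V D \<mu> = ring_det (function_field n V) (Suc n)
    (\<lambda>i j. case i of
        0 \<Rightarrow> coord_fun n V j [^]\<^bsub>function_field n V\<^esub> CARD('a)
      | Suc i' \<Rightarrow> D (\<mu> ! i') (coord_fun n V j))"

definition frobenius_admissible ::
    "nat \<Rightarrow> 'a::finite_field alg_closure point set \<Rightarrow> (nat \<Rightarrow> 'a ratfun \<Rightarrow> 'a ratfun) \<Rightarrow>
      nat list \<Rightarrow> bool"
  where "frobenius_admissible n V D \<mu> \<longleftrightarrow> length \<mu> = n \<and> sorted_wrt (<) \<mu> \<and>
    frobenius_det n V D \<mu> \<noteq> \<zero>\<^bsub>function_field n V\<^esub>"

definition frobenius_order_sequence ::
    "nat \<Rightarrow> 'a::finite_field alg_closure point set \<Rightarrow> (nat \<Rightarrow> 'a ratfun \<Rightarrow> 'a ratfun) \<Rightarrow>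
      nat list \<Rightarrow> bool"
  where "frobenius_order_sequence n V D \<nu> \<longleftrightarrow> frobenius_admissible n V D \<nu> \<and>
    (\<forall>\<mu>. frobenius_admissible n V D \<mu> \<longrightarrow> \<nu> = \<mu> \<or> (\<nu>, \<mu>) \<in> lex less_than)"

text \<open>
  For a nondegenerate curve over \<open>F_q\<close>, separating elements \<open>\<zeta>\<close>, the Hasse derivatives with respect
  to \<open>\<zeta>\<close> and the order sequence exist, and the order sequence does not depend on \<open>\<zeta>\<close>.
\<close>

definition frobenius_nonclassical_curve ::
    "nat \<Rightarrow> 'a::finite_field alg_closure point set \<Rightarrow> bool"
  where "frobenius_nonclassical_curve n V \<longleftrightarrow>
    irreducible_curve n V \<and> closed_over_Fq n V \<and> nondegenerate n V \<and>
    (\<forall>\<zeta> D \<nu>. separating n V \<zeta> \<and>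
      hasse_derivatives (function_field n V) (constants n V) \<zeta> D \<and>
      frobenius_order_sequence n V D \<nu> \<longrightarrow> \<nu> \<noteq> [0..<n])"

section \<open>The Veronese embedding of the plane\<close>

definition veronese_dim :: "nat \<Rightarrow> nat"
  where "veronese_dim s = (s + 2 choose 2) - 1"

text \<open>
  With \<open>(X, Y, Z) = (v 0, v 1, v 2)\<close>, the monomial \<open>X^i Y^j Z^(s-i-j)\<close> has position
  \<open>prod_encode (j, i) = (i + j)(i + j + 1)/2 + j\<close> in the list \<open>Z^s\<close>, \<open>X Z^(s-1)\<close>, \<open>Y Z^(s-1)\<close>,
  \<open>X^2 Z^(s-2)\<close>, ..., \<open>Y^s\<close>, and \<open>i + j \<le> s\<close> says that the position is at most \<open>veronese_dim s\<close>.
\<close>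

definition veronese_vec :: "nat \<Rightarrow> (nat \<Rightarrow> 'd::comm_semiring_1) \<Rightarrow> nat \<Rightarrow> 'd"
  where "veronese_vec s v l = (case prod_decode l of (j, i) \<Rightarrow>
    if i + j \<le> s then v 0 ^ i * v 1 ^ j * v 2 ^ (s - i - j) else 0)"

definition veronese :: "nat \<Rightarrow> 'k::field point \<Rightarrow> 'k point"
  where "veronese s P = (\<Union>v\<in>P. proj_pt (veronese_vec s v))"

definition veronese_preimage :: "nat \<Rightarrow> 'k::field point set \<Rightarrow> 'k point set"
  where "veronese_preimage s V = {P \<in> proj_space 2. veronese s P \<in> V}"

definition veronese_pullback :: "nat \<Rightarrow> 'c::comm_semiring_1 mpoly \<Rightarrow> 'c mpoly"
  where "veronese_pullback s F = mp_subst mp_const (veronese_vec s mp_var) F"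

definition plane_degree :: "'k::field point set \<Rightarrow> nat"
  where "plane_degree C =
    (THE d. \<exists>G \<in> forms 2 d. Factorial_Ring.irreducible G \<and> C = zero_locus 2 {G})"

definition frobenius_nonclassical_wrt_curves_of_degree ::
    "nat \<Rightarrow> 'a::finite_field alg_closure point set \<Rightarrow> bool"
  where "frobenius_nonclassical_wrt_curves_of_degree s C \<longleftrightarrow>
    frobenius_nonclassical_curve (veronese_dim s) (veronese s ` C)"

end

theory Submission
  imports Defs
begin

text \<open>
  Let \<open>K\<close> be the function field of the curve \<open>V\<close> over the finite field
  with \<open>q\<close> elements, \<open>y_j = X_j / X_0\<close> its coordinate functions and \<open>z_j\<close> the partial derivatives
  of \<open>F\<close> on \<open>V\<close>, divided by one of them that does not vanish on \<open>V\<close>.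

  Euler's formula gives \<open>\<Sum> z_j y_j = 0\<close>, and Frobenius nonclassicality of the hypersurface gives
  \<open>\<Sum> z_j y_j ^ q = 0\<close>: at a regular point of the hypersurface this is the definition, and at a
  singular point all partial derivatives vanish. The functions \<open>z_j\<close> lie in the function field of the
  Gauss image. If one of them had a nonzero derivative, the field \<open>K\<close> would be separable over the
  field generated by this single function (lemma \<open>simple_root_if_derivation_nonzero\<close>), hence over
  the function field of the Gauss image, against inseparability. So the first derivative of every
  \<open>z_j\<close> vanishes. In orders below the characteristic the Hasse derivatives are iterates of the first
  one up to nonzero constants (lemma \<open>hasse_iterate\<close>), so all \<open>z_j\<close> behave as constants, and
  applying these derivatives to \<open>\<Sum> z_j y_j = 0\<close> yields \<open>\<Sum> z_j D_i y_j = 0\<close> for \<open>i < M < p\<close>. The nonzero vector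
  of the \<open>z_j\<close> is therefore in the kernel of the matrix with rows \<open>(y_j ^ q)\<close> and \<open>(D_i y_j)\<close>,
  \<open>i < M\<close>. Its determinant is zero, and \<open>0, ..., M - 1\<close> is not the Frobenius order sequence
  (lemma \<open>frobenius_det_eq_0\<close>). This is the second assertion.

  The first assertion is that an irreducible curve in the plane that is defined over the finite field
  is the zero locus of one form over the finite field that is irreducible over the algebraic closure.
  The forms vanishing on the preimage \<open>C\<close> of \<open>V\<close> form a prime ideal, because an \<open>s\<close>-th power of a form
  on the plane is the pullback of a form on the ambient space and \<open>V\<close> is irreducible. The ideal is not
  zero, because the Veronese surface contains the image of a line and so has dimension at least two.
  Pseudo-division and cancellation of linear factors show that the ideal is generated by one form
  (theorem \<open>form_generator\<close>). The Frobenius map preserves \<open>C\<close>, so it fixes the generator once a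
  coefficient is normalized to \<open>1\<close>, and the coefficients lie in the finite field (theorem
  \<open>preimage_is_plane_curve\<close>). The pullback of \<open>F\<close> vanishes on \<open>C\<close> and is a multiple of the generator.
\<close>

section \<open>Substitution homomorphisms\<close>

abbreviation (input) "lookup \<equiv> Poly_Mapping.lookup"
abbreviation (input) "keys \<equiv> Poly_Mapping.keys"
abbreviation (input) "single \<equiv> Poly_Mapping.single"

lemma mpoly_eq_sum_single:
  "G = (\<Sum>m\<in>keys G. single m (lookup G m))"
  by (rule poly_mapping_eqI) (auto simp: lookup_sum lookup_single when_def in_keys_iff)

lemma mpoly_induct [case_names zero single add]:
  fixes G :: "'c::comm_monoid_add mpoly"
  assumes "P 0" "\<And>m c. c \<noteq> 0 \<Longrightarrow> m \<in> keys G \<Longrightarrow> P (single m c)"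
    "\<And>A B. P A \<Longrightarrow> P B \<Longrightarrow> P (A + B)"
  shows "P G"
proof -
  have "P (\<Sum>m\<in>S. single m (lookup G m))"
    if "finite S" "S \<subseteq> keys G" for S
    using that
  proof (induction S)
    case (insert m S)
    have "lookup G m \<noteq> 0"
      using insert.prems by (simp add: in_keys_iff)
    thus ?case
      using insert assms(2,3) by simp
  qed (use assms in simp)
  from this[of "keys G"] show ?thesis
    by (subst mpoly_eq_sum_single) simp
qed

text \<open>
  The homomorphisms in question are identities, inclusions of constants, \<open>to_ac\<close>, Frobenius maps and
  the substitutions built from them. Each substitution is again an instance, so that the same rules
  serve for evaluation, pullback, change of coefficients and dehomogenization.
\<close>

locale type_ring_hom =
  fixes h :: "'c::comm_ring_1 \<Rightarrow> 'd::comm_ring_1"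
  assumes h_1 [simp]: "h 1 = 1"
    and h_add [simp]: "h (a + b) = h a + h b"
    and h_mult [simp]: "h (a * b) = h a * h b"
begin

lemma h_0 [simp]: "h 0 = 0"
  using h_add[of 0 0] by simp

lemma h_uminus [simp]: "h (- a) = - h a"
  using h_add[of a "- a"] by (simp add: eq_neg_iff_add_eq_0 add.commute)

lemma h_diff [simp]: "h (a - b) = h a - h b"
  using h_add[of a "- b"] by simp

lemma h_power [simp]: "h (a ^ n) = h a ^ n"
  by (induction n) auto

lemma h_sum: "h (sum f A) = (\<Sum>x\<in>A. h (f x))"
  by (induction A rule: infinite_finite_induct) auto

lemma h_prod: "h (prod f A) = (\<Prod>x\<in>A. h (f x))"
  by (induction A rule: infinite_finite_induct) auto

end

definition mon_val :: "(nat \<Rightarrow> 'd::comm_semiring_1) \<Rightarrow> (nat \<Rightarrow>\<^sub>0 nat) \<Rightarrow> 'd"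
  where "mon_val v m = (\<Prod>i\<in>keys m. v i ^ lookup m i)"

lemma mon_val_superset:
  assumes "finite S" "keys m \<subseteq> S"
  shows "mon_val v m = (\<Prod>i\<in>S. v i ^ lookup m i)"
  unfolding mon_val_def using assms by (intro prod.mono_neutral_left) (auto simp: in_keys_iff)

lemma mon_val_add: "mon_val v (m + m') = mon_val v m * mon_val v m'"
proof -
  let ?S = "keys m \<union> keys m'"
  have "keys (m + m') \<subseteq> ?S"
    by (rule keys_add)
  thus ?thesis
    by (simp add: mon_val_superset[of ?S] lookup_add power_add prod.distrib)
qed

lemma mon_val_0 [simp]: "mon_val v 0 = 1"
  by (simp add: mon_val_def)

lemma mon_val_single [simp]: "mon_val v (single i n) = v i ^ n"
  by (simp add: mon_val_def)

lemma mon_val_const_mult: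
  "mon_val (\<lambda>i. c i * v i) m = mon_val c m * mon_val v m"
  by (simp add: mon_val_def power_mult_distrib prod.distrib)

lemma mon_val_const: "mon_val (\<lambda>_. c) m = c ^ (\<Sum>i\<in>keys m. lookup m i)"
  by (simp add: mon_val_def power_sum)

context type_ring_hom
begin

lemma h_mon_val: "h (mon_val v m) = mon_val (\<lambda>i. h (v i)) m"
  by (simp add: mon_val_def h_prod)

lemma subst_superset:
  assumes "finite S" "keys G \<subseteq> S"
  shows "mp_subst h v G = (\<Sum>m\<in>S. h (lookup G m) * mon_val v m)"
  unfolding mp_subst_def mon_val_def using assms
  by (intro sum.mono_neutral_left) (auto simp: in_keys_iff)

lemma subst_0 [simp]: "mp_subst h v 0 = 0"
  by (simp add: mp_subst_def)

lemma subst_single [simp]: "mp_subst h v (single m c) = h c * mon_val v m"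
  by (cases "c = 0") (auto simp: mp_subst_def mon_val_def)

lemma subst_add [simp]: "mp_subst h v (A + B) = mp_subst h v A + mp_subst h v B"
proof -
  let ?S = "keys A \<union> keys B"
  have "keys (A + B) \<subseteq> ?S"
    by (rule keys_add)
  thus ?thesis
    by (simp add: subst_superset[of ?S] lookup_add distrib_right sum.distrib)
qed

lemma subst_single_mult:
  "mp_subst h v (single m c * B) = h c * mon_val v m * mp_subst h v B"
proof (induction B rule: mpoly_induct)
  case (single m' c')
  show ?case
    by (simp add: mult_single mon_val_add)
qed (simp_all add: distrib_left)

lemma subst_mult [simp]: "mp_subst h v (A * B) = mp_subst h v A * mp_subst h v B"
  by (induction A rule: mpoly_induct) (simp_all add: subst_single_mult distrib_right)

lemma subst_1 [simp]: "mp_subst h v 1 = 1"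
  using subst_single[of v 0 1] by simp

lemma subst_hom: "type_ring_hom (mp_subst h v)"
  by unfold_locales auto

lemma subst_const [simp]: "mp_subst h v (mp_const c) = h c"
  by (simp add: mp_const_def)

lemma subst_var [simp]: "mp_subst h v (mp_var i) = v i"
  by (simp add: mp_var_def)

lemmas subst_uminus [simp] = type_ring_hom.h_uminus[OF subst_hom]
  and subst_diff [simp] = type_ring_hom.h_diff[OF subst_hom]
  and subst_power [simp] = type_ring_hom.h_power[OF subst_hom]
  and subst_sum = type_ring_hom.h_sum[OF subst_hom]

end

lemma type_ring_hom_id: "type_ring_hom (\<lambda>c. c)"
  by unfold_locales auto

lemma type_ring_hom_comp:
  assumes "type_ring_hom h" "type_ring_hom g"
  shows "type_ring_hom (\<lambda>c. g (h c))"
proof -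
  interpret h: type_ring_hom h by fact
  interpret g: type_ring_hom g by fact
  show ?thesis by unfold_locales auto
qed

lemma mp_const_0 [simp]: "mp_const 0 = 0" and mp_const_1 [simp]: "mp_const 1 = 1"
  by (simp_all add: mp_const_def)

lemma mp_const_add: "mp_const (a + b) = mp_const a + mp_const b"
  by (simp add: mp_const_def single_add)

lemma mp_const_mult: "mp_const (a * b) = mp_const a * mp_const b"
  by (simp add: mp_const_def mult_single)

lemma type_ring_hom_const: "type_ring_hom mp_const"
  by unfold_locales (simp_all add: mp_const_add mp_const_mult)

lemma type_ring_hom_to_ac: "type_ring_hom to_ac"
  by unfold_locales simp_all

lemma type_ring_hom_pCons: "type_ring_hom (\<lambda>c. [:c:])"
  by unfold_locales (simp_all add: one_pCons)

lemmas eval_simps [simp] =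
  type_ring_hom.subst_0[OF type_ring_hom_id] type_ring_hom.subst_1[OF type_ring_hom_id]
  type_ring_hom.subst_add[OF type_ring_hom_id] type_ring_hom.subst_mult[OF type_ring_hom_id]
  type_ring_hom.subst_uminus[OF type_ring_hom_id] type_ring_hom.subst_diff[OF type_ring_hom_id]
  type_ring_hom.subst_power[OF type_ring_hom_id] type_ring_hom.subst_const[OF type_ring_hom_id]
  type_ring_hom.subst_var[OF type_ring_hom_id] type_ring_hom.subst_single[OF type_ring_hom_id]

interpretation mpc: type_ring_hom "mp_const :: 'c::comm_ring_1 \<Rightarrow> 'c mpoly"
  by (rule type_ring_hom_const)

lemma subst_compose:
  assumes "type_ring_hom h" "type_ring_hom g"
  shows "g (mp_subst h v G) = mp_subst (\<lambda>c. g (h c)) (\<lambda>i. g (v i)) G"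
proof -
  interpret h: type_ring_hom h by fact
  interpret g: type_ring_hom g by fact
  interpret gh: type_ring_hom "\<lambda>c. g (h c)"
    by (rule type_ring_hom_comp) fact+
  show ?thesis
  proof (induction G rule: mpoly_induct)
    case (single m c)
    show ?case
      by (simp only: h.subst_single gh.subst_single g.h_mult g.h_mon_val)
  qed (simp_all only: h.subst_0 h.subst_add gh.subst_0 gh.subst_add g.h_0 g.h_add)
qed

lemma single_eq_const_mon_val:
  "single m c = mp_const c * mon_val mp_var (m :: nat \<Rightarrow>\<^sub>0 nat)"
  for c :: "'c::comm_ring_1"
proof -
  have *: "mp_var i ^ n = (single (single i n) 1 :: 'c mpoly)" for i n
    by (induction n) (simp_all add: mp_var_def mult_single flip: single_add)
  have "(\<Prod>i\<in>S. single (single i (lookup m i)) 1)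
      = (single (\<Sum>i\<in>S. single i (lookup m i)) 1 :: 'c mpoly)"
    if "finite S" for S
    using that by induction (simp_all add: mult_single)
  from this[of "keys m"] have "mon_val mp_var m = (single m 1 :: 'c mpoly)"
    using mpoly_eq_sum_single[of m] by (simp add: mon_val_def *)
  thus ?thesis
    by (simp add: mp_const_def mult_single)
qed

lemma subst_var_id [simp]: "mp_subst mp_const mp_var G = G"
  for G :: "'c::comm_ring_1 mpoly"
  by (induction G rule: mpoly_induct) (simp_all flip: single_eq_const_mon_val)

lemma subst_cong:
  assumes "\<And>m i. m \<in> keys G \<Longrightarrow> i \<in> keys m \<Longrightarrow> v i = w i"
  shows "mp_subst h v G = mp_subst h w G"
  unfolding mp_subst_def using assms by (intro sum.cong arg_cong2[of _ _ _ _ "(*)"] prod.cong) auto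

section \<open>Change of the coefficient field\<close>

lemma lookup_base_change [simp]:
  "lookup (base_change G) m = to_ac (lookup G m)"
  by (simp add: base_change_def Poly_Mapping.map.rep_eq when_def)

lemma keys_base_change [simp]: "keys (base_change G) = keys G"
  by (auto simp: in_keys_iff)

lemma base_change_eq_iff [simp]: "base_change A = base_change B \<longleftrightarrow> A = B"
  by (metis lookup_base_change poly_mapping_eqI to_ac_eq_iff)

interpretation bc: type_ring_hom "\<lambda>c. mp_const (to_ac c) :: 'a::field alg_closure mpoly"
  using type_ring_hom_comp[OF type_ring_hom_to_ac type_ring_hom_const] .

lemma base_change_single [simp]:
  "base_change (single m c) = single m (to_ac c)"
  by (rule poly_mapping_eqI) (simp add: lookup_single when_def)

lemma base_change_hom_add [simp]: "base_change (A + B) = base_change A + base_change B"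
  by (rule poly_mapping_eqI) (simp add: lookup_add)

lemma base_change_0 [simp]: "base_change 0 = 0"
  by (rule poly_mapping_eqI) simp

lemma base_change_eq_subst: "base_change G = mp_subst (\<lambda>c. mp_const (to_ac c)) mp_var G"
  by (induction G rule: mpoly_induct) (simp_all flip: single_eq_const_mon_val)

lemma type_ring_hom_base_change: "type_ring_hom base_change"
  using bc.subst_hom[of mp_var] by (simp add: base_change_eq_subst[abs_def])

lemma base_change_eq_0_iff [simp]: "base_change G = 0 \<longleftrightarrow> G = 0"
  using base_change_eq_iff[of G 0] by (simp del: base_change_eq_iff)

lemma base_change_const [simp]: "base_change (mp_const c) = mp_const (to_ac c)"
  by (simp add: mp_const_def)

lemma base_change_var [simp]: "base_change (mp_var i) = mp_var i"
  by (simp add: mp_var_def)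

lemma base_change_subst:
  "base_change (mp_subst mp_const v G) = mp_subst mp_const (\<lambda>i. base_change (v i)) (base_change G)"
proof -
  have "base_change (mp_subst mp_const v G) = mp_subst (\<lambda>c. mp_const (to_ac c)) (\<lambda>i. base_change (v i)) G"
    using subst_compose[OF type_ring_hom_const type_ring_hom_base_change, of v G] by simp
  also have "\<dots> = mp_subst mp_const (\<lambda>i. base_change (v i)) (base_change G)"
    by (induction G rule: mpoly_induct) simp_all
  finally show ?thesis .
qed

section \<open>Forms\<close>

definition mdeg :: "(nat \<Rightarrow>\<^sub>0 nat) \<Rightarrow> nat"
  where "mdeg m = (\<Sum>i\<in>keys m. lookup m i)"

definition wdeg :: "(nat \<Rightarrow> nat) \<Rightarrow> (nat \<Rightarrow>\<^sub>0 nat) \<Rightarrow> nat"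
  where "wdeg w m = (\<Sum>i\<in>keys m. w i * lookup m i)"

lemma wdeg_superset:
  assumes "finite S" "keys m \<subseteq> S"
  shows "wdeg w m = (\<Sum>i\<in>S. w i * lookup m i)"
  unfolding wdeg_def using assms by (intro sum.mono_neutral_left) (auto simp: in_keys_iff)

lemma wdeg_add [simp]: "wdeg w (m + m') = wdeg w m + wdeg w m'"
proof -
  let ?S = "keys m \<union> keys m'"
  have "keys (m + m') \<subseteq> ?S"
    by (rule keys_add)
  thus ?thesis
    by (simp add: wdeg_superset[of ?S] lookup_add distrib_left sum.distrib)
qed

lemma mdeg_eq_wdeg: "mdeg = wdeg (\<lambda>_. 1)"
  by (rule ext) (simp add: mdeg_def wdeg_def)

lemma mdeg_add [simp]: "mdeg (m + m') = mdeg m + mdeg m'"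
  by (simp add: mdeg_eq_wdeg)

lemma mdeg_0 [simp]: "mdeg 0 = 0" and mdeg_single [simp]: "mdeg (single i n) = n"
  by (simp_all add: mdeg_def)

lemma mdeg_eq_0_iff: "mdeg m = 0 \<longleftrightarrow> m = 0"
  by (auto simp: mdeg_def in_keys_iff intro!: poly_mapping_eqI)

text \<open>
  Arbitrary sets of indices are allowed because binary forms in any two of the three plane
  coordinates occur, and because \<open>form_factor\<close> needs no bound on the indices.
\<close>

definition forms_in :: "nat set \<Rightarrow> nat \<Rightarrow> 'c::zero mpoly set"
  where "forms_in S d = {G. \<forall>m\<in>keys G. keys m \<subseteq> S \<and> mdeg m = d}"

lemma forms_eq_forms_in: "forms n d = forms_in {..n} d"
  by (simp add: forms_def forms_in_def mdeg_def)

lemma forms_in_mono: "G \<in> forms_in S d \<Longrightarrow> S \<subseteq> T \<Longrightarrow> G \<in> forms_in T d"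
  by (auto simp: forms_in_def)

lemma forms_in_0 [simp]: "0 \<in> forms_in S d"
  by (simp add: forms_in_def)

lemma forms_in_single: "keys m \<subseteq> S \<Longrightarrow> mdeg m = d \<Longrightarrow> single m c \<in> forms_in S d"
  by (auto simp: forms_in_def)

lemma forms_in_add: "A \<in> forms_in S d \<Longrightarrow> B \<in> forms_in S d \<Longrightarrow> A + B \<in> forms_in S d"
  using keys_add[of A B] unfolding forms_in_def by blast

lemma forms_in_uminus: "A \<in> forms_in S d \<Longrightarrow> - A \<in> forms_in S d" for A :: "'c::ab_group_add mpoly"
  by (auto simp: forms_in_def in_keys_iff)

lemma forms_in_diff: "A \<in> forms_in S d \<Longrightarrow> B \<in> forms_in S d \<Longrightarrow> A - B \<in> forms_in S d"
  for A :: "'c::ab_group_add mpoly"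
  using forms_in_add[OF _ forms_in_uminus, of A S d B] by simp

lemma forms_in_mult:
  assumes "A \<in> forms_in S d" "B \<in> forms_in S e"
  shows "A * B \<in> forms_in S (d + e)"
  unfolding forms_in_def
proof safe
  fix m assume "m \<in> keys (A * B)"
  then obtain a b where ab: "m = a + b" "a \<in> keys A" "b \<in> keys B"
    using keys_mult[of A B] by blast
  show "mdeg m = d + e"
    using ab assms by (simp add: forms_in_def)
  fix i assume "i \<in> keys m"
  thus "i \<in> S"
    using ab assms keys_add[of a b] unfolding forms_in_def by blast
qed

lemma forms_in_const: "mp_const c \<in> forms_in S 0"
  by (simp add: mp_const_def forms_in_single)

lemma forms_in_1: "1 \<in> forms_in S 0"
  by (auto simp: forms_in_def)

lemma forms_in_var: "i \<in> S \<Longrightarrow> mp_var i \<in> forms_in S 1"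
  by (simp add: mp_var_def forms_in_single)

lemma forms_in_power: "A \<in> forms_in S d \<Longrightarrow> A ^ n \<in> forms_in S (n * d)"
  for A :: "'c::comm_ring_1 mpoly"
  by (induction n) (auto intro: forms_in_mult forms_in_1)

lemma forms_in_sum: "(\<And>x. x \<in> N \<Longrightarrow> f x \<in> forms_in S d) \<Longrightarrow> sum f N \<in> forms_in S d"
  by (induction N rule: infinite_finite_induct) (auto intro: forms_in_add)

lemma forms_in_induct [consumes 1, case_names zero single add]:
  fixes G :: "'c::comm_monoid_add mpoly"
  assumes "G \<in> forms_in S d" "P 0"
    "\<And>m c. keys m \<subseteq> S \<Longrightarrow> mdeg m = d \<Longrightarrow> P (single m c)"
    "\<And>A B. P A \<Longrightarrow> P B \<Longrightarrow> P (A + B)"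
  shows "P G"
proof (rule mpoly_induct[of P G])
  fix m and c :: 'c assume "c \<noteq> 0" "m \<in> keys G"
  thus "P (single m c)"
    using assms(1,3) by (auto simp: forms_in_def)
qed (use assms in auto)

lemma forms_in_subst:
  fixes G :: "'c::comm_ring_1 mpoly"
  assumes "G \<in> forms_in S d" "\<And>i. i \<in> S \<Longrightarrow> v i \<in> forms_in T e"
  shows "mp_subst mp_const v G \<in> forms_in T (d * e)"
  using assms(1)
proof (induction rule: forms_in_induct)
  case (single m c)
  have "(\<Prod>i\<in>N. v i ^ lookup m i) \<in> forms_in T ((\<Sum>i\<in>N. lookup m i) * e)"
    if "finite N" "N \<subseteq> S" for N
    using that
  proof (induction N)
    case (insert i N)
    thus ?case
      using forms_in_mult[OF forms_in_power[OF assms(2)[of i], of "lookup m i"]]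
      by (simp add: distrib_right)
  qed (simp add: forms_in_1)
  from this[of "keys m"] have "mon_val v m \<in> forms_in T (d * e)"
    using single by (simp add: mon_val_def mdeg_def)
  thus ?case
    using forms_in_mult[OF forms_in_const] by simp
qed (auto intro: forms_in_add)

lemma base_change_forms_in [simp]: "base_change G \<in> forms_in S d \<longleftrightarrow> G \<in> forms_in S d"
  by (simp add: forms_in_def)

lemma subst_scale:
  assumes "type_ring_hom h" "G \<in> forms_in S d"
  shows "mp_subst h (\<lambda>i. c * v i) G = c ^ d * mp_subst h v G"
proof -
  interpret h: type_ring_hom h by fact
  show ?thesis
    using assms(2)
  proof (induction rule: forms_in_induct)
    case (single m a)
    thus ?case
      using mon_val_const[of c m] by (simp add: mon_val_const_mult mdeg_def)
  qed (simp_all add: distrib_left)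
qed

lemmas eval_scale = subst_scale[OF type_ring_hom_id]

lemma form_degree_0:
  assumes "G \<in> forms_in S 0"
  shows "G = mp_const (lookup G 0)"
proof (rule poly_mapping_eqI)
  fix m show "lookup G m = lookup (mp_const (lookup G 0)) m"
  proof (cases "m \<in> keys G")
    case True
    hence "m = 0"
      using assms by (auto simp: forms_in_def mdeg_eq_0_iff)
    thus ?thesis
      by (simp add: mp_const_def)
  next
    case False
    thus ?thesis
      by (cases "m = 0") (auto simp: mp_const_def in_keys_iff lookup_single)
  qed
qed

section \<open>Factors of forms are forms\<close>

text \<open>
  Marking the variable \<open>X_i\<close> with \<open>t ^ w i\<close> turns a polynomial into a univariate polynomial in \<open>t\<close>
  whose coefficients are its components of the various \<open>w\<close>-degrees. Homogeneity becomes being a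
  monomial in \<open>t\<close>, a property that passes to factors over a domain.
\<close>

definition grade :: "(nat \<Rightarrow> nat) \<Rightarrow> 'c::comm_ring_1 mpoly \<Rightarrow> 'c mpoly poly"
  where "grade w = mp_subst (\<lambda>c. [:mp_const c:]) (\<lambda>i. Polynomial.monom (mp_var i) (w i))"

lemma type_ring_hom_pc: "type_ring_hom (\<lambda>c::'c::comm_ring_1. [:mp_const c:])"
  using type_ring_hom_comp[OF type_ring_hom_const type_ring_hom_pCons] .

interpretation pc: type_ring_hom "\<lambda>c::'c::comm_ring_1. [:mp_const c:]"
  by (rule type_ring_hom_pc)

lemma type_ring_hom_grade: "type_ring_hom (grade w)"
  unfolding grade_def by (rule pc.subst_hom)

lemma grade_single:
  "grade w (single m c) = Polynomial.monom (single m c) (wdeg w m)"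
proof -
  have "(\<Prod>i\<in>N. Polynomial.monom (mp_var i) (w i) ^ lookup m i) =
      (Polynomial.monom (\<Prod>i\<in>N. mp_var i ^ lookup m i)
        (\<Sum>i\<in>N. w i * lookup m i) :: 'a mpoly poly)" if "finite N" for N
    using that by induction (simp_all add: Polynomial.monom_power Polynomial.mult_monom mult.commute)
  from this[of "keys m"]
  have "mon_val (\<lambda>i. Polynomial.monom (mp_var i) (w i)) m =
      (Polynomial.monom (mon_val mp_var m) (wdeg w m) :: 'a mpoly poly)"
    by (simp add: mon_val_def wdeg_def)
  thus ?thesis
    by (simp add: grade_def smult_monom single_eq_const_mon_val[symmetric])
qed

lemma lookup_coeff_grade:
  "lookup (Polynomial.coeff (grade w G) j) m =
    (if wdeg w m = j then lookup G m else 0)"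
proof -
  interpret g: type_ring_hom "grade w"
    by (rule type_ring_hom_grade)
  show ?thesis
    by (induction G rule: mpoly_induct)
      (auto simp: grade_single lookup_add lookup_single when_def)
qed

lemma grade_eq_monom_iff:
  "grade w G = Polynomial.monom G d \<longleftrightarrow> (\<forall>m\<in>keys G. wdeg w m = d)"
proof
  assume *: "grade w G = Polynomial.monom G d"
  show "\<forall>m\<in>keys G. wdeg w m = d"
  proof
    fix m assume "m \<in> keys G"
    thus "wdeg w m = d"
      using lookup_coeff_grade[of w G "wdeg w m" m] unfolding *
      by (cases "wdeg w m = d") (auto simp: in_keys_iff)
  qed
next
  assume *: "\<forall>m\<in>keys G. wdeg w m = d"
  show "grade w G = Polynomial.monom G d"
    using * by (intro poly_eqI poly_mapping_eqI) (auto simp: lookup_coeff_grade in_keys_iff)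
qed

lemma poly_grade_1 [simp]: "poly (grade w G) 1 = G"
proof -
  interpret g: type_ring_hom "grade w"
    by (rule type_ring_hom_grade)
  show ?thesis
    by (induction G rule: mpoly_induct) (auto simp: grade_single poly_monom)
qed

lemma monom_factor:
  fixes p q :: "'c::idom poly"
  assumes "p * q = Polynomial.monom c d" "c \<noteq> 0"
  shows "\<exists>b e. p = Polynomial.monom b e"
proof -
  have nz: "p \<noteq> 0" "q \<noteq> 0"
    using assms by auto
  have "Polynomial.order 0 p + Polynomial.order 0 q = Polynomial.degree p + Polynomial.degree q"
    using nz order_mult[of p q 0] Polynomial.degree_mult_eq[of p q] assms
    by (simp add: order_0_monom degree_monom_eq)
  moreover have "Polynomial.order 0 p \<le> Polynomial.degree p" "Polynomial.order 0 q \<le> Polynomial.degree q"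
    using nz by (auto intro: order_degree)
  ultimately have eq: "Polynomial.order 0 p = Polynomial.degree p"
    by linarith
  obtain r where r: "p = [:0, 1:] ^ Polynomial.degree p * r"
    using order_1[of 0 p] eq by (auto elim: dvdE)
  have "r \<noteq> 0"
    using r nz by auto
  hence "Polynomial.degree p = Polynomial.degree p + Polynomial.degree r"
    by (subst r) (simp add: Polynomial.degree_mult_eq degree_power_eq)
  then obtain b where b: "r = [:b:]"
    by (metis add_cancel_left_right degree_eq_zeroE)
  show ?thesis
    by (rule exI[of _ b], rule exI[of _ "Polynomial.degree p"], subst r)
      (simp add: b monom_altdef)
qed

lemma wdeg_factor:
  fixes A B :: "'c::idom mpoly"
  assumes "\<forall>m\<in>keys (A * B). wdeg w m = d" "A * B \<noteq> 0"
  shows "\<exists>e\<le>d. \<forall>m\<in>keys A. wdeg w m = e"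
proof -
  interpret g: type_ring_hom "grade w"
    by (rule type_ring_hom_grade)
  have eq: "grade w A * grade w B = Polynomial.monom (A * B) d"
    using assms grade_eq_monom_iff[of w "A * B" d] by simp
  from monom_factor[OF this assms(2)] obtain b e where b: "grade w A = Polynomial.monom b e"
    by blast
  have "b = A"
    using poly_grade_1[of w A] unfolding b by (simp add: poly_monom)
  moreover have "e \<le> d"
  proof -
    have "grade w B \<noteq> 0"
      using eq assms(2) by auto
    moreover have "A \<noteq> 0"
      using assms by auto
    ultimately have "e + Polynomial.degree (grade w B) = d"
      using arg_cong[OF eq, of Polynomial.degree] assms(2) unfolding b \<open>b = A\<close>
      by (simp add: degree_mult_eq degree_monom_eq)
    thus ?thesis by simp
  qed
  ultimately show ?thesis
    using b grade_eq_monom_iff[of w A e] by auto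
qed

lemma form_factor:
  fixes A B :: "'c::idom mpoly"
  assumes "A * B \<in> forms_in S d" "A * B \<noteq> 0"
  shows "\<exists>e\<le>d. A \<in> forms_in S e"
proof -
  from assms(1) have "\<forall>m\<in>keys (A * B). wdeg (\<lambda>_. 1) m = d"
    by (simp add: forms_in_def mdeg_eq_wdeg)
  from wdeg_factor[OF this assms(2)] obtain e where
    e: "e \<le> d" "\<forall>m\<in>keys A. mdeg m = e"
    by (auto simp: mdeg_eq_wdeg)
  \<comment> \<open>no variable outside \<open>S\<close> occurs in a factor, by the grading that counts these variables\<close>
  let ?w = "\<lambda>i. if i \<in> S then 0 else 1"
  have iff: "wdeg ?w m = 0 \<longleftrightarrow> keys m \<subseteq> S" for m
    by (auto simp: wdeg_def in_keys_iff)
  have "\<forall>m\<in>keys (A * B). wdeg ?w m = 0"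
    using assms(1) unfolding iff by (simp add: forms_in_def)
  from wdeg_factor[OF this assms(2)] have "\<forall>m\<in>keys A. keys m \<subseteq> S"
    unfolding iff[symmetric] by simp
  with e show ?thesis
    by (auto simp: forms_in_def)
qed

lemma form_cofactor:
  fixes A B :: "'c::idom mpoly"
  assumes "A * B \<in> forms_in S d" "A * B \<noteq> 0" "A \<in> forms_in S e"
  shows "B \<in> forms_in S (d - e)" "e \<le> d"
proof -
  obtain f where f: "B \<in> forms_in S f"
    using form_factor[of B A S d] assms(1,2) by (auto simp: mult.commute)
  have "A * B \<in> forms_in S (e + f)"
    using assms(3) f by (rule forms_in_mult)
  moreover obtain m where "m \<in> keys (A * B)"
    using assms(2) keys_eq_empty by blast
  ultimately have "d = e + f"
    using assms(1) by (auto simp: forms_in_def)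
  thus "B \<in> forms_in S (d - e)" "e \<le> d"
    using f by auto
qed

section \<open>Linear factors\<close>

text \<open>
  Modulo \<open>x\<close> the two substitutions are the same ring homomorphism.
\<close>

lemma dvd_subst_diff:
  assumes "type_ring_hom h" "\<And>i. x dvd v i - w i"
  shows "x dvd mp_subst h v P - mp_subst h w P"
proof -
  interpret h: type_ring_hom h by fact
  have pow: "x dvd v i ^ n - w i ^ n" for i n
    using assms(2)[of i] by (metis dvd_mult2 power_diff_sumr2)
  have "x dvd (\<Prod>i\<in>S. v i ^ f i) - (\<Prod>i\<in>S. w i ^ f i)" if "finite S" for S f
    using that
  proof induction
    case (insert i S)
    have "x dvd (v i ^ f i - w i ^ f i) * (\<Prod>i\<in>S. v i ^ f i) +
        w i ^ f i * ((\<Prod>i\<in>S. v i ^ f i) - (\<Prod>i\<in>S. w i ^ f i))"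
      using pow insert by (intro dvd_add dvd_mult dvd_mult2) auto
    thus ?case
      using insert by (simp add: algebra_simps)
  qed simp
  hence mon: "x dvd mon_val v m - mon_val w m" for m
    by (simp add: mon_val_def)
  show ?thesis
  proof (induction P rule: mpoly_induct)
    case (single m c)
    thus ?case
      using dvd_mult[OF mon, of "h c"] by (simp add: right_diff_distrib)
  next
    case (add A B)
    thus ?case
      using dvd_add[OF add] by (simp add: algebra_simps)
  qed simp
qed

definition subst_at :: "nat \<Rightarrow> 'c::comm_ring_1 mpoly \<Rightarrow> 'c mpoly \<Rightarrow> 'c mpoly"
  where "subst_at i q = mp_subst mp_const (mp_var(i := q))"

lemma type_ring_hom_subst_at: "type_ring_hom (subst_at i q)"
  unfolding subst_at_def by (rule type_ring_hom.subst_hom[OF type_ring_hom_const])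

lemma diff_subst_at_dvd: "mp_var i - q dvd P - subst_at i q P"
proof -
  have "mp_var i - q dvd mp_subst mp_const mp_var P - mp_subst mp_const (mp_var(i := q)) P"
    by (rule dvd_subst_diff[OF type_ring_hom_const]) simp
  thus ?thesis
    by (simp add: subst_at_def)
qed

text \<open>
  Modulo \<open>X_i - q\<close> every polynomial is congruent to the one obtained by substituting \<open>q\<close> for \<open>X_i\<close>, and
  this substitution annihilates \<open>X_i - q\<close> because \<open>q\<close> does not involve \<open>X_i\<close>.
\<close>

lemma linear_dvd_iff:
  assumes "q \<in> forms_in S d" "i \<notin> S"
  shows "mp_var i - q dvd P \<longleftrightarrow> subst_at i q P = 0"
proof
  interpret s: type_ring_hom "subst_at i q"
    by (rule type_ring_hom_subst_at)
  have "mp_subst mp_const (mp_var(i := q)) q = mp_subst mp_const mp_var q"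
    using assms by (intro subst_cong) (auto simp: forms_in_def)
  hence q: "subst_at i q q = q"
    by (simp add: subst_at_def)
  have "subst_at i q (mp_var i) = q"
    by (simp add: subst_at_def type_ring_hom.subst_var[OF type_ring_hom_const])
  thus "subst_at i q P = 0" if "mp_var i - q dvd P"
    using that q by (auto elim!: dvdE)
  show "mp_var i - q dvd P" if "subst_at i q P = 0"
    using diff_subst_at_dvd[of i q P] that by simp
qed

definition lin :: "nat \<Rightarrow> nat \<Rightarrow> 'c::comm_ring_1 \<Rightarrow> 'c mpoly"
  where "lin i j a = mp_var i - mp_const a * mp_var j"

lemma const_var_form: "mp_const a * mp_var j \<in> forms_in {j} 1"
  using forms_in_mult[OF forms_in_const forms_in_var, of j "{j}" a] by simp

lemma lin_form: "i \<in> S \<Longrightarrow> j \<in> S \<Longrightarrow> lin i j a \<in> forms_in S 1"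
  unfolding lin_def
  by (intro forms_in_diff forms_in_var forms_in_mono[OF const_var_form]) auto

lemma lin_dvd_iff: "i \<noteq> j \<Longrightarrow> lin i j a dvd P \<longleftrightarrow> subst_at i (mp_const a * mp_var j) P = 0"
  unfolding lin_def by (rule linear_dvd_iff[OF const_var_form]) auto

lemma lin_nonzero:
  assumes "i \<noteq> j" shows "lin i j a \<noteq> 0"
proof -
  have "mp_eval (\<lambda>k. if k = i then 1 else 0) (lin i j a) = 1"
    using assms by (simp add: lin_def)
  thus ?thesis
    by (metis eval_simps(1) zero_neq_one)
qed

text \<open>
  Divisibility by \<open>X_i - a X_j\<close> is the vanishing of a substitution homomorphism into a domain.
\<close>

lemma lin_prime:
  fixes A B :: "'c::idom mpoly"
  assumes "i \<noteq> j" "lin i j a dvd A * B"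
  shows "lin i j a dvd A \<or> lin i j a dvd B"
proof -
  interpret s: type_ring_hom "subst_at i (mp_const a * mp_var j)"
    by (rule type_ring_hom_subst_at)
  show ?thesis
    using assms by (simp add: lin_dvd_iff)
qed

section \<open>Binary forms\<close>

definition dehom :: "nat \<Rightarrow> 'c::comm_ring_1 mpoly \<Rightarrow> 'c poly"
  where "dehom i = mp_subst (\<lambda>c. [:c:]) (\<lambda>l. if l = i then [:0, 1:] else 1)"

lemma poly_dehom: "poly (dehom i r) t = mp_eval (\<lambda>l. if l = i then t else 1) r"
proof -
  have "type_ring_hom (\<lambda>p. poly p t)"
    by unfold_locales auto
  from subst_compose[OF type_ring_hom_pCons this] show ?thesis
    by (simp add: dehom_def if_distrib[of "\<lambda>p. poly p t"] cong: if_cong)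
qed

text \<open>
  Setting \<open>X_j = 1\<close> loses nothing on binary forms: the exponent of \<open>X_i\<close> and the degree determine a
  monomial.
\<close>

lemma coeff_dehom:
  assumes "r \<in> forms_in {i, j} n" "i \<noteq> j" "m \<in> keys r"
  shows "coeff (dehom i r) (lookup m i) = lookup r m"
proof -
  have mdeg2: "mdeg m' = lookup m' i + lookup m' j"
    if "keys m' \<subseteq> {i, j}" for m'
  proof -
    have "mdeg m' = (\<Sum>l\<in>{i, j}. lookup m' l)"
      unfolding mdeg_def using that by (intro sum.mono_neutral_left) (auto simp: in_keys_iff)
    thus ?thesis using assms(2) by simp
  qed
  have unique: "m' = m" if "m' \<in> keys r" "lookup m' i = lookup m i" for m'
  proof (rule poly_mapping_eqI)
    fix l
    have *: "keys m' \<subseteq> {i, j}" "mdeg m' = n" "keys m \<subseteq> {i, j}" "mdeg m = n"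
      using assms that by (auto simp: forms_in_def)
    hence "lookup m' j = lookup m j"
      using that(2) by (simp add: mdeg2)
    moreover have "l \<notin> {i, j} \<Longrightarrow> lookup m' l = 0 \<and> lookup m l = 0"
      using * by (meson in_keys_iff subsetD)
    ultimately show "lookup m' l = lookup m l"
      using that(2) by (cases "l \<in> {i, j}") auto
  qed
  have mon: "mon_val (\<lambda>l. if l = i then [:0, 1:] else 1) m' = Polynomial.monom (1::'a) (lookup m' i)"
    for m'
  proof -
    have "mon_val (\<lambda>l. if l = i then [:0, 1:] else 1) m' =
        (\<Prod>l\<in>insert i (keys m'). (if l = i then [:0, 1::'a:] else 1) ^ lookup m' l)"
      by (rule mon_val_superset) auto
    also have "\<dots> = [:0, 1:] ^ lookup m' i *
        (\<Prod>l\<in>keys m' - {i}. (if l = i then [:0, 1::'a:] else 1) ^ lookup m' l)"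
      by (subst prod.insert_remove) auto
    also have "(\<Prod>l\<in>keys m' - {i}. (if l = i then [:0, 1::'a:] else 1) ^ lookup m' l) = 1"
      by (rule prod.neutral) auto
    finally show ?thesis
      by (simp add: monom_altdef)
  qed
  have "dehom i r = (\<Sum>m'\<in>keys r.
      Polynomial.monom (lookup r m') (lookup m' i))"
    unfolding dehom_def
    by (subst type_ring_hom.subst_superset[OF type_ring_hom_pCons, of "keys r"])
      (auto simp: mon smult_monom)
  hence "coeff (dehom i r) (lookup m i) = (\<Sum>m'\<in>keys r.
      coeff (Polynomial.monom (lookup r m') (lookup m' i)) (lookup m i))"
    by (simp only: coeff_sum)
  also have "\<dots> = (\<Sum>m'\<in>keys r. if m' = m then lookup r m' else 0)"
    using unique by (intro sum.cong) (auto simp: assms)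
  finally show ?thesis
    using assms(3) by simp
qed

lemma dehom_nonzero:
  assumes "r \<in> forms_in {i, j} n" "i \<noteq> j" "r \<noteq> 0"
  shows "dehom i r \<noteq> 0"
proof -
  obtain m where "m \<in> keys r"
    using assms(3) keys_eq_empty by blast
  thus ?thesis
    using coeff_dehom[OF assms(1,2)] by (auto simp: in_keys_iff)
qed

lemma binary_form_nonvanishing:
  fixes r :: "'c::alg_closed_field mpoly"
  assumes "r \<in> forms_in {i, j} n" "i \<noteq> j" "r \<noteq> 0"
  shows "\<exists>t. mp_eval (\<lambda>l. if l = i then t else 1) r \<noteq> 0"
proof (cases "degree (dehom i r) = 0")
  case True
  then obtain c where "dehom i r = [:c:]"
    by (metis degree_eq_zeroE)
  thus ?thesis
    using dehom_nonzero[OF assms] poly_dehom[of i r] by auto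
next
  case False
  \<comment> \<open>a nonconstant polynomial takes the value \<open>1\<close>\<close>
  have "degree (dehom i r - 1) = degree (dehom i r)"
    using False degree_add_eq_left[of "-1" "dehom i r"] by simp
  then obtain t where "poly (dehom i r - 1) t = 0"
    using alg_closed_imp_poly_has_root[of "dehom i r - 1"] False by auto
  thus ?thesis
    using poly_dehom[of i r t] by (intro exI[of _ t]) auto
qed

text \<open>
  Either \<open>X_j\<close> divides \<open>r\<close>, or the monomial \<open>X_i ^ n\<close> occurs in \<open>r\<close>. In the second case the
  dehomogenization has positive degree, and a root \<open>a\<close> of it gives the factor \<open>X_i - a X_j\<close>.
\<close>

lemma binary_form_linear_factor:
  fixes r :: "'c::alg_closed_field mpoly"
  assumes r: "r \<in> forms_in {i, j} n" and "i \<noteq> j" "n > 0"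
  shows "\<exists>k l a. {k, l} = {i, j} \<and> k \<noteq> l \<and> lin k l a dvd r"
proof (cases "\<forall>m\<in>keys r. lookup m j > 0")
  case True
  have "mon_val (mp_var(j := 0)) m = (0 :: 'c mpoly)" if "m \<in> keys r" for m
  proof -
    have "lookup m j > 0" "j \<in> keys m"
      using True that by (auto simp: in_keys_iff)
    thus ?thesis
      unfolding mon_val_def by (intro prod_zero) (auto intro!: bexI[of _ j])
  qed
  hence "subst_at j (mp_const 0 * mp_var i) r = 0"
    unfolding subst_at_def
    by (subst type_ring_hom.subst_superset[OF type_ring_hom_const, of "keys r"]) auto
  hence "lin j i 0 dvd r"
    using assms by (subst lin_dvd_iff) auto
  thus ?thesis
    using assms by (intro exI[of _ j] exI[of _ i] exI[of _ 0]) auto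
next
  case False
  then obtain m where m: "m \<in> keys r" "lookup m j = 0"
    by auto
  have "mdeg m = (\<Sum>l\<in>{i, j}. lookup m l)"
    unfolding mdeg_def using m r by (intro sum.mono_neutral_left) (auto simp: in_keys_iff forms_in_def)
  hence "lookup m i = n"
    using m r assms(2) by (auto simp: forms_in_def)
  hence "coeff (dehom i r) n \<noteq> 0"
    using coeff_dehom[OF r assms(2) m(1)] m(1) by (simp add: in_keys_iff)
  hence "degree (dehom i r) > 0"
    using le_degree[of "dehom i r" n] assms(3) by simp
  then obtain a where "poly (dehom i r) a = 0"
    using alg_closed_imp_poly_has_root by blast
  hence 0: "mp_eval (\<lambda>l. if l = i then a else 1) r = 0"
    by (simp add: poly_dehom)
  have "subst_at i (mp_const a * mp_var j) r =
      mp_subst mp_const (\<lambda>l. mp_var j * mp_const (if l = i then a else 1)) r"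
    unfolding subst_at_def using r by (intro subst_cong) (auto simp: forms_in_def mult.commute)
  also have "\<dots> = mp_var j ^ n * mp_subst mp_const (\<lambda>l. mp_const (if l = i then a else 1)) r"
    by (rule subst_scale[OF type_ring_hom_const r])
  also have "mp_subst mp_const (\<lambda>l. mp_const (if l = i then a else 1)) r = mp_const 0"
    unfolding 0[symmetric] by (rule subst_compose[OF type_ring_hom_id type_ring_hom_const, symmetric])
  finally have "lin i j a dvd r"
    using assms by (subst lin_dvd_iff) auto
  thus ?thesis
    using assms by (intro exI[of _ i] exI[of _ j] exI[of _ a]) auto
qed

section \<open>Ternary forms as univariate polynomials\<close>

text \<open>
  The polynomial viewed as univariate in \<open>X_2\<close>, with coefficients free of \<open>X_2\<close>; this is the setting for
  division with remainder.
\<close>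

definition zpoly :: "'c::comm_ring_1 mpoly \<Rightarrow> 'c mpoly poly"
  where "zpoly = mp_subst (\<lambda>c. [:mp_const c:]) (\<lambda>i. if i = 2 then [:0, 1:] else [:mp_var i:])"

lemma type_ring_hom_zpoly: "type_ring_hom zpoly"
  unfolding zpoly_def by (rule type_ring_hom.subst_hom[OF type_ring_hom_pc])

interpretation zpoly: type_ring_hom "zpoly :: 'c::comm_ring_1 mpoly \<Rightarrow> _"
  by (rule type_ring_hom_zpoly)

lemma zpoly_var2 [simp]: "zpoly (mp_var 2) = [:0, 1:]"
  by (simp add: zpoly_def type_ring_hom.subst_var[OF type_ring_hom_pc])

lemma poly_zpoly [simp]: "poly (zpoly H) (mp_var 2) = H"
proof -
  have "type_ring_hom (\<lambda>p. poly p (mp_var 2 :: 'a mpoly))"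
    by unfold_locales auto
  from subst_compose[OF type_ring_hom_pc this]
  have "poly (zpoly H) (mp_var 2) =
      mp_subst mp_const (\<lambda>i. poly (if i = 2 then [:0, 1:] else [:mp_var i:]) (mp_var 2)) H"
    by (simp add: zpoly_def)
  also have "(\<lambda>i. poly (if i = 2 then [:0, 1:] else [:mp_var i:]) (mp_var 2)) = (mp_var :: _ \<Rightarrow> 'a mpoly)"
    by auto
  finally show ?thesis by simp
qed

lemma zpoly_eq_0_iff [simp]: "zpoly H = 0 \<longleftrightarrow> H = 0"
  using poly_zpoly[of H] by (metis poly_0 zpoly.h_0)

lemma zpoly_free:
  assumes "H \<in> forms_in {0, 1} d" shows "zpoly H = [:H:]"
proof -
  have "zpoly H = mp_subst (\<lambda>c. [:mp_const c:]) (\<lambda>i. [:mp_var i:]) H"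
    unfolding zpoly_def using assms by (intro subst_cong) (force simp: forms_in_def)
  also have "\<dots> = [:mp_subst mp_const mp_var H:]"
    by (rule subst_compose[OF type_ring_hom_const type_ring_hom_pCons, symmetric])
  finally show ?thesis by simp
qed

lemma coeff_zpoly:
  assumes "H \<in> forms_in {..2} d"
  shows "coeff (zpoly H) j \<in> forms_in {0, 1} (d - j) \<and> (j > d \<longrightarrow> coeff (zpoly H) j = 0)"
  using assms
proof (induction rule: forms_in_induct)
  case (single m c)
  define k m' where "k = lookup m 2" and "m' = m - single 2 k"
  have m: "m = m' + single 2 k"
    by (rule poly_mapping_eqI) (auto simp: m'_def k_def lookup_add lookup_minus lookup_single when_def)
  have "keys m' \<subseteq> {0, 1}"
  proof
    fix i assume i: "i \<in> keys m'"
    hence "i \<in> keys m" "i \<noteq> 2"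
      by (auto simp: m'_def k_def in_keys_iff lookup_minus lookup_single when_def split: if_splits)
    hence "i \<le> 2" "i \<noteq> 2"
      using single by auto
    thus "i \<in> {0, 1}" by auto
  qed
  moreover have "mdeg m' = d - k" "k \<le> d"
    using single arg_cong[OF m, of mdeg] by simp_all
  ultimately have f: "single m' c \<in> forms_in {0, 1} (d - k)"
    by (intro forms_in_single)
  have "mp_var 2 ^ k = (single (single 2 k) 1 :: 'a mpoly)"
    using single_eq_const_mon_val[of "single 2 k" "1 :: 'a"] by simp
  hence "single m c = single m' c * mp_var 2 ^ k"
    by (simp add: mult_single m)
  hence "zpoly (single m c) = [:single m' c:] * [:0, 1:] ^ k"
    by (simp add: zpoly_free[OF f])
  also have "\<dots> = Polynomial.monom (single m' c) k"
    by (simp add: monom_altdef)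
  finally show ?case
    using f \<open>k \<le> d\<close> by auto
qed (auto intro: forms_in_add)

section \<open>Prime ideals of plane curves are principal\<close>

text \<open>
  The ideal of an irreducible closed subset of the plane, only forms being of interest. The
  last assumption says that the ideal does not contain all linear forms through a point.
\<close>

locale plane_ideal =
  fixes I :: "'k::alg_closed_field mpoly set"
  assumes I_add: "A \<in> I \<Longrightarrow> B \<in> I \<Longrightarrow> A + B \<in> I"
    and I_mult: "A \<in> I \<Longrightarrow> C * A \<in> I"
    and I_1: "1 \<notin> I"
    and I_prime: "A \<in> forms_in {..2} d \<Longrightarrow> B \<in> forms_in {..2} e \<Longrightarrow> A * B \<in> I \<Longrightarrow> A \<in> I \<or> B \<in> I"
    and not_point: "\<not> (\<exists>p. (\<exists>i\<le>2. p i \<noteq> 0) \<and>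
      (\<forall>i\<le>2. \<forall>j\<le>2. mp_const (p i) * mp_var j - mp_const (p j) * mp_var i \<in> I))"
begin

lemma I_dvd: "A \<in> I \<Longrightarrow> A dvd B \<Longrightarrow> B \<in> I"
  using I_mult by (auto simp: mult.commute elim!: dvdE)

lemma I_diff: "A \<in> I \<Longrightarrow> B \<in> I \<Longrightarrow> A - B \<in> I"
  using I_add[of A "(-1) * B"] I_mult[of B "-1"] by simp

lemma I_const: "c \<noteq> 0 \<Longrightarrow> mp_const c \<notin> I"
  using I_mult[of "mp_const c" "mp_const (inverse c)"] I_1 by (auto simp flip: mp_const_mult)

text \<open>
  A binary form is a product of linear forms, and one of them lies in the prime ideal.
\<close>

lemma binary_imp_linear:
  assumes "r \<in> forms_in {i, j} n" "r \<in> I" "r \<noteq> 0" "i \<noteq> j" "i \<le> 2" "j \<le> 2"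
  shows "\<exists>k l a. {k, l} = {i, j} \<and> k \<noteq> l \<and> lin k l a \<in> I"
  using assms(1-3)
proof (induction n arbitrary: r)
  case 0
  hence r: "r = mp_const (lookup r 0)"
    using form_degree_0 by blast
  hence "lookup r 0 \<noteq> 0"
    using 0 by (metis mp_const_0)
  thus ?case
    using r 0 I_const by metis
next
  case (Suc n)
  obtain k l a where kl: "{k, l} = {i, j}" "k \<noteq> l" "lin k l a dvd r"
    using binary_form_linear_factor[OF Suc.prems(1) assms(4)] by auto
  then obtain r' where r': "r = lin k l a * r'"
    by (auto elim: dvdE)
  have lin: "lin k l a \<in> forms_in {i, j} 1"
    using kl by (intro lin_form) auto
  have r'_form: "r' \<in> forms_in {i, j} n"
    using form_cofactor(1)[OF _ _ lin, of r' "Suc n"] Suc.prems r' by simp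
  have "lin k l a \<in> I \<or> r' \<in> I"
    using Suc.prems r' assms
    by (intro I_prime[OF forms_in_mono[OF lin] forms_in_mono[OF r'_form]]) auto
  thus ?case
    using kl Suc.IH[OF r'_form] Suc.prems r' by auto
qed

lemma not_all_lin: "l \<le> 2 \<Longrightarrow> p l = 1 \<Longrightarrow> \<exists>i\<le>2. lin i l (p i) \<notin> I"
proof (rule ccontr)
  assume l: "l \<le> 2" "p l = 1" and "\<not> (\<exists>i\<le>2. lin i l (p i) \<notin> I)"
  hence *: "lin i l (p i) \<in> I" if "i \<le> 2" for i
    using that by auto
  have "mp_const (p i) * mp_var j - mp_const (p j) * mp_var i \<in> I" if "i \<le> 2" "j \<le> 2" for i j
  proof -
    have "mp_const (p i) * lin j l (p j) - mp_const (p j) * lin i l (p i) \<in> I"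
      using * that by (intro I_diff I_mult)
    thus ?thesis
      by (simp add: lin_def algebra_simps)
  qed
  thus False
    using not_point l by (metis zero_neq_one)
qed

text \<open>
  Eliminating \<open>X_k\<close> with the linear form turns \<open>H\<close> into a binary form of the ideal in the other two
  variables. If it were not zero, a linear factor of it would lie in the ideal as well, and two
  independent linear forms cut out a point.
\<close>

lemma linear_generates:
  assumes "lin k l a \<in> I" "k \<le> 2" "l \<le> 2" "k \<noteq> l" "H \<in> forms_in {..2} d" "H \<in> I"
  shows "lin k l a dvd H"
proof (rule ccontr)
  assume not: "\<not> lin k l a dvd H"
  define t where "t = 3 - k - l"
  have t: "t \<le> 2" "t \<noteq> k" "t \<noteq> l" "{..2} = {k, l, t}"
  proof -
    have "k = 0 \<or> k = 1 \<or> k = 2" "l = 0 \<or> l = 1 \<or> l = 2"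
      using assms(2,3) by auto
    thus "t \<le> 2" "t \<noteq> k" "t \<noteq> l" "{..2} = {k, l, t}"
      using assms(4) unfolding t_def by auto
  qed
  let ?q = "mp_const a * mp_var l"
  have "(mp_var(k := ?q)) i \<in> forms_in {l, t} 1" if "i \<in> {..2}" for i
    using that forms_in_var[of i "{l, t}"] forms_in_mono[OF const_var_form, of l "{l, t}" a]
    unfolding t(4) by auto
  hence "mp_subst mp_const (mp_var(k := ?q)) H \<in> forms_in {l, t} (d * 1)"
    by (rule forms_in_subst[OF assms(5)])
  hence form: "subst_at k ?q H \<in> forms_in {l, t} d"
    by (simp add: subst_at_def)
  have "H - subst_at k ?q H \<in> I"
    using I_dvd[OF assms(1)] diff_subst_at_dvd[of k ?q H] by (simp add: lin_def)
  hence "subst_at k ?q H \<in> I"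
    using I_diff[OF assms(6)] by fastforce
  moreover have "subst_at k ?q H \<noteq> 0"
    using not assms by (simp add: lin_dvd_iff)
  ultimately obtain u w b where u: "{u, w} = {l, t}" "u \<noteq> w" "lin u w b \<in> I"
    using binary_imp_linear[OF form] t assms by auto
  then consider "u = l" "w = t" | "u = t" "w = l"
    by (auto simp: doubleton_eq_iff)
  thus False
  proof cases
    case 1
    have "lin k t (a * b) = lin k l a + mp_const a * lin l t b"
      by (simp add: lin_def algebra_simps mp_const_mult)
    hence "lin k t (a * b) \<in> I"
      using assms u 1 I_add I_mult by metis
    moreover have "lin t t 1 \<in> I"
      using I_mult[OF assms(1), of 0] by (simp add: lin_def)
    ultimately have "\<forall>i\<in>{..2}. lin i t (if i = t then 1 else if i = l then b else a * b) \<in> I"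
      using t u 1 assms(4) unfolding t(4) by auto
    thus False
      using not_all_lin[of t "\<lambda>i. if i = t then 1 else if i = l then b else a * b"] t(1) by auto
  next
    case 2
    moreover have "lin l l 1 \<in> I"
      using I_mult[OF assms(1), of 0] by (simp add: lin_def)
    ultimately have "\<forall>i\<in>{..2}. lin i l (if i = l then 1 else if i = t then b else a) \<in> I"
      using t u assms(1,4) unfolding t(4) by auto
    thus False
      using not_all_lin[of l "\<lambda>i. if i = l then 1 else if i = t then b else a"] assms(3) by auto
  qed
qed

end

context plane_ideal
begin

text \<open>
  If no binary form in \<open>X_0\<close>, \<open>X_1\<close> lies in the ideal, take in it a form \<open>G\<close> of minimal degree in
  \<open>X_2\<close> and, among these, of minimal total degree. Pseudo-division by \<open>G\<close> shows that \<open>G\<close> divides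
  every form \<open>H\<close> of the ideal up to a power of its leading coefficient, which is a product of
  linear forms. These linear forms are prime and do not divide \<open>G\<close>, so they can be cancelled.
\<close>

lemma generator_if_no_binary:
  assumes no_binary: "\<And>r n. r \<in> forms_in {0, 1} n \<Longrightarrow> r \<in> I \<Longrightarrow> r = 0"
    and H0: "H0 \<in> forms_in {..2} d0" "H0 \<in> I" "H0 \<noteq> 0"
  shows "\<exists>e. \<exists>G \<in> forms_in {..2} e. G \<in> I \<and> G \<noteq> 0 \<and> (\<forall>d. \<forall>H \<in> forms_in {..2} d. H \<in> I \<longrightarrow> G dvd H)"
proof -
  define P where "P k e G \<longleftrightarrow> G \<in> forms_in {..2} e \<and> G \<in> I \<and> G \<noteq> 0 \<and> degree (zpoly G) = k" for k e G
  define k where "k = (LEAST k. \<exists>e G. P k e G)"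
  have "\<exists>e G. P (degree (zpoly H0)) e G"
    using H0 by (auto simp: P_def)
  hence k: "\<exists>e G. P k e G"
    unfolding k_def by (rule LeastI)
  have k_min: "k \<le> degree (zpoly H)" if "H \<in> forms_in {..2} d" "H \<in> I" "H \<noteq> 0" for H d
  proof -
    have "\<exists>e G. P (degree (zpoly H)) e G"
      using that unfolding P_def by blast
    thus ?thesis
      unfolding k_def by (rule Least_le)
  qed
  define e where "e = (LEAST e. \<exists>G. P k e G)"
  have "\<exists>G. P k e G"
    unfolding e_def using k by (rule LeastI_ex)
  then obtain G where "P k e G" by blast
  hence G: "G \<in> forms_in {..2} e" "G \<in> I" "G \<noteq> 0" "degree (zpoly G) = k"
    by (auto simp: P_def)
  have e_min: "e \<le> e'" if "P k e' G'" for e' G'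
    unfolding e_def using that by (intro Least_le) blast
  define g where "g = lead_coeff (zpoly G)"
  have g: "g \<noteq> 0" "g \<in> forms_in {0, 1} (e - k)" "k \<le> e"
    using G coeff_zpoly[OF G(1), of k] unfolding g_def by (auto simp: not_less[symmetric])
  have k_pos: "k > 0"
  proof (rule ccontr)
    assume "\<not> k > 0"
    then obtain c where c: "zpoly G = [:c:]"
      using G(4) by (metis degree_eq_zeroE gr0I)
    hence "G \<in> forms_in {0, 1} e"
      using poly_zpoly[of G] coeff_zpoly[OF G(1), of 0] by simp
    thus False
      using no_binary G by blast
  qed

  have division: "\<exists>n Q. g ^ n * H = Q * G" if "H \<in> forms_in {..2} d" "H \<in> I" for H d
    using that
  proof (induction "degree (zpoly H)" arbitrary: H d rule: less_induct)
    case (less H d)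
    show ?case
    proof (cases "H = 0")
      case True
      thus ?thesis by (metis mult_zero_left mult_zero_right)
    next
      case False
      define j h where "j = degree (zpoly H)" and "h = lead_coeff (zpoly H)"
      have kj: "k \<le> j"
        using k_min[OF less.prems False] by (simp add: j_def)
      have h: "h \<in> forms_in {0, 1} (d - j)" "j \<le> d"
        using coeff_zpoly[OF less.prems(1), of j] False unfolding h_def j_def
        by (auto simp: not_less[symmetric])
      define H1 where "H1 = g * H - h * mp_var 2 ^ (j - k) * G"
      have z: "zpoly H1 = smult g (zpoly H) - smult h (Polynomial.monom 1 (j - k) * zpoly G)"
        by (simp add: H1_def zpoly_free[OF g(2)] zpoly_free[OF h(1)] monom_altdef mult.assoc)
      have "coeff (zpoly H1) i = 0" if "i > j - 1" for i
      proof (cases "i = j")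
        case True
        thus ?thesis
          using kj G(4) by (simp add: z coeff_monom_mult g_def h_def j_def)
      next
        case False
        hence "i > j" using that by auto
        hence "coeff (zpoly H) i = 0" "coeff (zpoly G) (i - (j - k)) = 0"
          using kj G(4) by (auto simp: j_def intro!: coeff_eq_0)
        thus ?thesis
          by (simp add: z coeff_monom_mult)
      qed
      hence "degree (zpoly H1) \<le> j - 1"
        by (intro degree_le) auto
      hence "degree (zpoly H1) < degree (zpoly H)"
        using kj k_pos by (simp add: j_def)
      moreover have "H1 \<in> I"
        unfolding H1_def by (intro I_diff I_mult less.prems G)
      moreover have "H1 \<in> forms_in {..2} (e - k + d)"
      proof -
        have "g * H \<in> forms_in {..2} (e - k + d)"
          by (intro forms_in_mult less.prems forms_in_mono[OF g(2)]) auto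
        moreover have "h * mp_var 2 ^ (j - k) * G \<in> forms_in {..2} ((d - j) + (j - k) * 1 + e)"
          by (intro forms_in_mult G forms_in_power forms_in_mono[OF h(1)] forms_in_var) auto
        moreover have "(d - j) + (j - k) * 1 + e = e - k + d"
          using kj h(2) g(3) by simp
        ultimately show ?thesis
          unfolding H1_def by (auto intro: forms_in_diff)
      qed
      ultimately obtain n Q where nQ: "g ^ n * H1 = Q * G"
        using less.hyps by blast
      have "g ^ Suc n * H = (Q + g ^ n * h * mp_var 2 ^ (j - k)) * G"
        using nQ by (simp add: H1_def algebra_simps)
      thus ?thesis by blast
    qed
  qed

  have cancel: "G dvd H" if "c \<in> forms_in {0, 1} n" "c \<noteq> 0" "c * H = Q * G" for c n Q H
    using that
  proof (induction n arbitrary: c Q)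
    case 0
    define a where "a = lookup c 0"
    have c: "c = mp_const a"
      unfolding a_def using 0 form_degree_0 by blast
    hence "a \<noteq> 0" using 0 by auto
    hence inv: "mp_const (inverse a) * c = 1"
      by (simp add: c flip: mp_const_mult)
    have "mp_const (inverse a) * (c * H) = H"
      unfolding mult.assoc[symmetric] inv by (rule mult_1_left)
    moreover have "G dvd mp_const (inverse a) * (Q * G)"
      by simp
    ultimately show ?case
      using 0(3) by simp
  next
    case (Suc n)
    obtain u w a where u: "{u, w} = {0, 1::nat}" "u \<noteq> w" "lin u w a dvd c"
      using binary_form_linear_factor[OF Suc.prems(1)] by auto
    let ?l = "lin u w a"
    obtain c' where c': "c = ?l * c'"
      using u(3) by (rule dvdE)
    have l: "?l \<in> forms_in {0, 1} 1" "?l \<noteq> 0"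
    proof -
      have "u \<in> {0, 1}" "w \<in> {0, 1}"
        unfolding u(1)[symmetric] by simp_all
      thus "?l \<in> forms_in {0, 1} 1"
        by (rule lin_form)
      show "?l \<noteq> 0"
        using u(2) by (rule lin_nonzero)
    qed
    have l2: "?l \<in> forms_in {..2} 1"
      by (rule forms_in_mono[OF l(1)]) auto
    have c'_form: "c' \<in> forms_in {0, 1} n"
      using form_cofactor(1)[OF _ _ l(1), of c' "Suc n"] Suc.prems(1,2) unfolding c' by simp
    have "?l dvd Q * G"
      using Suc.prems(3) c' by (metis dvd_triv_left mult.assoc)
    moreover have "\<not> ?l dvd G"
    proof
      assume "?l dvd G"
      then obtain G2 where G2: "G = ?l * G2"
        by (rule dvdE)
      have form: "G2 \<in> forms_in {..2} (e - 1)" "1 \<le> e"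
        using form_cofactor[OF _ _ l2, of G2 e] G G2 by auto
      have "?l \<notin> I"
        using no_binary l by blast
      hence "G2 \<in> I"
        using I_prime[OF l2 form(1)] G G2 by auto
      moreover have "degree (zpoly G2) = k"
        using G(3,4) by (simp add: G2 zpoly_free[OF l(1)] degree_mult_eq)
      ultimately have "P k (e - 1) G2"
        using form G G2 by (auto simp: P_def)
      from e_min[OF this] form show False by simp
    qed
    ultimately have "?l dvd Q"
      using lin_prime[OF u(2)] by blast
    then obtain Q' where Q': "Q = ?l * Q'"
      by (rule dvdE)
    have "?l * (c' * H) = ?l * (Q' * G)"
      using Suc.prems(3) unfolding c' Q' by (simp add: mult.assoc)
    hence "c' * H = Q' * G"
      using l(2) by simp
    moreover have "c' \<noteq> 0"
      using Suc.prems(2) c' by auto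
    ultimately show ?case
      using Suc.IH[OF c'_form] by blast
  qed

  have "G dvd H" if "H \<in> forms_in {..2} d" "H \<in> I" for H d
    using division[OF that] cancel[OF forms_in_power[OF g(2)]] g(1) by auto
  thus ?thesis
    using G by blast
qed

theorem form_generator:
  assumes "H0 \<in> forms_in {..2} d0" "H0 \<in> I" "H0 \<noteq> 0"
  shows "\<exists>e. \<exists>G \<in> forms_in {..2} e. G \<in> I \<and> G \<noteq> 0 \<and> (\<forall>d. \<forall>H \<in> forms_in {..2} d. H \<in> I \<longrightarrow> G dvd H)"
proof (cases "\<exists>n. \<exists>r \<in> forms_in {0, 1} n. r \<in> I \<and> r \<noteq> 0")
  case True
  then obtain n r where r: "r \<in> forms_in {0, 1} n" "r \<in> I" "r \<noteq> 0"
    by blast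
  have "\<exists>k l a. {k, l} = {0, 1} \<and> k \<noteq> l \<and> lin k l a \<in> I"
    by (rule binary_imp_linear[OF r]) simp_all
  then obtain k l a where kl: "{k, l} = {0, 1}" "k \<noteq> l" "lin k l a \<in> I"
    by blast
  have "k \<in> {0, 1}" "l \<in> {0, 1}"
    unfolding kl(1)[symmetric] by simp_all
  hence kl2: "k \<le> 2" "l \<le> 2"
    by auto
  show ?thesis
  proof (intro exI[of _ 1] bexI[of _ "lin k l a"] conjI allI ballI impI)
    show "lin k l a \<noteq> 0"
      using kl by (intro lin_nonzero)
    show "lin k l a \<in> forms_in {..2} 1"
      using kl2 by (intro lin_form) auto
    fix d H assume "H \<in> forms_in {..2} d" "H \<in> I"
    thus "lin k l a dvd H"
      using linear_generates[OF kl(3) kl2 kl(2)] by blast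
  qed (rule kl(3))
next
  case False
  have "r = 0" if "r \<in> forms_in {0, 1} n" "r \<in> I" for r n
    using that False by (metis (full_types))
  from generator_if_no_binary[OF this assms] show ?thesis .
qed

text \<open>
  If \<open>G = A B\<close>, then one factor lies in the prime ideal, is a multiple of \<open>G\<close>, and the other factor is
  a unit.
\<close>

lemma generator_irreducible:
  assumes G: "G \<in> forms_in {..2} e" "G \<in> I" "G \<noteq> 0"
    and gen: "\<And>H d. H \<in> forms_in {..2} d \<Longrightarrow> H \<in> I \<Longrightarrow> G dvd H"
  shows "Factorial_Ring.irreducible G"
proof (rule irreducibleI)
  show "\<not> G dvd 1"
    using G I_1 I_dvd by blast
  fix A B assume AB: "G = A * B"
  have aux: "B' dvd 1" if "G = A' * B'" "A' \<in> I" "A' \<in> forms_in {..2} d" for A' B' d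
  proof -
    have "G dvd A'"
      using gen that(2,3) by blast
    then obtain A'' where "A' = G * A''"
      by (rule dvdE)
    hence "G * (A'' * B') = G * 1"
      using that(1) by (simp only: mult.assoc[symmetric] mult_1_right)
    hence "A'' * B' = 1"
      using G(3) by simp
    thus ?thesis by (metis dvd_triv_right)
  qed
  obtain a where a: "A \<in> forms_in {..2} a"
    using form_factor[of A B] G AB by auto
  obtain b where b: "B \<in> forms_in {..2} b"
    using form_factor[of B A] G AB by (auto simp: mult.commute)
  have "A \<in> I \<or> B \<in> I"
    using I_prime[OF a b] G AB by auto
  thus "A dvd 1 \<or> B dvd 1"
    using aux[OF AB _ a] aux[OF _ _ b, of A] AB mult.commute[of A B] by metis
qed (rule G(3))

end

section \<open>The Frobenius automorphism of the algebraic closure of a finite field\<close>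

lemma poly_eq_0_if_vanishes_on_subfield:
  fixes p :: "'a::finite_field alg_closure poly"
  assumes "\<And>c::'a. poly p (to_ac c) = 0" "degree p < CARD('a)"
  shows "p = 0"
proof (rule ccontr)
  assume "p \<noteq> 0"
  have "CARD('a) = card (range (to_ac :: 'a \<Rightarrow> _))"
    by (rule card_image[OF inj_to_ac, symmetric])
  also have "\<dots> \<le> card {x. poly p x = 0}"
    using assms(1) \<open>p \<noteq> 0\<close> by (intro card_mono poly_roots_finite) auto
  also have "\<dots> \<le> degree p"
    using \<open>p \<noteq> 0\<close> by (rule card_poly_roots_bound)
  finally show False
    using assms(2) by simp
qed

lemma card_field_gt_1: "CARD('a::finite_field) > 1"
proof -
  have "card {0, 1::'a} \<le> CARD('a)"
    by (rule card_mono) auto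
  thus ?thesis by simp
qed

text \<open>
  Both sides are monic of degree \<open>q\<close> in \<open>x\<close> and vanish on the finite field, which has \<open>q\<close> elements.
\<close>

lemma power_card_minus_self_factorization:
  "x ^ CARD('a) - x = (\<Prod>c\<in>UNIV. x - to_ac c)" for x :: "'a::finite_field alg_closure"
proof -
  let ?q = "CARD('a)"
  define P where "P = (\<Prod>c\<in>(UNIV :: 'a set). [:- to_ac c, 1:])"
  define p where "p = Polynomial.monom 1 ?q - [:0, 1:] - P"
  have q: "?q > 1"
    by (rule card_field_gt_1)
  have deg_P: "degree P = ?q"
    unfolding P_def by (subst degree_prod_sum_eq) auto
  have lead_P: "lead_coeff P = 1"
    unfolding P_def by (simp add: lead_coeff_prod)
  have "degree p \<le> ?q - 1"
  proof (rule degree_le, intro allI impI)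
    fix i assume "?q - 1 < i"
    hence "i = ?q \<or> i > ?q" by auto
    thus "coeff p i = 0"
    proof
      assume "i = ?q"
      thus ?thesis
        using q lead_P deg_P by (simp add: p_def coeff_eq_0)
    next
      assume "i > ?q"
      thus ?thesis
        using q deg_P by (simp add: p_def coeff_eq_0)
    qed
  qed
  moreover have "poly p (to_ac c) = 0" for c
  proof -
    have "poly P (to_ac c) = 0"
      unfolding P_def poly_prod by (intro prod_zero) auto
    moreover have "to_ac c ^ ?q = to_ac c"
      using finite_field_power_card_eq_same[of c] by (metis to_ac_power)
    ultimately show ?thesis
      by (simp add: p_def poly_monom)
  qed
  ultimately have "p = 0"
    using q by (intro poly_eq_0_if_vanishes_on_subfield) auto
  hence "poly p x = 0" by simp
  thus ?thesis
    by (simp add: p_def poly_monom P_def poly_prod)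
qed

lemma fixed_by_frobenius_imp_in_subfield:
  assumes "x ^ CARD('a) = x" shows "x \<in> range (to_ac :: 'a::finite_field \<Rightarrow> _)"
  using assms power_card_minus_self_factorization[of x] by auto

text \<open>
  As a polynomial in \<open>x\<close>, the difference of both sides has degree less than \<open>q\<close> and vanishes on
  the finite field, because \<open>y ^ q - y\<close> is the product of all \<open>y - c\<close> and hence invariant under
  translations by elements of the finite field.
\<close>

lemma power_card_add:
  "(x + y) ^ CARD('a) = x ^ CARD('a) + y ^ CARD('a)" for x y :: "'a::finite_field alg_closure"
proof -
  let ?q = "CARD('a)"
  have q: "?q > 1"
    by (rule card_field_gt_1)
  have translate: "(to_ac c + y) ^ ?q = to_ac c + y ^ ?q" for c
  proof -
    have "(to_ac c + y) ^ ?q - (to_ac c + y) = (\<Prod>b\<in>UNIV. to_ac c + y - to_ac b)"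
      by (rule power_card_minus_self_factorization)
    also have "\<dots> = (\<Prod>b\<in>UNIV. y - to_ac b)"
      by (rule prod.reindex_bij_witness[of _ "\<lambda>b. b + c" "\<lambda>b. b - c"]) auto
    also have "\<dots> = y ^ ?q - y"
      by (rule power_card_minus_self_factorization[symmetric])
    finally show ?thesis by (simp add: algebra_simps)
  qed
  define p where "p = [:y, 1:] ^ ?q - [:0, 1:] ^ ?q - [:y ^ ?q:]"
  have "degree p \<le> ?q - 1"
  proof (rule degree_le, intro allI impI)
    fix i assume i: "?q - 1 < i"
    have deg: "degree ([:a, 1:] ^ ?q) = ?q" "lead_coeff ([:a, 1:] ^ ?q) = 1" for a :: "'a alg_closure"
      by (simp add: degree_power_eq) (unfold lead_coeff_power, simp)
    show "coeff p i = 0"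
    proof (cases "i = ?q")
      case True
      thus ?thesis
        using q deg[of y] deg[of 0] by (simp add: p_def coeff_eq_0)
    next
      case False
      thus ?thesis
        using q i deg[of y] deg[of 0] by (simp add: p_def coeff_eq_0)
    qed
  qed
  moreover have "poly p (to_ac c) = 0" for c
    using translate[of c] finite_field_power_card_eq_same[of c]
    by (simp add: p_def poly_power add.commute flip: to_ac_power)
  ultimately have "p = 0"
    using q by (intro poly_eq_0_if_vanishes_on_subfield) auto
  hence "poly p x = 0" by simp
  thus ?thesis
    by (simp add: p_def poly_power add.commute diff_eq_eq)
qed

lemma type_ring_hom_frob: "type_ring_hom (\<lambda>c::'a::finite_field alg_closure. c ^ CARD('a))"
  by unfold_locales (simp_all add: power_card_add power_mult_distrib)

definition frob_coeffs :: "'a::finite_field alg_closure mpoly \<Rightarrow> 'a alg_closure mpoly"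
  where "frob_coeffs = mp_subst (\<lambda>c. mp_const (c ^ CARD('a))) mp_var"

lemma type_ring_hom_frob_const:
  "type_ring_hom (\<lambda>c::'a::finite_field alg_closure. mp_const (c ^ CARD('a)))"
  by (rule type_ring_hom_comp[OF type_ring_hom_frob type_ring_hom_const])

lemma type_ring_hom_frob_coeffs: "type_ring_hom frob_coeffs"
  unfolding frob_coeffs_def by (rule type_ring_hom.subst_hom[OF type_ring_hom_frob_const])

lemma lookup_frob_coeffs:
  "lookup (frob_coeffs G) m = lookup G m ^ CARD('a)"
  for G :: "'a::finite_field alg_closure mpoly"
proof -
  interpret f: type_ring_hom frob_coeffs
    by (rule type_ring_hom_frob_coeffs)
  have single: "frob_coeffs (single m c) = single m (c ^ CARD('a))"
    for m and c :: "'a alg_closure"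
    unfolding frob_coeffs_def
    by (subst type_ring_hom.subst_single[OF type_ring_hom_frob_const])
      (rule single_eq_const_mon_val[symmetric])
  show ?thesis
    by (induction G rule: mpoly_induct)
      (simp_all add: single lookup_add lookup_single when_def power_card_add)
qed

lemma frob_coeffs_form: "G \<in> forms_in S d \<Longrightarrow> frob_coeffs G \<in> forms_in S d"
  by (simp add: forms_in_def in_keys_iff lookup_frob_coeffs)

lemma eval_frob_coeffs:
  "mp_eval (\<lambda>i. v i ^ CARD('a)) (frob_coeffs G) = mp_eval v G ^ CARD('a)"
  for v :: "nat \<Rightarrow> 'a::finite_field alg_closure"
proof -
  have "mp_eval (\<lambda>i. v i ^ CARD('a)) (frob_coeffs G) =
      mp_subst (\<lambda>c. mp_eval (\<lambda>i. v i ^ CARD('a)) (mp_const (c ^ CARD('a))))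
        (\<lambda>i. mp_eval (\<lambda>i. v i ^ CARD('a)) (mp_var i)) G"
    unfolding frob_coeffs_def
    by (rule subst_compose[OF type_ring_hom_frob_const type_ring_hom.subst_hom[OF type_ring_hom_id]])
  also have "\<dots> = mp_eval v G ^ CARD('a)"
    using subst_compose[OF type_ring_hom_id type_ring_hom_frob, of v G] by simp
  finally show ?thesis .
qed

lemma frob_coeffs_fixed_imp_base_change:
  assumes "frob_coeffs G = G" shows "\<exists>G' :: 'a::finite_field mpoly. G = base_change G'"
proof -
  have "lookup G m \<in> range (to_ac :: 'a \<Rightarrow> _)" for m
    using lookup_frob_coeffs[of G m] assms by (intro fixed_by_frobenius_imp_in_subfield) simp
  hence *: "to_ac (of_ac (lookup G m)) = lookup G m" for m
    by (rule to_ac_of_ac)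
  have "G = base_change (Poly_Mapping.map of_ac G)"
    by (rule poly_mapping_eqI) (simp add: Poly_Mapping.map.rep_eq when_def *)
  thus ?thesis by blast
qed

lemma frob_coeffs_base_change [simp]: "frob_coeffs (base_change G) = base_change G"
  for G :: "'a::finite_field mpoly"
  by (rule poly_mapping_eqI)
    (simp add: lookup_frob_coeffs finite_field_power_card_eq_same flip: to_ac_power)

section \<open>Points and zero loci\<close>

definition vanishing :: "'k::field point set \<Rightarrow> 'k mpoly set"
  where "vanishing A = {H. \<forall>P\<in>A. \<forall>v\<in>P. mp_eval v H = 0}"

lemma vanishes_on_iff: "vanishes_on V G \<longleftrightarrow> base_change G \<in> vanishing V"
  by (simp add: vanishes_on_def vanishing_def)

lemma self_in_proj_pt [simp]: "v \<in> proj_pt v"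
  unfolding proj_pt_def by (auto intro!: exI[of _ 1])

lemma in_proj_ptD:
  assumes "w \<in> proj_pt v"
  shows "proj_pt w = proj_pt v" "v \<in> coord_vecs n \<Longrightarrow> w \<in> coord_vecs n"
proof -
  obtain c where c: "c \<noteq> 0" "w = (\<lambda>i. c * v i)"
    using assms unfolding proj_pt_def by blast
  show "proj_pt w = proj_pt v"
    unfolding proj_pt_def
  proof safe
    fix a :: 'a assume "a \<noteq> 0"
    thus "\<exists>b. (\<lambda>i. a * w i) = (\<lambda>i. b * v i) \<and> b \<noteq> 0"
      using c by (intro exI[of _ "a * c"]) (simp add: mult.assoc)
    show "\<exists>b. (\<lambda>i. a * v i) = (\<lambda>i. b * w i) \<and> b \<noteq> 0"
      using c \<open>a \<noteq> 0\<close> by (intro exI[of _ "a / c"]) simp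
  qed
  assume "v \<in> coord_vecs n"
  thus "w \<in> coord_vecs n"
    using c by (auto simp: coord_vecs_def fun_eq_iff)
qed

lemma proj_spaceE:
  assumes "P \<in> proj_space n"
  obtains v where "v \<in> coord_vecs n" "P = proj_pt v"
  using assms unfolding proj_space_def by blast

lemma proj_pt_in_space [simp]: "v \<in> coord_vecs n \<Longrightarrow> proj_pt v \<in> proj_space n"
  unfolding proj_space_def by blast

text \<open>
  Forms scale by a nonzero factor, so one coordinate vector of a point decides.
\<close>

lemma form_vanishes_on_point_iff:
  assumes "H \<in> forms_in S d"
  shows "(\<forall>w\<in>proj_pt v. mp_eval w H = 0) \<longleftrightarrow> mp_eval v H = 0"
  using eval_scale[OF assms] by (auto simp: proj_pt_def)

lemma proj_pt_in_zero_locus: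
  assumes "v \<in> coord_vecs n" "T \<subseteq> (\<Union>d. forms n d)"
  shows "proj_pt v \<in> zero_locus n T \<longleftrightarrow> (\<forall>G\<in>T. mp_eval v G = 0)"
proof -
  have "(\<forall>w\<in>proj_pt v. mp_eval w G = 0) \<longleftrightarrow> mp_eval v G = 0" if G: "G \<in> T" for G
  proof -
    obtain d where "G \<in> forms_in {..n} d"
      using assms(2) G by (auto simp: forms_eq_forms_in)
    thus ?thesis by (rule form_vanishes_on_point_iff)
  qed
  thus ?thesis
    using assms(1) unfolding zero_locus_def by auto
qed

lemma proj_pt_in_zero_locus_single:
  "v \<in> coord_vecs n \<Longrightarrow> H \<in> forms_in {..n} d \<Longrightarrow> proj_pt v \<in> zero_locus n {H} \<longleftrightarrow> mp_eval v H = 0"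
  by (subst proj_pt_in_zero_locus) (auto simp: forms_eq_forms_in)

lemma zero_locus_subset: "zero_locus n T \<subseteq> proj_space n"
  by (auto simp: zero_locus_def)

lemma zariski_closed_zero_locus:
  "T \<subseteq> (\<Union>d. forms n d) \<Longrightarrow> zariski_closed n (zero_locus n T)"
  by (auto simp: zariski_closed_def)

lemma base_change_in_forms: "G \<in> forms n d \<Longrightarrow> base_change G \<in> forms n d"
  by (simp add: forms_eq_forms_in)

lemma base_change_image_forms:
  assumes "T \<subseteq> (\<Union>d. forms n d)" shows "base_change ` T \<subseteq> (\<Union>d. forms n d)"
proof
  fix H assume "H \<in> base_change ` T"
  then obtain G where G: "G \<in> T" "H = base_change G"
    by (rule imageE)
  then obtain d where "G \<in> forms n d"
    using assms by blast
  thus "H \<in> (\<Union>d. forms n d)"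
    using G(2) base_change_in_forms by blast
qed

lemma vanishing_add: "A \<in> vanishing V \<Longrightarrow> B \<in> vanishing V \<Longrightarrow> A + B \<in> vanishing V"
  and vanishing_mult: "A \<in> vanishing V \<Longrightarrow> C * A \<in> vanishing V"
  by (simp_all add: vanishing_def)

text \<open>
  The zero loci of \<open>A\<close> and \<open>B\<close> are closed sets that cover \<open>V\<close>.
\<close>

lemma irreducible_closed_prime:
  assumes V: "irreducible_closed n V"
    and A: "A \<in> forms_in {..n} a" and B: "B \<in> forms_in {..n} b"
    and AB: "A * B \<in> vanishing V"
  shows "A \<in> vanishing V \<or> B \<in> vanishing V"
proof -
  have closed: "zariski_closed n (zero_locus n {H})" if "H \<in> forms_in {..n} d"
    for H :: "'a mpoly" and d
    using that by (intro zariski_closed_zero_locus) (auto simp: forms_eq_forms_in)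
  have space: "V \<subseteq> proj_space n"
  proof -
    obtain T where "V = zero_locus n T"
      using V by (auto simp: irreducible_closed_def zariski_closed_def)
    thus ?thesis
      by (simp add: zero_locus_subset)
  qed
  have "V \<subseteq> zero_locus n {A} \<union> zero_locus n {B}"
  proof
    fix P assume P: "P \<in> V"
    then obtain v where v: "v \<in> coord_vecs n" "P = proj_pt v"
      using space proj_spaceE by (metis subsetD)
    have "mp_eval v A * mp_eval v B = 0"
      using AB P v by (auto simp: vanishing_def)
    thus "P \<in> zero_locus n {A} \<union> zero_locus n {B}"
      using proj_pt_in_zero_locus_single[OF v(1) A] proj_pt_in_zero_locus_single[OF v(1) B] v(2)
      by auto
  qed
  hence "V \<subseteq> zero_locus n {A} \<or> V \<subseteq> zero_locus n {B}"
    using V closed[OF A] closed[OF B] unfolding irreducible_closed_def by blast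
  thus ?thesis
    by (auto simp: vanishing_def zero_locus_def)
qed

section \<open>The Veronese embedding\<close>

lemma veronese_vec_encode:
  "i + j \<le> s \<Longrightarrow> veronese_vec s v (prod_encode (j, i)) = v 0 ^ i * v 1 ^ j * v 2 ^ (s - i - j)"
  by (simp add: veronese_vec_def)

lemma prod_encode_le_veronese_dim:
  assumes "i + j \<le> s" shows "prod_encode (j, i) \<le> veronese_dim s"
proof -
  have mono: "triangle a \<le> triangle b" if "a \<le> b" for a b
    using that by (induction b) (auto simp: le_Suc_eq)
  have tri: "triangle n = (n + 1) choose 2" for n
    by (induction n) (auto simp: numeral_2_eq_2)
  have "prod_encode (j, i) \<le> triangle s + s"
    using mono[OF assms] assms by (simp add: prod_encode_def add.commute)
  also have "triangle s + s = veronese_dim s"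
    using tri[of "Suc s"] by (simp add: veronese_dim_def)
  finally show ?thesis .
qed

lemma veronese_vec_eq_0: "l > veronese_dim s \<Longrightarrow> veronese_vec s v l = 0"
  using prod_encode_le_veronese_dim[of "snd (prod_decode l)" "fst (prod_decode l)" s]
  by (auto simp: veronese_vec_def split: prod.splits)

lemma hom_veronese_vec:
  assumes "type_ring_hom g"
  shows "g (veronese_vec s v l) = veronese_vec s (\<lambda>i. g (v i)) l"
proof -
  interpret g: type_ring_hom g by fact
  show ?thesis by (simp add: veronese_vec_def split: prod.splits)
qed

lemma veronese_vec_scale: "veronese_vec s (\<lambda>i. c * v i) l = c ^ s * veronese_vec s v l"
proof -
  obtain j i where l: "prod_decode l = (j, i)" by fastforce
  have "(c * v 0) ^ i * (c * v 1) ^ j * (c * v 2) ^ (s - i - j) =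
      c ^ s * (v 0 ^ i * v 1 ^ j * v 2 ^ (s - i - j))" if "i + j \<le> s"
  proof -
    have "(c * v 0) ^ i * (c * v 1) ^ j * (c * v 2) ^ (s - i - j) =
        (c ^ i * c ^ j * c ^ (s - i - j)) * (v 0 ^ i * v 1 ^ j * v 2 ^ (s - i - j))"
      by (simp only: power_mult_distrib ac_simps)
    also have "c ^ i * c ^ j * c ^ (s - i - j) = c ^ s"
      using that by (simp flip: power_add)
    finally show ?thesis .
  qed
  thus ?thesis
    by (simp add: veronese_vec_def l)
qed

lemma veronese_vec_in_coord_vecs:
  fixes v :: "nat \<Rightarrow> 'k::field"
  assumes "v \<in> coord_vecs 2"
  shows "veronese_vec s v \<in> coord_vecs (veronese_dim s)"
proof -
  obtain i where i: "v i \<noteq> 0"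
    using assms by (auto simp: coord_vecs_def)
  hence "\<not> i > 2"
    using assms by (auto simp: coord_vecs_def)
  hence "i = 0 \<or> i = 1 \<or> i = 2" by auto
  moreover have "veronese_vec s v (prod_encode (0, s)) = v 0 ^ s"
    "veronese_vec s v (prod_encode (s, 0)) = v 1 ^ s" "veronese_vec s v (prod_encode (0, 0)) = v 2 ^ s"
    by (simp_all add: veronese_vec_encode)
  ultimately have "\<exists>l. veronese_vec s v l \<noteq> 0"
    using i by (metis power_not_zero)
  thus ?thesis
    by (auto simp: coord_vecs_def veronese_vec_eq_0)
qed

lemma veronese_proj_pt: "veronese s (proj_pt v) = proj_pt (veronese_vec s v)"
proof -
  have "proj_pt (veronese_vec s w) = proj_pt (veronese_vec s v)" if "w \<in> proj_pt v" for w
  proof -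
    from that obtain c where c: "c \<noteq> 0" "w = (\<lambda>i. c * v i)"
      by (auto simp: proj_pt_def)
    have "veronese_vec s w = (\<lambda>l. c ^ s * veronese_vec s v l)"
      unfolding c(2) by (rule ext) (rule veronese_vec_scale)
    hence "veronese_vec s w \<in> proj_pt (veronese_vec s v)"
      unfolding proj_pt_def using c(1) by (intro CollectI exI[of _ "c ^ s"]) simp
    thus ?thesis by (rule in_proj_ptD)
  qed
  moreover have "proj_pt v \<noteq> {}"
    using self_in_proj_pt[of v] by blast
  ultimately show ?thesis
    unfolding veronese_def by (intro SUP_eq_const)
qed

lemma eval_veronese_pullback:
  "mp_eval v (veronese_pullback s G) = mp_eval (veronese_vec s v) G"
  for G :: "'c::comm_ring_1 mpoly"
proof -
  have hom: "type_ring_hom (mp_eval v)"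
    by (rule type_ring_hom.subst_hom[OF type_ring_hom_id])
  show ?thesis
    unfolding veronese_pullback_def subst_compose[OF type_ring_hom_const hom]
    by (simp add: hom_veronese_vec[OF hom])
qed

lemma base_change_veronese_pullback:
  "base_change (veronese_pullback s G) = veronese_pullback s (base_change G)"
  unfolding veronese_pullback_def base_change_subst
  by (simp add: hom_veronese_vec[OF type_ring_hom_base_change])

lemma veronese_vec_var_form:
  "veronese_vec s mp_var l \<in> (forms_in {..2} s :: 'c::comm_ring_1 mpoly set)"
proof -
  obtain j i where l: "prod_decode l = (j, i)" by fastforce
  have "mp_var 0 ^ i * mp_var 1 ^ j * mp_var 2 ^ (s - i - j) \<in>
      (forms_in {..2} (i * 1 + j * 1 + (s - i - j) * 1) :: 'c mpoly set)"
    by (intro forms_in_mult forms_in_power forms_in_var) auto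
  moreover have "i * 1 + j * 1 + (s - i - j) * 1 = s" if "i + j \<le> s"
    using that by simp
  ultimately show ?thesis
    by (cases "i + j \<le> s") (simp_all add: veronese_vec_def l)
qed

lemma veronese_pullback_form:
  fixes G :: "'c::comm_ring_1 mpoly"
  assumes "G \<in> forms_in S d"
  shows "veronese_pullback s G \<in> forms_in {..2} (d * s)"
  unfolding veronese_pullback_def using assms by (rule forms_in_subst) (rule veronese_vec_var_form)

lemma type_ring_hom_veronese_pullback: "type_ring_hom (veronese_pullback s)"
  unfolding veronese_pullback_def by (rule type_ring_hom.subst_hom[OF type_ring_hom_const])

text \<open>
  A monomial of degree \<open>a s\<close> in three variables is a product of \<open>a\<close> monomials of degree \<open>s\<close>.
\<close>

lemma veronese_pullback_surj:
  fixes H :: "'c::comm_ring_1 mpoly"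
  assumes "H \<in> forms_in {..2} (a * s)"
  shows "\<exists>H' \<in> forms_in {..veronese_dim s} a. veronese_pullback s H' = H"
proof -
  interpret vp: type_ring_hom "veronese_pullback s"
    by (rule type_ring_hom_veronese_pullback)
  have mono: "\<exists>H' \<in> forms_in {..veronese_dim s} a.
      veronese_pullback s H' = mp_var 0 ^ x * mp_var 1 ^ y * (mp_var 2 ^ z :: 'c mpoly)"
    if "x + y + z = a * s" for a x y z
    using that
  proof (induction a arbitrary: x y z)
    case 0
    thus ?case
      by (intro bexI[of _ 1]) (auto intro: forms_in_1)
  next
    case (Suc a)
    define i where "i = min x s"
    define j where "j = min y (s - i)"
    have ij: "i \<le> x" "j \<le> y" "i + j \<le> s" "s - i - j \<le> z"
      using Suc.prems by (auto simp: i_def j_def min_def)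
    hence "(x - i) + (y - j) + (z - (s - i - j)) = a * s"
      using Suc.prems by simp
    from Suc.IH[OF this] obtain H' where H': "H' \<in> forms_in {..veronese_dim s} a"
      "veronese_pullback s H' = mp_var 0 ^ (x - i) * mp_var 1 ^ (y - j) * (mp_var 2 ^ (z - (s - i - j)) :: 'c mpoly)"
      by blast
    let ?l = "prod_encode (j, i)"
    have "veronese_pullback s (mp_var ?l) = mp_var 0 ^ i * mp_var 1 ^ j * (mp_var 2 ^ (s - i - j) :: 'c mpoly)"
      using ij(3) by (simp add: veronese_pullback_def type_ring_hom.subst_var[OF type_ring_hom_const] veronese_vec_encode)
    hence "veronese_pullback s (mp_var ?l * H') =
        (mp_var 0 ^ i * mp_var 0 ^ (x - i)) * (mp_var 1 ^ j * mp_var 1 ^ (y - j)) *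
        (mp_var 2 ^ (s - i - j) * mp_var 2 ^ (z - (s - i - j)) :: 'c mpoly)"
      by (simp only: vp.h_mult H'(2) ac_simps)
    also have "\<dots> = mp_var 0 ^ x * mp_var 1 ^ y * mp_var 2 ^ z"
      using ij by (simp flip: power_add)
    finally have "veronese_pullback s (mp_var ?l * H') = mp_var 0 ^ x * mp_var 1 ^ y * mp_var 2 ^ z" .
    moreover have "mp_var ?l * H' \<in> forms_in {..veronese_dim s} (1 + a)"
      using ij(3) by (intro forms_in_mult H' forms_in_var) (simp add: prod_encode_le_veronese_dim)
    ultimately show ?case
      unfolding plus_1_eq_Suc by blast
  qed
  show ?thesis
    using assms
  proof (induction rule: forms_in_induct)
    case zero
    show ?case by (intro bexI[of _ 0]) auto
  next
    case (single m c)
    let ?e = "lookup m"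
    have "mon_val mp_var m = (\<Prod>i\<in>{..2}. mp_var i ^ ?e i :: 'c mpoly)"
      using single by (intro mon_val_superset) auto
    hence m: "mon_val mp_var m = mp_var 0 ^ ?e 0 * mp_var 1 ^ ?e 1 * (mp_var 2 ^ ?e 2 :: 'c mpoly)"
      by (simp add: numeral_2_eq_2)
    have "mdeg m = (\<Sum>i\<in>{..2}. ?e i)"
      unfolding mdeg_def using single by (intro sum.mono_neutral_left) (auto simp: in_keys_iff)
    hence "?e 0 + ?e 1 + ?e 2 = a * s"
      using single by (simp add: numeral_2_eq_2)
    from mono[OF this] obtain H' where H': "H' \<in> forms_in {..veronese_dim s} a"
      "veronese_pullback s H' = (mon_val mp_var m :: 'c mpoly)"
      unfolding m by blast
    have "veronese_pullback s (mp_const c) = mp_const c"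
      by (simp add: veronese_pullback_def type_ring_hom.subst_const[OF type_ring_hom_const])
    hence "veronese_pullback s (mp_const c * H') = single m c"
      by (simp only: vp.h_mult H'(2) single_eq_const_mon_val)
    moreover have "mp_const c * H' \<in> forms_in {..veronese_dim s} (0 + a)"
      by (intro forms_in_mult H' forms_in_const)
    ultimately show ?case
      unfolding add_0 by blast
  next
    case (add A B)
    then obtain A' B' where "A' \<in> forms_in {..veronese_dim s} a" "veronese_pullback s A' = A"
      "B' \<in> forms_in {..veronese_dim s} a" "veronese_pullback s B' = B"
      by blast
    thus ?case
      by (intro bexI[of _ "A' + B'"]) (simp_all add: forms_in_add)
  qed
qed

section \<open>Curves on the Veronese surface\<close>

locale veronese_curve =
  fixes s M :: nat and V :: "'a::finite_field alg_closure point set"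
  assumes s_pos: "s > 0" and M_def: "M = veronese_dim s"
    and V_sub: "V \<subseteq> veronese s ` proj_space 2"
    and curve: "irreducible_curve M V"
    and over_Fq: "closed_over_Fq M V"
begin

definition C where "C = veronese_preimage s V"

lemma irred: "irreducible_closed M V"
  using curve by (simp add: irreducible_curve_def)

lemma V_eq: "V = veronese s ` C"
  using V_sub unfolding C_def veronese_preimage_def by blast

lemma proj_pt_in_C: "v \<in> coord_vecs 2 \<Longrightarrow> proj_pt v \<in> C \<longleftrightarrow> proj_pt (veronese_vec s v) \<in> V"
  by (simp add: C_def veronese_preimage_def veronese_proj_pt)

lemma C_E:
  assumes "P \<in> C" obtains v where "v \<in> coord_vecs 2" "P = proj_pt v"
  using assms unfolding C_def veronese_preimage_def by (auto elim: proj_spaceE)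

lemma form_in_vanishing_C:
  assumes "H \<in> forms_in S d"
  shows "H \<in> vanishing C \<longleftrightarrow> (\<forall>v\<in>coord_vecs 2. proj_pt v \<in> C \<longrightarrow> mp_eval v H = 0)"
proof
  show "\<forall>v\<in>coord_vecs 2. proj_pt v \<in> C \<longrightarrow> mp_eval v H = 0" if "H \<in> vanishing C"
    using that self_in_proj_pt unfolding vanishing_def by blast
  show "H \<in> vanishing C" if *: "\<forall>v\<in>coord_vecs 2. proj_pt v \<in> C \<longrightarrow> mp_eval v H = 0"
    unfolding vanishing_def
  proof safe
    fix P v assume "P \<in> C" "v \<in> P"
    moreover from this(1) obtain w where "w \<in> coord_vecs 2" "P = proj_pt w"
      by (rule C_E)
    ultimately show "mp_eval v H = 0"
      using * form_vanishes_on_point_iff[OF assms, of w] by blast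
  qed
qed

lemma pullback_in_vanishing:
  assumes "G \<in> forms_in S d"
  shows "veronese_pullback s G \<in> vanishing C \<longleftrightarrow> G \<in> vanishing V"
proof -
  have "G \<in> vanishing V \<longleftrightarrow> (\<forall>P\<in>C. \<forall>w\<in>veronese s P. mp_eval w G = 0)"
    using V_eq by (auto simp: vanishing_def)
  also have "\<dots> \<longleftrightarrow> (\<forall>v\<in>coord_vecs 2. proj_pt v \<in> C \<longrightarrow> (\<forall>w\<in>veronese s (proj_pt v). mp_eval w G = 0))"
    using C_E by metis
  also have "\<dots> \<longleftrightarrow> (\<forall>v\<in>coord_vecs 2. proj_pt v \<in> C \<longrightarrow> mp_eval v (veronese_pullback s G) = 0)"
    by (simp add: veronese_proj_pt form_vanishes_on_point_iff[OF assms] eval_veronese_pullback)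
  finally show ?thesis
    using form_in_vanishing_C[OF veronese_pullback_form[OF assms]] by simp
qed

text \<open>
  Irreducibility is known for \<open>V\<close> and hence concerns forms on the ambient space. These pull back only to
  forms whose degree is a multiple of \<open>s\<close>, which is why \<open>s\<close>-th powers are taken.
\<close>

lemma vanishing_C_prime:
  assumes A: "A \<in> forms_in {..2} a" and B: "B \<in> forms_in {..2} b" and AB: "A * B \<in> vanishing C"
  shows "A \<in> vanishing C \<or> B \<in> vanishing C"
proof -
  have lift: "\<exists>H' \<in> forms_in {..M} d. veronese_pullback s H' = H ^ s" if "H \<in> forms_in {..2} d"
    for H :: "'a alg_closure mpoly" and d
    unfolding M_def using forms_in_power[OF that, of s]
    by (intro veronese_pullback_surj) (simp add: mult.commute)
  have root: "H \<in> vanishing C" if "H ^ s \<in> vanishing C" for H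
    using that s_pos by (auto simp: vanishing_def)
  obtain A' where A': "A' \<in> forms_in {..M} a" "veronese_pullback s A' = A ^ s"
    using lift[OF A] by blast
  obtain B' where B': "B' \<in> forms_in {..M} b" "veronese_pullback s B' = B ^ s"
    using lift[OF B] by blast
  have "veronese_pullback s (A' * B') = A ^ s * B ^ s"
    using A' B' type_ring_hom.h_mult[OF type_ring_hom_veronese_pullback] by metis
  moreover have "A ^ s * B ^ s \<in> vanishing C"
    using AB s_pos by (auto simp: vanishing_def)
  ultimately have "A' * B' \<in> vanishing V"
    using pullback_in_vanishing[OF forms_in_mult[OF A'(1) B'(1)]] by simp
  hence "A' \<in> vanishing V \<or> B' \<in> vanishing V"
    by (rule irreducible_closed_prime[OF irred A'(1) B'(1)])
  thus ?thesis
    using pullback_in_vanishing[OF A'(1)] pullback_in_vanishing[OF B'(1)] A' B' root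
    by auto
qed

lemma V_nonempty: "V \<noteq> {}" and V_not_point: "V \<noteq> {P}"
  using curve by (auto simp: irreducible_curve_def irreducible_closed_def)

text \<open>
  If the ideal contained the equations of a point, then \<open>C\<close> and its image \<open>V\<close> would consist of at most
  one point.
\<close>

lemma plane_ideal_C: "plane_ideal (vanishing C)"
proof
  show "1 \<notin> vanishing C"
  proof
    assume "1 \<in> vanishing C"
    hence "P = {}" if "P \<in> C" for P
      using that by (auto simp: vanishing_def)
    moreover obtain P where "P \<in> C"
      using V_nonempty V_eq by blast
    ultimately show False
      by (metis C_E self_in_proj_pt empty_iff)
  qed
  show "\<not> (\<exists>p. (\<exists>i\<le>2. p i \<noteq> 0) \<and>
      (\<forall>i\<le>2. \<forall>j\<le>2. mp_const (p i) * mp_var j - mp_const (p j) * mp_var i \<in> vanishing C))"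
  proof safe
    fix p i assume i: "i \<le> (2 :: nat)" "p i \<noteq> 0"
      and p: "\<forall>i\<le>2. \<forall>j\<le>2. mp_const (p i) * mp_var j - mp_const (p j) * mp_var i \<in> vanishing C"
    define p' where "p' = (\<lambda>i. if i \<le> 2 then p i else 0)"
    have "P = proj_pt p'" if P: "P \<in> C" for P
    proof -
      obtain v where v: "v \<in> coord_vecs 2" "P = proj_pt v"
        using P by (rule C_E)
      have eq: "p i * v j = p j * v i" if "j \<le> 2" for j
        using p i that P v(2) self_in_proj_pt[of v] by (fastforce simp: vanishing_def)
      have v_eq: "v = (\<lambda>j. (v i / p i) * p' j)"
      proof
        fix j show "v j = (v i / p i) * p' j"
          using eq[of j] i v(1) by (auto simp: p'_def coord_vecs_def field_simps)
      qed
      hence "v i / p i \<noteq> 0"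
        using v(1) by (auto simp: coord_vecs_def)
      hence "v \<in> proj_pt p'"
        using v_eq unfolding proj_pt_def by blast
      thus ?thesis
        using v(2) in_proj_ptD(1) by blast
    qed
    hence "V \<subseteq> {veronese s (proj_pt p')}"
      using V_eq by blast
    thus False
      using V_nonempty V_not_point by blast
  qed
qed (use vanishing_C_prime in \<open>auto intro: vanishing_add vanishing_mult\<close>)

text \<open>
  The image of the line \<open>X_0 = 0\<close> would be a proper closed subset of \<open>V\<close> with more than one point. It
  is irreducible: two closed sets covering it, neither of which contains it, would give two nonzero
  binary forms whose product vanishes on the whole line. This contradicts dimension one.
\<close>

lemma not_whole_surface:
  assumes all: "\<And>v. v \<in> coord_vecs 2 \<Longrightarrow> proj_pt (veronese_vec s v) \<in> V"
  shows False
proof -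
  define l where "l = prod_encode (0, s)"
  have val: "veronese_vec s v l = v 0 ^ s" for v :: "nat \<Rightarrow> 'b::comm_semiring_1"
    by (simp add: l_def veronese_vec_encode)
  have "l \<le> M"
    unfolding l_def M_def by (rule prod_encode_le_veronese_dim) simp
  obtain T where T: "T \<subseteq> (\<Union>d. forms M d)" "V = zero_locus M T"
    using irred by (auto simp: irreducible_closed_def zariski_closed_def)
  define W where "W = zero_locus M (insert (mp_var l) T)"
  have lT: "insert (mp_var l) T \<subseteq> (\<Union>d. forms M d)"
    using T \<open>l \<le> M\<close> forms_in_var[of l "{..M}"] by (auto simp: forms_eq_forms_in)
  have W_iff: "proj_pt (veronese_vec s v) \<in> W \<longleftrightarrow> v 0 = 0" if "v \<in> coord_vecs 2" for v
  proof -
    have c: "veronese_vec s v \<in> coord_vecs M"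
      using veronese_vec_in_coord_vecs[OF that] by (simp add: M_def)
    show ?thesis
      using all[OF that] s_pos unfolding T(2) W_def
      by (simp add: proj_pt_in_zero_locus[OF c lT] proj_pt_in_zero_locus[OF c T(1)] val)
  qed
  have WV: "W \<subseteq> V"
    by (auto simp: W_def T zero_locus_def)
  have W_E: "\<exists>v. v \<in> coord_vecs 2 \<and> v 0 = 0 \<and> P = proj_pt (veronese_vec s v)" if "P \<in> W" for P
  proof -
    have "P \<in> veronese s ` proj_space 2"
      using that WV V_sub by blast
    then obtain v where "v \<in> coord_vecs 2" "P = proj_pt (veronese_vec s v)"
      by (auto simp: veronese_proj_pt elim!: proj_spaceE)
    thus ?thesis
      using that W_iff by blast
  qed
  define e :: "nat \<Rightarrow> nat \<Rightarrow> 'a alg_closure" where "e = (\<lambda>i j. if j = i then 1 else 0)"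
  have e: "e i \<in> coord_vecs 2" if "i \<le> 2" for i
    using that by (auto simp: e_def coord_vecs_def fun_eq_iff)
  have "irreducible_closed M W"
    unfolding irreducible_closed_def
  proof (intro conjI allI impI)
    show "zariski_closed M W"
      unfolding W_def using lT by (rule zariski_closed_zero_locus)
    show "W \<noteq> {}"
      using W_iff[OF e, of 1] by (auto simp: e_def)
    fix B B' assume *: "zariski_closed M B \<and> zariski_closed M B' \<and> W \<subseteq> B \<union> B'"
    show "W \<subseteq> B \<or> W \<subseteq> B'"
    proof (rule ccontr)
      assume not: "\<not> (W \<subseteq> B \<or> W \<subseteq> B')"
      \<comment> \<open>a closed set that does not contain the image of the line gives a nonzero form on the line\<close>
      have aux: "\<exists>r n. r \<in> forms_in {1, 2} n \<and> r \<noteq> 0 \<and> (\<forall>u\<in>coord_vecs 2. u 0 = 0 \<longrightarrow>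
          proj_pt (veronese_vec s u) \<in> D \<longrightarrow> mp_eval u r = 0)"
        if D: "zariski_closed M D" "\<not> W \<subseteq> D" for D
      proof -
        obtain TD where TD: "TD \<subseteq> (\<Union>d. forms M d)" "D = zero_locus M TD"
          using D by (auto simp: zariski_closed_def)
        obtain P where P: "P \<in> W" "P \<notin> D"
          using D by blast
        then obtain v where v: "v \<in> coord_vecs 2" "v 0 = 0" "P = proj_pt (veronese_vec s v)"
          using W_E by blast
        have in_D: "proj_pt (veronese_vec s u) \<in> D \<longleftrightarrow> (\<forall>G\<in>TD. mp_eval (veronese_vec s u) G = 0)"
          if "u \<in> coord_vecs 2" for u
          unfolding TD(2) M_def
          using veronese_vec_in_coord_vecs[OF that] TD(1)
          by (intro proj_pt_in_zero_locus) (simp_all add: M_def)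
        obtain G where G: "G \<in> TD" "mp_eval (veronese_vec s v) G \<noteq> 0"
          using P v in_D by blast
        obtain d where d: "G \<in> forms_in {..M} d"
          using G TD(1) by (auto simp: forms_eq_forms_in)
        define r where "r = subst_at 0 0 (veronese_pullback s G)"
        have "(mp_var(0 := 0)) i \<in> forms_in {1, 2} 1" if "i \<in> {..2::nat}" for i
        proof -
          have "i = 0 \<or> i = 1 \<or> i = 2"
            using that by auto
          thus ?thesis
            using forms_in_var[of i "{1, 2}"] by auto
        qed
        hence "mp_subst mp_const (mp_var(0 := 0)) (veronese_pullback s G) \<in> forms_in {1, 2} (d * s * 1)"
          by (rule forms_in_subst[OF veronese_pullback_form[OF d]])
        hence r: "r \<in> forms_in {1, 2} (d * s)"
          by (simp add: r_def subst_at_def)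
        have eval_r: "mp_eval u r = mp_eval (veronese_vec s u) G" if "u 0 = 0" for u
        proof -
          have hom: "type_ring_hom (mp_eval u)"
            by (rule type_ring_hom.subst_hom[OF type_ring_hom_id])
          have "(\<lambda>i. mp_eval u ((mp_var(0 := 0)) i)) = u"
            using that by (auto simp: fun_eq_iff)
          hence "mp_eval u r = mp_eval u (veronese_pullback s G)"
            using subst_compose[OF type_ring_hom_const hom, of "mp_var(0 := 0)" "veronese_pullback s G"]
            by (simp add: r_def subst_at_def)
          thus ?thesis by (simp add: eval_veronese_pullback)
        qed
        have "r \<noteq> 0"
          using eval_r[of v, OF v(2)] G(2) by auto
        moreover have "mp_eval u r = 0"
          if "u \<in> coord_vecs 2" "u 0 = 0" "proj_pt (veronese_vec s u) \<in> D" for u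
          using that in_D G eval_r by simp
        ultimately show ?thesis
          using r by blast
      qed
      obtain r n where r: "r \<in> forms_in {1, 2} n" "r \<noteq> 0"
        "\<And>u. u \<in> coord_vecs 2 \<Longrightarrow> u 0 = 0 \<Longrightarrow> proj_pt (veronese_vec s u) \<in> B \<Longrightarrow> mp_eval u r = 0"
        using aux[of B] * not by blast
      obtain r' n' where r': "r' \<in> forms_in {1, 2} n'" "r' \<noteq> 0"
        "\<And>u. u \<in> coord_vecs 2 \<Longrightarrow> u 0 = 0 \<Longrightarrow> proj_pt (veronese_vec s u) \<in> B' \<Longrightarrow> mp_eval u r' = 0"
        using aux[of B'] * not by blast
      have "r * r' \<in> forms_in {1, 2} (n + n')" "r * r' \<noteq> 0"
        using r r' by (auto intro: forms_in_mult)
      then obtain t where t: "mp_eval (\<lambda>l. if l = 1 then t else 1) (r * r') \<noteq> 0"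
        using binary_form_nonvanishing[of "r * r'" 1 2] by auto
      \<comment> \<open>\<open>X_0\<close> does not occur in the binary forms, but it must be \<open>0\<close> on the line\<close>
      define u where "u = (\<lambda>l::nat. if l = 1 then t else if l = 2 then 1 else 0)"
      have "mp_eval (\<lambda>l. if l = 1 then t else 1) (r * r') = mp_eval u (r * r')"
        using \<open>r * r' \<in> _\<close> by (intro subst_cong) (force simp: u_def forms_in_def)
      hence "mp_eval u r \<noteq> 0" "mp_eval u r' \<noteq> 0"
        using t by auto
      moreover have u: "u \<in> coord_vecs 2" "u 0 = 0"
        by (auto simp: u_def coord_vecs_def fun_eq_iff)
      ultimately have "proj_pt (veronese_vec s u) \<notin> B \<union> B'"
        using r(3) r'(3) by blast
      thus False
        using * W_iff[OF u(1)] u(2) by blast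
    qed
  qed
  moreover have "W \<noteq> V"
    using W_iff[OF e, of 0] all[OF e, of 0] by (auto simp: e_def)
  ultimately obtain P where P: "W = {P}"
    using curve WV unfolding irreducible_curve_def by blast
  have "proj_pt (veronese_vec s (e 1)) = proj_pt (veronese_vec s (e 2))"
    using W_iff[OF e, of 1] W_iff[OF e, of 2] P by (auto simp: e_def)
  hence "veronese_vec s (e 1) \<in> proj_pt (veronese_vec s (e 2))"
    by (metis self_in_proj_pt)
  then obtain c where "veronese_vec s (e 1) = (\<lambda>i. c * veronese_vec s (e 2) i)"
    unfolding proj_pt_def by blast
  hence "veronese_vec s (e 1) (prod_encode (s, 0)) = c * veronese_vec s (e 2) (prod_encode (s, 0))"
    by metis
  thus False
    using s_pos by (simp add: veronese_vec_encode e_def zero_power)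
qed

text \<open>
  Pullbacks of all forms vanishing on \<open>V\<close> are collected, not only those from some system of equations
  of \<open>V\<close>, so that no choice is involved.
\<close>

definition eqns :: "'a mpoly set"
  where "eqns = {veronese_pullback s G | G. G \<in> (\<Union>d. forms M d) \<and> vanishes_on V G}"

lemma eqns_forms: "eqns \<subseteq> (\<Union>d. forms 2 d)"
  using veronese_pullback_form by (fastforce simp: eqns_def forms_eq_forms_in)

lemma C_eq: "C = zero_locus 2 (base_change ` eqns)"
proof -
  obtain T where T: "T \<subseteq> (\<Union>d. forms M d)" "V = zero_locus M (base_change ` T)"
    using over_Fq by (auto simp: closed_over_Fq_def)
  note forms = base_change_image_forms[OF T(1)] base_change_image_forms[OF eqns_forms]
  have *: "proj_pt v \<in> C \<longleftrightarrow> proj_pt v \<in> zero_locus 2 (base_change ` eqns)" if v: "v \<in> coord_vecs 2" for v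
  proof
    assume "proj_pt v \<in> C"
    hence "proj_pt (veronese_vec s v) \<in> V"
      using v by (simp add: proj_pt_in_C)
    hence "mp_eval v (base_change H) = 0" if "H \<in> eqns" for H
      using that by (auto simp: eqns_def base_change_veronese_pullback eval_veronese_pullback
          vanishes_on_def intro: self_in_proj_pt)
    thus "proj_pt v \<in> zero_locus 2 (base_change ` eqns)"
      by (simp add: proj_pt_in_zero_locus[OF v forms(2)])
  next
    assume 0: "proj_pt v \<in> zero_locus 2 (base_change ` eqns)"
    have "mp_eval (veronese_vec s v) (base_change G) = 0" if G: "G \<in> T" for G
    proof -
      have "vanishes_on V G"
        using G by (auto simp: T(2) vanishes_on_def zero_locus_def)
      moreover have "G \<in> (\<Union>d. forms M d)"
        using G T(1) by (rule subsetD[rotated])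
      ultimately have "veronese_pullback s G \<in> eqns"
        unfolding eqns_def by blast
      thus ?thesis
        using 0 by (auto simp: proj_pt_in_zero_locus[OF v forms(2)]
            base_change_veronese_pullback eval_veronese_pullback)
    qed
    hence "proj_pt (veronese_vec s v) \<in> V"
      using veronese_vec_in_coord_vecs[OF v, of s] forms(1)
      by (simp add: T(2) proj_pt_in_zero_locus flip: M_def)
    thus "proj_pt v \<in> C"
      using v by (simp add: proj_pt_in_C)
  qed
  show ?thesis
  proof (rule equalityI; rule subsetI)
    fix P assume P: "P \<in> C"
    then obtain v where "v \<in> coord_vecs 2" "P = proj_pt v" by (rule C_E)
    thus "P \<in> zero_locus 2 (base_change ` eqns)" using * P by blast
  next
    fix P assume P: "P \<in> zero_locus 2 (base_change ` eqns)"
    hence "P \<in> proj_space 2" using zero_locus_subset by blast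
    then obtain v where "v \<in> coord_vecs 2" "P = proj_pt v" by (rule proj_spaceE)
    thus "P \<in> C" using * P by blast
  qed
qed

lemma exists_nonzero_equation: "\<exists>d. \<exists>H \<in> forms_in {..2} d. H \<in> vanishing C \<and> H \<noteq> 0"
proof (rule ccontr)
  assume *: "\<not> ?thesis"
  have "H = 0" if H: "H \<in> eqns" for H
  proof -
    obtain d where "base_change H \<in> forms_in {..2} d"
      using H eqns_forms by (auto simp: forms_eq_forms_in)
    moreover have "base_change H \<in> vanishing C"
      using H unfolding C_eq by (auto simp: vanishing_def zero_locus_def)
    ultimately show ?thesis
      using * base_change_eq_0_iff by blast
  qed
  hence "base_change ` eqns \<subseteq> {0}"
    by auto
  hence "C = proj_space 2"
    unfolding C_eq zero_locus_def by fastforce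
  thus False
    using not_whole_surface proj_pt_in_C by auto
qed

lemma frobenius_preserves_C:
  assumes "v \<in> coord_vecs 2" "w \<in> coord_vecs 2" "\<And>i. w i = v i ^ CARD('a)" "proj_pt w \<in> C"
  shows "proj_pt v \<in> C"
proof -
  note forms = base_change_image_forms[OF eqns_forms]
  have w: "w = (\<lambda>i. v i ^ CARD('a))"
    using assms(3) by auto
  have "mp_eval v (base_change H) = 0" if "H \<in> eqns" for H
  proof -
    have "mp_eval v (base_change H) ^ CARD('a) = mp_eval w (base_change H)"
      using eval_frob_coeffs[of v "base_change H"] unfolding w by simp
    also have "\<dots> = 0"
      using assms(4) that by (simp add: C_eq proj_pt_in_zero_locus[OF assms(2) forms])
    finally show ?thesis by simp
  qed
  thus ?thesis
    by (simp add: C_eq proj_pt_in_zero_locus[OF assms(1) forms])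
qed

text \<open>
  Every point of \<open>C\<close> is the Frobenius image of a point of \<open>C\<close>, since coordinates have \<open>q\<close>-th roots in the
  algebraic closure and \<open>C\<close> has equations over the finite field.
\<close>

lemma frob_coeffs_vanishing_C:
  assumes H: "H \<in> forms_in {..2} d" "H \<in> vanishing C"
  shows "frob_coeffs H \<in> vanishing C"
  unfolding form_in_vanishing_C[OF frob_coeffs_form[OF H(1)]]
proof safe
  fix w :: "nat \<Rightarrow> 'a alg_closure" assume w: "w \<in> coord_vecs 2" "proj_pt w \<in> C"
  have q: "CARD('a) > 0" by simp
  have "\<exists>y. w i = y ^ CARD('a)" for i
  proof -
    obtain y where "y ^ CARD('a) = w i"
      using nth_root_exists[OF q] by blast
    thus ?thesis
      by (intro exI[of _ y]) (rule sym)
  qed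
  then obtain v where v: "w i = v i ^ CARD('a)" for i
    by metis
  have "v \<in> coord_vecs 2"
    using w(1) v by (auto simp: coord_vecs_def fun_eq_iff)
  hence "proj_pt v \<in> C"
    using frobenius_preserves_C w v by blast
  hence "mp_eval v H = 0"
    using H form_in_vanishing_C \<open>v \<in> coord_vecs 2\<close> by blast
  moreover have "w = (\<lambda>i. v i ^ CARD('a))"
    using v by auto
  ultimately show "mp_eval w (frob_coeffs H) = 0"
    using eval_frob_coeffs[of v H] by simp
qed

text \<open>
  The conjugate of the generator has the same degree and is a multiple of the generator, hence a
  constant multiple, and the constant is \<open>1\<close> if some coefficient is \<open>1\<close>. The quotient of the pullback
  of \<open>F\<close> by the generator is then fixed by conjugation, too, and has coefficients in the finite field.
\<close>

theorem preimage_is_plane_curve: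
  assumes F: "F \<in> forms M d" "vanishes_on V F"
  shows "\<exists>G :: 'a mpoly. (\<exists>e. G \<in> forms 2 e) \<and> Factorial_Ring.irreducible (base_change G) \<and>
    G dvd veronese_pullback s F \<and> C = zero_locus 2 {base_change G}"
proof -
  interpret plane_ideal "vanishing C"
    by (rule plane_ideal_C)
  interpret f: type_ring_hom "frob_coeffs :: 'a alg_closure mpoly \<Rightarrow> _"
    by (rule type_ring_hom_frob_coeffs)
  obtain e G0 where G0: "G0 \<in> forms_in {..2} e" "G0 \<in> vanishing C" "G0 \<noteq> 0"
    "\<And>d H. H \<in> forms_in {..2} d \<Longrightarrow> H \<in> vanishing C \<Longrightarrow> G0 dvd H"
    using form_generator exists_nonzero_equation by metis
  obtain m where "m \<in> keys G0"
    using G0(3) keys_eq_empty by blast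
  hence m: "lookup G0 m \<noteq> 0"
    by (simp add: in_keys_iff)
  define a where "a = inverse (lookup G0 m)"
  define G where "G = mp_const a * G0"
  have lookup_G: "lookup (mp_const c * H) m' = c * lookup H m'"
    for c m' and H :: "'a alg_closure mpoly"
    by (induction H rule: mpoly_induct)
      (simp_all add: mp_const_def mult_single distrib_left lookup_add lookup_single when_def)
  have "a \<noteq> 0" using m by (simp add: a_def)
  have G_m: "lookup G m = 1"
    using m by (simp add: G_def lookup_G a_def)
  have inv: "mp_const (inverse a) * G = G0"
    using \<open>a \<noteq> 0\<close> by (simp add: G_def flip: mult.assoc mp_const_mult)
  have G: "G \<in> forms_in {..2} e" "G \<in> vanishing C" "G \<noteq> 0"
    using forms_in_mult[OF forms_in_const G0(1), of a] G0(2) vanishing_mult inv G0(3)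
    unfolding G_def by auto
  have gen: "G dvd H" if "H \<in> forms_in {..2} d" "H \<in> vanishing C" for H d
  proof -
    have "G dvd G0"
      unfolding inv[symmetric] by simp
    thus ?thesis
      using G0(4)[OF that] dvd_trans by blast
  qed
  have irr: "Factorial_Ring.irreducible G"
    using generator_irreducible[OF G] gen by blast
  have "frob_coeffs G = G"
  proof -
    have fG: "frob_coeffs G \<in> forms_in {..2} e" "frob_coeffs G \<noteq> 0"
    proof -
      show "frob_coeffs G \<in> forms_in {..2} e"
        using G(1) by (rule frob_coeffs_form)
      have "lookup (frob_coeffs G) m = 1"
        by (simp add: lookup_frob_coeffs G_m)
      thus "frob_coeffs G \<noteq> 0" by auto
    qed
    have "G dvd frob_coeffs G"
      using gen[OF fG(1)] frob_coeffs_vanishing_C[OF G(1,2)] by blast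
    then obtain u where u: "frob_coeffs G = G * u"
      by (rule dvdE)
    have "u \<in> forms_in {..2} (e - e)"
      using form_cofactor(1)[OF _ _ G(1), of u e] fG unfolding u by blast
    then obtain b where b: "u = mp_const b"
      using form_degree_0[of u "{..2}"] by auto
    have "lookup (frob_coeffs G) m = b * lookup G m"
      unfolding u b using lookup_G[of b G m] by (simp only: mult.commute[of G])
    hence "b = 1"
      by (simp add: lookup_frob_coeffs G_m)
    thus ?thesis
      using u b by simp
  qed
  then obtain G' :: "'a mpoly" where G': "G = base_change G'"
    using frob_coeffs_fixed_imp_base_change by blast
  show ?thesis
  proof (intro exI[of _ G'] conjI)
    show "\<exists>e. G' \<in> forms 2 e"
      using G(1) unfolding G' forms_eq_forms_in by auto
    show "Factorial_Ring.irreducible (base_change G')"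
      using irr G' by simp
    show "C = zero_locus 2 {base_change G'}"
    proof
      show "C \<subseteq> zero_locus 2 {base_change G'}"
        using G(2) unfolding G' vanishing_def zero_locus_def C_def veronese_preimage_def by auto
      have "base_change G' dvd base_change H" if H: "H \<in> eqns" for H
      proof -
        obtain d where "base_change H \<in> forms_in {..2} d"
          using H eqns_forms by (auto simp: forms_eq_forms_in)
        moreover have "base_change H \<in> vanishing C"
          using H unfolding C_eq by (auto simp: vanishing_def zero_locus_def)
        ultimately show ?thesis
          using gen G' by simp
      qed
      hence "mp_eval v (base_change H) = 0" if "H \<in> eqns" "mp_eval v (base_change G') = 0" for H v
        using that by (metis eval_simps(4) dvdE mult_zero_left)
      thus "zero_locus 2 {base_change G'} \<subseteq> C"
        unfolding C_eq zero_locus_def by auto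
    qed
    let ?f = "veronese_pullback s F"
    have F': "base_change F \<in> forms_in {..M} d"
      using F(1) by (simp add: forms_eq_forms_in)
    have "base_change ?f \<in> vanishing C"
      unfolding base_change_veronese_pullback
      using pullback_in_vanishing[OF F'] F(2) by (simp add: vanishes_on_iff)
    moreover have "base_change ?f \<in> forms_in {..2} (d * s)"
      using veronese_pullback_form F(1) by (auto simp: forms_eq_forms_in)
    ultimately have "G dvd base_change ?f"
      using gen by blast
    then obtain h where h: "base_change ?f = G * h"
      by (rule dvdE)
    have "G * frob_coeffs h = frob_coeffs (G * h)"
      by (simp only: f.h_mult \<open>frob_coeffs G = G\<close>)
    also have "\<dots> = G * h"
      unfolding h[symmetric] by (rule frob_coeffs_base_change)
    finally have "G * frob_coeffs h = G * h" .
    hence "frob_coeffs h = h"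
      using G(3) by (simp only: mult_cancel_left) simp
    then obtain h' :: "'a mpoly" where "h = base_change h'"
      using frob_coeffs_fixed_imp_base_change by blast
    hence "base_change ?f = base_change (G' * h')"
      using h G' type_ring_hom.h_mult[OF type_ring_hom_base_change] by metis
    hence "?f = G' * h'"
      by (simp only: base_change_eq_iff)
    thus "G' dvd ?f" by simp
  qed
qed

end

section \<open>Evaluating polynomials in a ring with a carrier\<close>

text \<open>
  Polynomials over a type are evaluated in a ring given by a carrier, coefficients being mapped by \<open>c\<close>.
  Since \<open>hev R c u\<close> is again a homomorphism defined on a type, the construction can be iterated:
  \<open>hev R (hev R c u) x P\<close> is the value of the bivariate polynomial \<open>P\<close> at \<open>u\<close> (inner variable) and \<open>x\<close>
  (outer variable).
\<close>

definition hev :: "('e, 'm) ring_scheme \<Rightarrow> ('r::zero \<Rightarrow> 'e) \<Rightarrow> 'e \<Rightarrow> 'r poly \<Rightarrow> 'e"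
  where "hev R c u p = fold_coeffs (\<lambda>a r. c a \<oplus>\<^bsub>R\<^esub> u \<otimes>\<^bsub>R\<^esub> r) p \<zero>\<^bsub>R\<^esub>"

locale type_into_cring = cring R for R (structure) +
  fixes c :: "'r::idom \<Rightarrow> 'a"
  assumes c_closed [simp, intro]: "c a \<in> carrier R"
    and c_1: "c 1 = \<one>"
    and c_add: "c (a + b) = c a \<oplus> c b"
    and c_mult: "c (a * b) = c a \<otimes> c b"
begin

lemma c_0: "c 0 = \<zero>"
proof -
  have "c 0 \<oplus> c 0 = c 0"
    using c_add[of 0 0] by simp
  thus ?thesis
    using c_closed[of 0] by (metis add.r_cancel_one)
qed

lemma c_uminus: "c (- a) = \<ominus> c a"
proof -
  have "c (- a) \<oplus> c a = \<zero>"
    using c_add[of "- a" a] by (simp add: c_0)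
  thus ?thesis
    by (simp add: minus_equality)
qed

lemma hev_0 [simp]: "hev R c u 0 = \<zero>"
  by (simp add: hev_def)

lemma hev_pCons:
  assumes "u \<in> carrier R"
  shows "hev R c u (pCons a p) = c a \<oplus> u \<otimes> hev R c u p"
  using assms by (cases "p = 0 \<and> a = 0") (auto simp: hev_def c_0)

lemma hev_closed [simp, intro]: "u \<in> carrier R \<Longrightarrow> hev R c u p \<in> carrier R"
  by (induction p) (auto simp: hev_pCons)

lemma hev_const: "u \<in> carrier R \<Longrightarrow> hev R c u [:a:] = c a"
  by (simp add: hev_pCons)

lemma hev_add:
  assumes u: "u \<in> carrier R"
  shows "hev R c u (p + q) = hev R c u p \<oplus> hev R c u q"
proof (induction p q rule: poly_induct2)
  case (pCons a p b q)
  have "hev R c u (pCons a p + pCons b q) =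
      (c a \<oplus> c b) \<oplus> u \<otimes> (hev R c u p \<oplus> hev R c u q)"
    using pCons u by (simp add: hev_pCons c_add)
  also have "\<dots> = (c a \<oplus> u \<otimes> hev R c u p) \<oplus> (c b \<oplus> u \<otimes> hev R c u q)"
    using u c_closed[of a] c_closed[of b] hev_closed[OF u, of p] hev_closed[OF u, of q] by algebra
  finally show ?case
    using u by (simp add: hev_pCons)
qed simp

lemma hev_smult:
  assumes u: "u \<in> carrier R"
  shows "hev R c u (smult a p) = c a \<otimes> hev R c u p"
proof (induction p)
  case (pCons b p)
  have "hev R c u (smult a (pCons b p)) = c a \<otimes> c b \<oplus> u \<otimes> (c a \<otimes> hev R c u p)"
    using pCons u by (simp add: hev_pCons c_mult)
  also have "\<dots> = c a \<otimes> (c b \<oplus> u \<otimes> hev R c u p)"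
    using u c_closed[of a] c_closed[of b] hev_closed[OF u, of p] by algebra
  finally show ?case
    using u by (simp add: hev_pCons)
qed simp

lemma hev_mult:
  assumes u: "u \<in> carrier R"
  shows "hev R c u (p * q) = hev R c u p \<otimes> hev R c u q"
proof (induction p)
  case (pCons a p)
  have "hev R c u (pCons a p * q) = hev R c u (smult a q) \<oplus> hev R c u (pCons 0 (p * q))"
    using hev_add[OF u, of "smult a q" "pCons 0 (p * q)"] by (simp add: mult_pCons_left)
  also have "\<dots> = c a \<otimes> hev R c u q \<oplus> u \<otimes> (hev R c u p \<otimes> hev R c u q)"
    using u pCons by (simp add: hev_smult hev_pCons c_0)
  also have "\<dots> = (c a \<oplus> u \<otimes> hev R c u p) \<otimes> hev R c u q"
    using u c_closed[of a] hev_closed[OF u, of p] hev_closed[OF u, of q] by algebra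
  finally show ?case
    using u by (simp add: hev_pCons)
qed (use u in \<open>simp add: l_null\<close>)

lemma hev_type_into_cring:
  assumes u: "u \<in> carrier R"
  shows "type_into_cring R (hev R c u)"
  by unfold_locales (use u in \<open>auto simp: hev_add hev_mult hev_const c_1 one_pCons\<close>)

lemma hom_hev:
  assumes "cring S" "\<phi> \<in> ring_hom R S" "u \<in> carrier R"
  shows "\<phi> (hev R c u p) = hev S (\<lambda>a. \<phi> (c a)) (\<phi> u) p"
proof -
  interpret S: type_into_cring S "\<lambda>a. \<phi> (c a)"
    using assms by (intro type_into_cring.intro type_into_cring_axioms.intro)
      (auto simp: c_1 c_add c_mult dest: ring_hom_closed ring_hom_add ring_hom_mult ring_hom_one)
  have z: "\<phi> \<zero> = \<zero>\<^bsub>S\<^esub>"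
    using S.c_0 by (simp add: c_0)
  have \<phi>u: "\<phi> u \<in> carrier S"
    using assms by (auto dest: ring_hom_closed)
  show ?thesis
    using assms(3) \<phi>u
    by (induction p) (simp_all add: z hev_pCons S.hev_pCons ring_hom_add[OF assms(2)] ring_hom_mult[OF assms(2)])
qed

text \<open>
  In a polynomial ring, with \<open>x\<close> the variable, \<open>w\<close> a constant root of \<open>P\<close> and \<open>\<phi>\<close> the evaluation at \<open>w\<close>,
  this exhibits the cofactor of the linear factor; its value decides whether the root is simple.
\<close>

lemma hev_taylor:
  assumes S: "cring S" "\<phi> \<in> ring_hom R S" "\<phi> x = \<phi> w" and x: "x \<in> carrier R" and w: "w \<in> carrier R"
  shows "\<exists>Q\<in>carrier R. hev R c x P = hev R c w P \<oplus> (x \<ominus> w) \<otimes> Q \<and>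
    \<phi> Q = hev S (\<lambda>a. \<phi> (c a)) (\<phi> w) (pderiv P)"
proof (induction P)
  case 0
  interpret S: cring S by fact
  show ?case
    using x w ring_hom_zero[OF S(2) ring_axioms S.ring_axioms]
    by (intro bexI[of _ \<zero>]) (auto simp: hev_def)
next
  case (pCons a p)
  then obtain Q where Q: "Q \<in> carrier R" "hev R c x p = hev R c w p \<oplus> (x \<ominus> w) \<otimes> Q"
    "\<phi> Q = hev S (\<lambda>a. \<phi> (c a)) (\<phi> w) (pderiv p)"
    by blast
  note hom = ring_hom_add[OF S(2)] ring_hom_mult[OF S(2)]
  have "c a \<oplus> x \<otimes> (hev R c w p \<oplus> (x \<ominus> w) \<otimes> Q) =
      (c a \<oplus> w \<otimes> hev R c w p) \<oplus> (x \<ominus> w) \<otimes> (hev R c w p \<oplus> x \<otimes> Q)"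
    using x w Q(1) c_closed[of a] hev_closed[OF w, of p] by algebra
  hence "hev R c x (pCons a p) = hev R c w (pCons a p) \<oplus> (x \<ominus> w) \<otimes> (hev R c w p \<oplus> x \<otimes> Q)"
    using x w Q(2) by (simp add: hev_pCons)
  moreover have "\<phi> (hev R c w p \<oplus> x \<otimes> Q) = hev S (\<lambda>a. \<phi> (c a)) (\<phi> w) (pderiv (pCons a p))"
  proof -
    interpret S: type_into_cring S "\<lambda>a. \<phi> (c a)"
      using S by (intro type_into_cring.intro type_into_cring_axioms.intro)
        (auto simp: c_1 c_add c_mult dest: ring_hom_closed ring_hom_add ring_hom_mult ring_hom_one)
    have \<phi>w: "\<phi> w \<in> carrier S"
      using S w by (auto dest: ring_hom_closed)
    show ?thesis
      using x w Q(1,3) S(3) hom_hev[OF S(1,2) w] \<phi>w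
      by (simp add: hom pderiv_pCons S.hev_add S.hev_pCons S.c_0)
  qed
  ultimately show ?case
    using x w Q(1) by (intro bexI[of _ "hev R c w p \<oplus> x \<otimes> Q"]) auto
qed

end

text \<open>
  A relation that makes \<open>v\<close> algebraic over the field generated by \<open>u\<close> has to be read as one that makes \<open>u\<close>
  algebraic over the field generated by \<open>v\<close>; this exchanges the inner and the outer variable.
\<close>

definition swap_poly :: "'a::idom poly poly \<Rightarrow> 'a poly poly"
  where "swap_poly = (\<lambda>P. fold_coeffs (\<lambda>p Q. map_poly (\<lambda>a. [:a:]) p + [:[:0, 1:]:] * Q) P 0)"

lemma swap_poly_0 [simp]: "swap_poly 0 = 0"
  by (simp add: swap_poly_def)

lemma swap_poly_pCons [simp]:
  "swap_poly (pCons p P) = map_poly (\<lambda>a. [:a:]) p + [:[:0, 1:]:] * swap_poly P"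
  by (cases "p = 0 \<and> P = 0") (auto simp: swap_poly_def)

lemma coeff_swap_poly: "coeff (coeff (swap_poly P) i) j = coeff (coeff P j) i"
proof (induction P arbitrary: j)
  case (pCons p P)
  thus ?case
    by (cases j) (auto simp: coeff_map_poly coeff_pCons split: nat.splits)
qed simp

lemma swap_poly_eq_0_iff [simp]: "swap_poly P = 0 \<longleftrightarrow> P = 0"
  by (auto simp: poly_eq_iff coeff_swap_poly)

context type_into_cring
begin

lemma hev_map_const:
  assumes u: "u \<in> carrier R" and v: "v \<in> carrier R"
  shows "hev R (hev R c u) v (map_poly (\<lambda>a. [:a:]) p) = hev R c v p"
proof -
  interpret u: type_into_cring R "hev R c u"
    by (rule hev_type_into_cring[OF u])
  show ?thesis
    using u v by (induction p) (simp_all add: map_poly_pCons u.hev_pCons hev_pCons hev_const)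
qed

lemma hev_swap:
  assumes u: "u \<in> carrier R" and v: "v \<in> carrier R"
  shows "hev R (hev R c v) u (swap_poly P) = hev R (hev R c u) v P"
proof -
  interpret u: type_into_cring R "hev R c u"
    by (rule hev_type_into_cring[OF u])
  interpret v: type_into_cring R "hev R c v"
    by (rule hev_type_into_cring[OF v])
  show ?thesis
  proof (induction P)
    case (pCons p P)
    have "hev R (hev R c v) u [:[:0, 1:]:] = v"
      using u v by (simp add: v.hev_const hev_pCons c_0 c_1)
    thus ?case
      using u v pCons
      by (simp only: swap_poly_pCons v.hev_add[OF u] v.hev_mult[OF u] hev_map_const[OF v u] u.hev_pCons[OF v])
  qed simp
qed

end

section \<open>Separability by a simple root\<close>

context domain
begin

lemma linear_factor_eq:
  assumes x: "x \<in> carrier R"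
  shows "[\<one>, \<ominus> x] = X \<ominus>\<^bsub>poly_ring R\<^esub> poly_of_const x"
proof -
  interpret UP: domain "poly_ring R"
    using univ_poly_is_domain[OF carrier_is_subring] .
  have hom: "poly_of_const \<in> ring_hom R (poly_ring R)"
    using canonical_embedding_is_hom[OF carrier_is_subring] by simp
  have "\<ominus>\<^bsub>poly_ring R\<^esub> poly_of_const x = poly_of_const (\<ominus> x)"
  proof -
    have "poly_of_const (\<ominus> x) \<oplus>\<^bsub>poly_ring R\<^esub> poly_of_const x = poly_of_const (\<ominus> x \<oplus> x)"
      using x by (intro ring_hom_add[OF hom, symmetric]) auto
    also have "\<dots> = \<zero>\<^bsub>poly_ring R\<^esub>"
      using x by (simp add: l_neg poly_of_const_def univ_poly_zero)
    finally show ?thesis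
      using x by (intro UP.minus_equality) (auto intro: ring_hom_closed[OF hom])
  qed
  moreover have "X \<oplus>\<^bsub>poly_ring R\<^esub> poly_of_const (\<ominus> x) = [\<one>, \<ominus> x]"
    using x by (auto simp: univ_poly_add poly_of_const_def var_def)
  ultimately show ?thesis
    by (simp add: a_minus_def)
qed

end

locale type_into_field = type_into_cring R c + field R
  for R :: "('b, 'm) ring_scheme" (structure) and c :: "'r::idom \<Rightarrow> 'b"
begin

text \<open>
  The image of a polynomial over a type in the ring of polynomials over \<open>R\<close>, where minimal polynomials
  and multiplicities of roots live.
\<close>

definition lift_poly :: "'r poly \<Rightarrow> 'b list"
  where "lift_poly P = hev (poly_ring R) (\<lambda>a. poly_of_const (c a)) X P"

lemma const_hom: "poly_of_const \<in> ring_hom R (poly_ring R)"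
  using canonical_embedding_is_hom[OF carrier_is_subring] by simp

lemma UP_cring: "cring (poly_ring R)"
  using univ_poly_is_cring[OF carrier_is_subring] .

lemma type_into_UP: "type_into_cring (poly_ring R) (\<lambda>a. poly_of_const (c a))"
proof -
  interpret UP: cring "poly_ring R"
    by (rule UP_cring)
  show ?thesis
    using const_hom by unfold_locales
      (auto simp: c_1 c_add c_mult dest: ring_hom_closed ring_hom_add ring_hom_mult ring_hom_one)
qed

lemma eval_hom: "x \<in> carrier R \<Longrightarrow> (\<lambda>p. eval p x) \<in> ring_hom (poly_ring R) R"
  using eval_is_hom[OF carrier_is_subring] by simp

lemma eval_const: "a \<in> carrier R \<Longrightarrow> x \<in> carrier R \<Longrightarrow> eval (poly_of_const a) x = a"
  by (auto simp: poly_of_const_def)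

lemma lift_poly_closed [simp, intro]: "lift_poly P \<in> carrier (poly_ring R)"
  unfolding lift_poly_def
  by (rule type_into_cring.hev_closed[OF type_into_UP var_closed(1)[OF carrier_is_subring]])

lemma eval_lift_poly:
  assumes "x \<in> carrier R" shows "eval (lift_poly P) x = hev R c x P"
  using type_into_cring.hom_hev[OF type_into_UP cring_axioms eval_hom[OF assms] var_closed(1)[OF carrier_is_subring]]
    assms by (simp add: lift_poly_def eval_const eval_var)

lemma lift_poly_over:
  assumes E: "subring E R" and "\<And>a. c a \<in> E"
  shows "lift_poly P \<in> carrier (E[X])"
proof (induction P)
  case 0
  thus ?case
    by (simp add: lift_poly_def hev_def univ_poly_zero univ_poly_zero_closed)
next
  case (pCons a P)
  interpret E: ring "E[X]"
    by (rule univ_poly_is_ring[OF E])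
  have "poly_of_const (c a) \<in> carrier (E[X])"
    using assms(2)[of a] by (auto simp: poly_of_const_def univ_poly_def polynomial_def)
  hence "poly_of_const (c a) \<oplus>\<^bsub>E[X]\<^esub> X \<otimes>\<^bsub>E[X]\<^esub> lift_poly P \<in> carrier (E[X])"
    using pCons var_closed(1)[OF E] by blast
  thus ?case
    using type_into_cring.hev_pCons[OF type_into_UP var_closed(1)[OF carrier_is_subring], of a P]
    by (simp add: lift_poly_def univ_poly_add univ_poly_mult)
qed

text \<open>
  The Taylor expansion of \<open>P\<close> in the polynomial ring, at the variable and the constant \<open>x\<close>; evaluation
  at \<open>x\<close> identifies the two.
\<close>

lemma lift_poly_root_factor:
  assumes x: "x \<in> carrier R" and root: "hev R c x P = \<zero>"
  shows "\<exists>Q\<in>carrier (poly_ring R). lift_poly P = [\<one>, \<ominus> x] \<otimes>\<^bsub>poly_ring R\<^esub> Q \<and>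
    eval Q x = hev R c x (pderiv P)"
proof -
  interpret UP: domain "poly_ring R"
    using univ_poly_is_domain[OF carrier_is_subring] .
  have X: "X \<in> carrier (poly_ring R)"
    by (rule var_closed(1)[OF carrier_is_subring])
  have w: "poly_of_const x \<in> carrier (poly_ring R)"
    by (rule ring_hom_closed[OF const_hom x])
  have "eval X x = eval (poly_of_const x) x"
    using x by (simp add: eval_var eval_const)
  from type_into_cring.hev_taylor[OF type_into_UP cring_axioms eval_hom[OF x] this X w, of P]
  obtain Q where Q: "Q \<in> carrier (poly_ring R)"
    "lift_poly P = hev (poly_ring R) (\<lambda>a. poly_of_const (c a)) (poly_of_const x) P
      \<oplus>\<^bsub>poly_ring R\<^esub> (X \<ominus>\<^bsub>poly_ring R\<^esub> poly_of_const x) \<otimes>\<^bsub>poly_ring R\<^esub> Q"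
    "eval Q x = hev R (\<lambda>a. eval (poly_of_const (c a)) x) (eval (poly_of_const x) x) (pderiv P)"
    unfolding lift_poly_def by blast
  have "hev (poly_ring R) (\<lambda>a. poly_of_const (c a)) (poly_of_const x) P = \<zero>\<^bsub>poly_ring R\<^esub>"
    using hom_hev[OF UP_cring const_hom x, of P] root by (simp add: poly_of_const_def univ_poly_zero)
  hence "lift_poly P = [\<one>, \<ominus> x] \<otimes>\<^bsub>poly_ring R\<^esub> Q"
    using Q(1,2) X w x by (simp add: linear_factor_eq)
  thus ?thesis
    using Q(1,3) x by (intro bexI[of _ Q]) (simp_all add: eval_const)
qed

lemma linear_closed: "x \<in> carrier R \<Longrightarrow> [\<one>, \<ominus> x] \<in> carrier (poly_ring R)"
  unfolding sym[OF univ_poly_carrier] polynomial_def by auto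

lemma linear_square: "x \<in> carrier R \<Longrightarrow> [\<one>, \<ominus> x] [^]\<^bsub>poly_ring R\<^esub> (2::nat) =
    [\<one>, \<ominus> x] \<otimes>\<^bsub>poly_ring R\<^esub> [\<one>, \<ominus> x]"
proof -
  interpret UP: domain "poly_ring R"
    using univ_poly_is_domain[OF carrier_is_subring] .
  show "x \<in> carrier R \<Longrightarrow> ?thesis"
    using linear_closed[of x] by (simp add: numeral_2_eq_2)
qed

lemma square_divides_iff:
  assumes x: "x \<in> carrier R" and root: "hev R c x P = \<zero>"
  shows "[\<one>, \<ominus> x] [^]\<^bsub>poly_ring R\<^esub> (2::nat) pdivides lift_poly P \<longleftrightarrow> hev R c x (pderiv P) = \<zero>"
proof -
  interpret UP: domain "poly_ring R"
    using univ_poly_is_domain[OF carrier_is_subring] .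
  let ?l = "[\<one>, \<ominus> x]"
  have l: "?l \<in> carrier (poly_ring R)" "?l \<noteq> \<zero>\<^bsub>poly_ring R\<^esub>"
    using x linear_closed by (auto simp: univ_poly_zero)
  obtain Q where Q: "Q \<in> carrier (poly_ring R)" "lift_poly P = ?l \<otimes>\<^bsub>poly_ring R\<^esub> Q"
    "eval Q x = hev R c x (pderiv P)"
    using lift_poly_root_factor[OF assms] by blast
  have "?l [^]\<^bsub>poly_ring R\<^esub> (2::nat) pdivides lift_poly P \<longleftrightarrow> ?l pdivides Q"
  proof
    assume "?l [^]\<^bsub>poly_ring R\<^esub> (2::nat) pdivides lift_poly P"
    then obtain S where S: "S \<in> carrier (poly_ring R)"
      "?l \<otimes>\<^bsub>poly_ring R\<^esub> Q = (?l \<otimes>\<^bsub>poly_ring R\<^esub> ?l) \<otimes>\<^bsub>poly_ring R\<^esub> S"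
      using x by (auto simp: pdivides_def factor_def Q(2) linear_square)
    hence "?l \<otimes>\<^bsub>poly_ring R\<^esub> Q = ?l \<otimes>\<^bsub>poly_ring R\<^esub> (?l \<otimes>\<^bsub>poly_ring R\<^esub> S)"
      using l(1) by (simp add: UP.m_assoc)
    hence "Q = ?l \<otimes>\<^bsub>poly_ring R\<^esub> S"
      using UP.m_lcancel[OF l(2,1) Q(1), of "?l \<otimes>\<^bsub>poly_ring R\<^esub> S"] l(1) S(1) by blast
    thus "?l pdivides Q"
      using S(1) by (auto simp: pdivides_def factor_def)
  next
    assume "?l pdivides Q"
    then obtain S where S: "S \<in> carrier (poly_ring R)" "Q = ?l \<otimes>\<^bsub>poly_ring R\<^esub> S"
      by (auto simp: pdivides_def factor_def)
    hence "lift_poly P = ?l [^]\<^bsub>poly_ring R\<^esub> (2::nat) \<otimes>\<^bsub>poly_ring R\<^esub> S"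
      using l(1) x by (simp add: Q(2) linear_square UP.m_assoc)
    thus "?l [^]\<^bsub>poly_ring R\<^esub> (2::nat) pdivides lift_poly P"
      using S(1) by (auto simp: pdivides_def factor_def)
  qed
  also have "\<dots> \<longleftrightarrow> eval Q x = \<zero>"
  proof
    assume "?l pdivides Q"
    moreover have "eval ?l x = \<zero>"
      using x by (simp add: r_neg)
    ultimately show "eval Q x = \<zero>"
      using pdivides_imp_root_sharing[OF l(1) _ x] by blast
  next
    assume *: "eval Q x = \<zero>"
    show "?l pdivides Q"
    proof (cases "Q = []")
      case True
      thus ?thesis
        using pdivides_zero[OF carrier_is_subring l(1)] by simp
    next
      case False
      thus ?thesis
        using is_root_imp_pdivides[OF Q(1)] x * by (simp add: is_root_def)
    qed
  qed
  finally show ?thesis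
    by (simp add: Q(3))
qed

text \<open>
  The minimal polynomial of \<open>x\<close> divides \<open>P\<close>, so a double root of it would be a double root of \<open>P\<close>.
\<close>

lemma separable_elementI:
  assumes E: "subfield E R" and c_E: "\<And>a. c a \<in> E" and x: "x \<in> carrier R"
    and root: "hev R c x P = \<zero>" and simple: "hev R c x (pderiv P) \<noteq> \<zero>"
  shows "separable_element R E x"
proof -
  interpret UP: domain "poly_ring R"
    using univ_poly_is_domain[OF carrier_is_subring] .
  have p: "lift_poly P \<in> carrier (E[X])"
    using lift_poly_over[OF subfieldE(1)[OF E] c_E] .
  have p0: "eval (lift_poly P) x = \<zero>"
    using x root by (simp add: eval_lift_poly)
  have sq: "\<not> [\<one>, \<ominus> x] [^]\<^bsub>poly_ring R\<^esub> (2::nat) pdivides lift_poly P"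
    using square_divides_iff[OF x root] simple by simp
  have "lift_poly P \<noteq> []"
  proof
    assume "lift_poly P = []"
    thus False
      using sq x pdivides_zero[OF carrier_is_subring] linear_closed UP.nat_pow_closed by metis
  qed
  hence alg: "(algebraic over E) x"
    using algebraicI[OF p _ p0] by blast
  let ?I = "Irr E x"
  have I: "?I \<in> carrier (E[X])" "eval ?I x = \<zero>" "pirreducible E ?I"
    using IrrE[OF E x alg] by auto
  have I_carrier: "?I \<in> carrier (poly_ring R)"
    using I(1) subfieldE(3)[OF E] unfolding univ_poly_carrier[symmetric] polynomial_def by auto
  have I_ne: "?I \<noteq> []"
    using pirreducibleE(1)[OF subfieldE(1)[OF E] I(1,3)] .
  have "alg_mult ?I x > 0"
    using alg_mult_gt_zero_iff_is_root[OF I_carrier] I(2) I_ne x by (simp add: is_root_def)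
  moreover have "\<not> alg_mult ?I x \<ge> 2"
  proof
    assume "alg_mult ?I x \<ge> 2"
    hence "[\<one>, \<ominus> x] [^]\<^bsub>poly_ring R\<^esub> (2::nat) pdivides ?I"
      by (rule le_alg_mult_imp_pdivides[OF x I_carrier])
    moreover have "?I pdivides lift_poly P"
      by (rule Irr_minimal[OF E x alg p p0])
    ultimately have "[\<one>, \<ominus> x] [^]\<^bsub>poly_ring R\<^esub> (2::nat) pdivides lift_poly P"
      unfolding pdivides_def using UP.divides_trans[OF _ _ UP.nat_pow_closed[OF linear_closed[OF x]]] by blast
    thus False using sq by blast
  qed
  ultimately have "alg_mult ?I x = 1"
    by linarith
  thus ?thesis
    using alg by (simp add: separable_element_def over_def)
qed

lemma generate_field_fraction:
  assumes u: "u \<in> carrier R" and x: "x \<in> generate_field R (insert u (range c))"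
  shows "\<exists>A B. hev R c u B \<noteq> \<zero> \<and> x \<otimes> hev R c u B = hev R c u A"
proof -
  have gen: "h \<in> carrier R" if "h \<in> generate_field R (insert u (range c))" for h
    using that u by (intro generate_field_in_carrier[of "insert u (range c)"]) auto
  note closed = hev_closed[OF u]
  have one: "hev R c u 1 = \<one>"
    using u by (simp add: one_pCons hev_const c_1)
  show ?thesis
    using x
  proof (induction rule: generate_field.induct)
    case one
    show ?case
      by (intro exI[of _ 1]) (simp add: \<open>hev R c u 1 = \<one>\<close>)
  next
    case (incl h)
    then consider "h = u" | a where "h = c a" by auto
    thus ?case
    proof cases
      case 1
      thus ?thesis
        using u by (intro exI[of _ "[:0, 1:]"] exI[of _ 1]) (simp add: one hev_pCons c_0 c_1)
    next
      case 2
      thus ?thesis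
        using u by (intro exI[of _ "[:a:]"] exI[of _ 1]) (simp add: one hev_const)
    qed
  next
    case (a_inv h)
    then obtain A B where AB: "hev R c u B \<noteq> \<zero>" "h \<otimes> hev R c u B = hev R c u A" by blast
    have "\<ominus> h \<otimes> hev R c u B = hev R c u (- A)"
      using AB(2) gen[OF a_inv.hyps] closed u
      by (simp add: l_minus type_into_cring.c_uminus[OF hev_type_into_cring[OF u]])
    thus ?case using AB(1) by blast
  next
    case (m_inv h)
    then obtain A B where AB: "hev R c u B \<noteq> \<zero>" "h \<otimes> hev R c u B = hev R c u A" by blast
    have h: "h \<in> carrier R" "h \<noteq> \<zero>"
      using m_inv gen by auto
    have "hev R c u A \<noteq> \<zero>"
      using AB h closed integral_iff by metis
    moreover have "inv h \<otimes> hev R c u A = hev R c u B"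
      unfolding AB(2)[symmetric] using h closed field_Units by (simp flip: m_assoc)
    ultimately show ?case by blast
  next
    case (eng_add h k)
    then obtain A B A' B' where AB: "hev R c u B \<noteq> \<zero>" "h \<otimes> hev R c u B = hev R c u A"
      "hev R c u B' \<noteq> \<zero>" "k \<otimes> hev R c u B' = hev R c u A'" by blast
    have "hev R c u (B * B') \<noteq> \<zero>"
      using AB closed u integral_iff by (metis hev_mult)
    moreover have "(h \<oplus> k) \<otimes> (hev R c u B \<otimes> hev R c u B') =
        (h \<otimes> hev R c u B) \<otimes> hev R c u B' \<oplus> (k \<otimes> hev R c u B') \<otimes> hev R c u B"
      using gen[OF eng_add.hyps(1)] gen[OF eng_add.hyps(2)] closed[of B] closed[of B'] by algebra
    hence "(h \<oplus> k) \<otimes> hev R c u (B * B') = hev R c u (A * B' + A' * B)"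
      unfolding AB by (simp add: hev_mult[OF u] hev_add[OF u])
    ultimately show ?case by blast
  next
    case (eng_mult h k)
    then obtain A B A' B' where AB: "hev R c u B \<noteq> \<zero>" "h \<otimes> hev R c u B = hev R c u A"
      "hev R c u B' \<noteq> \<zero>" "k \<otimes> hev R c u B' = hev R c u A'" by blast
    have "hev R c u (B * B') \<noteq> \<zero>"
      using AB closed u integral_iff by (metis hev_mult)
    moreover have "(h \<otimes> k) \<otimes> (hev R c u B \<otimes> hev R c u B') =
        (h \<otimes> hev R c u B) \<otimes> (k \<otimes> hev R c u B')"
      using gen[OF eng_mult.hyps(1)] gen[OF eng_mult.hyps(2)] closed[of B] closed[of B'] by algebra
    hence "(h \<otimes> k) \<otimes> hev R c u (B * B') = hev R c u (A * A')"
      unfolding AB by (simp add: hev_mult[OF u])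
    ultimately show ?case by blast
  qed
qed

lemma hev_in_generate_field:
  assumes "u \<in> carrier R"
  shows "hev R c u p \<in> generate_field R (insert u (range c))"
proof (induction p)
  case 0
  thus ?case by (simp add: zero_in_generate)
next
  case (pCons a p)
  thus ?case
    using assms by (simp add: hev_pCons generate_field.eng_add generate_field.eng_mult generate_field.incl)
qed

end

context type_into_field
begin

lemma hev_type_into_field: "u \<in> carrier R \<Longrightarrow> type_into_field R (hev R c u)"
  by (intro type_into_field.intro hev_type_into_cring field_axioms)

lemma lift_poly_0: "lift_poly 0 = []"
  by (simp add: lift_poly_def hev_def univ_poly_zero)

lemma lift_poly_pCons:
  "lift_poly (pCons a P) = poly_of_const (c a) \<oplus>\<^bsub>poly_ring R\<^esub> X \<otimes>\<^bsub>poly_ring R\<^esub> lift_poly P"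
  unfolding lift_poly_def
  by (rule type_into_cring.hev_pCons[OF type_into_UP var_closed(1)[OF carrier_is_subring]])

lemma lift_poly_smult: "lift_poly (smult a P) = poly_of_const (c a) \<otimes>\<^bsub>poly_ring R\<^esub> lift_poly P"
  unfolding lift_poly_def
  by (rule type_into_cring.hev_smult[OF type_into_UP var_closed(1)[OF carrier_is_subring]])

lemma lift_poly_eq_Nil_imp:
  assumes "\<And>a. c a = \<zero> \<Longrightarrow> a = 0" "lift_poly P = []"
  shows "P = 0"
  using assms(2)
proof (induction P)
  case (pCons a P)
  interpret UP: domain "poly_ring R"
    using univ_poly_is_domain[OF carrier_is_subring] .
  have X: "X \<in> carrier (poly_ring R)"
    by (rule var_closed(1)[OF carrier_is_subring])
  have "eval (lift_poly (pCons a P)) \<zero> = \<zero>"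
    using pCons.prems by simp
  hence "c a \<oplus> \<zero> \<otimes> hev R c \<zero> P = \<zero>"
    unfolding eval_lift_poly[OF zero_closed] by (simp only: hev_pCons[OF zero_closed])
  hence "a = 0"
    using assms(1) by simp
  hence "X \<otimes>\<^bsub>poly_ring R\<^esub> lift_poly P = \<zero>\<^bsub>poly_ring R\<^esub>"
    using pCons.prems X unfolding lift_poly_pCons by (simp add: c_0 poly_of_const_def univ_poly_zero)
      (metis UP.l_zero UP.m_closed lift_poly_closed univ_poly_zero)
  hence "lift_poly P = []"
    using UP.integral[OF _ X lift_poly_closed] by (auto simp: univ_poly_zero var_def)
  thus ?case
    using pCons \<open>a = 0\<close> by simp
qed simp

text \<open>
  By induction on the list of coefficients, each of which is a fraction of polynomials in \<open>u\<close>.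
\<close>

lemma clear_denominators:
  assumes u: "u \<in> carrier R" and p: "p \<in> carrier ((generate_field R (insert u (range c)))[X])"
  shows "\<exists>B P. hev R c u B \<noteq> \<zero> \<and> type_into_field.lift_poly R (hev R c u) P =
    poly_of_const (hev R c u B) \<otimes>\<^bsub>poly_ring R\<^esub> p"
proof -
  interpret u: type_into_field R "hev R c u"
    by (rule hev_type_into_field[OF u])
  interpret UP: domain "poly_ring R"
    using univ_poly_is_domain[OF carrier_is_subring] .
  let ?E = "generate_field R (insert u (range c))"
  have E_carrier: "?E \<subseteq> carrier R"
    using u by (intro generate_field_incl) auto
  have X: "X \<in> carrier (poly_ring R)"
    by (rule var_closed(1)[OF carrier_is_subring])
  have const: "poly_of_const a \<in> carrier (poly_ring R)" if "a \<in> carrier R" for a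
    using that by (rule ring_hom_closed[OF const_hom])
  have *: "\<exists>B P. hev R c u B \<noteq> \<zero> \<and> u.lift_poly P =
      poly_of_const (hev R c u B) \<otimes>\<^bsub>poly_ring R\<^esub> UP.eval (map poly_of_const ps) X"
    if "set ps \<subseteq> ?E" for ps
    using that
  proof (induction ps rule: rev_induct)
    case Nil
    have "hev R c u 1 = \<one>"
      using u by (simp add: one_pCons hev_const c_1)
    moreover have "[] = poly_of_const \<one> \<otimes>\<^bsub>poly_ring R\<^esub> UP.eval (map poly_of_const []) X"
      using UP.r_null[OF const[OF one_closed]] by simp (simp add: univ_poly_zero)
    ultimately show ?case
      by (intro exI[of _ 1] exI[of _ 0]) (simp add: u.lift_poly_0)
  next
    case (snoc a ps)
    then obtain B P where BP: "hev R c u B \<noteq> \<zero>"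
      "u.lift_poly P = poly_of_const (hev R c u B) \<otimes>\<^bsub>poly_ring R\<^esub> UP.eval (map poly_of_const ps) X"
      by auto
    obtain A' B' where A'B': "hev R c u B' \<noteq> \<zero>" "a \<otimes> hev R c u B' = hev R c u A'"
      using generate_field_fraction[OF u, of a] snoc.prems by auto
    have a: "a \<in> carrier R"
      using snoc.prems E_carrier by auto
    have set: "set (map poly_of_const ps) \<subseteq> carrier (poly_ring R)"
      using snoc.prems E_carrier const by auto
    let ?v = "UP.eval (map poly_of_const ps) X"
    have v: "?v \<in> carrier (poly_ring R)"
      by (rule UP.eval_in_carrier[OF set X])
    let ?b = "poly_of_const (hev R c u B)" and ?b' = "poly_of_const (hev R c u B')"
    have b: "?b \<in> carrier (poly_ring R)" "?b' \<in> carrier (poly_ring R)" "poly_of_const a \<in> carrier (poly_ring R)"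
      using const u a by auto
    have "u.lift_poly (pCons (A' * B) (smult B' P)) =
        (poly_of_const a \<otimes>\<^bsub>poly_ring R\<^esub> ?b') \<otimes>\<^bsub>poly_ring R\<^esub> ?b \<oplus>\<^bsub>poly_ring R\<^esub>
        X \<otimes>\<^bsub>poly_ring R\<^esub> (?b' \<otimes>\<^bsub>poly_ring R\<^esub> (?b \<otimes>\<^bsub>poly_ring R\<^esub> ?v))"
      using u a
      by (simp add: u.lift_poly_pCons u.lift_poly_smult BP(2) hev_mult A'B'(2)[symmetric] ring_hom_mult[OF const_hom])
    also have "\<dots> = (?b' \<otimes>\<^bsub>poly_ring R\<^esub> ?b) \<otimes>\<^bsub>poly_ring R\<^esub>
        (?v \<otimes>\<^bsub>poly_ring R\<^esub> X \<oplus>\<^bsub>poly_ring R\<^esub> poly_of_const a)"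
      using b v X by (simp add: UP.r_distr UP.m_assoc UP.m_comm UP.m_lcomm UP.a_comm)
    also have "?v \<otimes>\<^bsub>poly_ring R\<^esub> X \<oplus>\<^bsub>poly_ring R\<^esub> poly_of_const a =
        UP.eval (map poly_of_const (ps @ [a])) X"
      using UP.eval_append_aux[OF set b(3) X] by simp
    also have "?b' \<otimes>\<^bsub>poly_ring R\<^esub> ?b = poly_of_const (hev R c u (B' * B))"
      using u by (simp add: hev_mult ring_hom_mult[OF const_hom])
    finally have "u.lift_poly (pCons (A' * B) (smult B' P)) =
      poly_of_const (hev R c u (B' * B)) \<otimes>\<^bsub>poly_ring R\<^esub> UP.eval (map poly_of_const (ps @ [a])) X" .
    moreover have "hev R c u (B' * B) \<noteq> \<zero>"
      using A'B'(1) BP(1) integral_iff u by (simp add: hev_mult)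
    ultimately show ?case by blast
  qed
  have set: "set p \<subseteq> ?E"
    using p unfolding univ_poly_carrier[symmetric] polynomial_def by auto
  hence "p \<in> carrier (poly_ring R)"
    using p E_carrier unfolding univ_poly_carrier[symmetric] polynomial_def by auto
  from eval_rewrite[OF carrier_is_subring this] *[OF set] show ?thesis
    by simp
qed

text \<open>
  The polynomial is the minimal polynomial of \<open>x\<close> with denominators cleared, which changes neither its
  roots nor their multiplicities.
\<close>

lemma separable_elementD:
  assumes u: "u \<in> carrier R" and x: "x \<in> carrier R"
    and sep: "separable_element R (generate_field R (insert u (range c))) x"
  shows "\<exists>P. hev R (hev R c u) x P = \<zero> \<and> hev R (hev R c u) x (pderiv P) \<noteq> \<zero>"
proof -
  interpret u: type_into_field R "hev R c u"
    by (rule hev_type_into_field[OF u])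
  interpret UP: domain "poly_ring R"
    using univ_poly_is_domain[OF carrier_is_subring] .
  let ?E = "generate_field R (insert u (range c))"
  have E: "subfield ?E R"
    using u by (intro generate_field_is_subfield) auto
  have alg: "(algebraic over ?E) x" and mult: "alg_mult (Irr ?E x) x = 1"
    using sep by (simp_all add: separable_element_def over_def)
  let ?I = "Irr ?E x"
  have I: "?I \<in> carrier (?E[X])" "eval ?I x = \<zero>" "pirreducible ?E ?I"
    using IrrE[OF E x alg] by auto
  have I_carrier: "?I \<in> carrier (poly_ring R)"
    using I(1) subfieldE(3)[OF E] unfolding univ_poly_carrier[symmetric] polynomial_def by auto
  have I_ne: "?I \<noteq> []"
    using pirreducibleE(1)[OF subfieldE(1)[OF E] I(1,3)] .
  obtain B P where BP: "hev R c u B \<noteq> \<zero>"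
    "u.lift_poly P = poly_of_const (hev R c u B) \<otimes>\<^bsub>poly_ring R\<^esub> ?I"
    using clear_denominators[OF u I(1)] by blast
  let ?b = "hev R c u B"
  have b: "?b \<in> carrier R" using u by blast
  have const: "poly_of_const a \<in> carrier (poly_ring R)" if "a \<in> carrier R" for a
    using that by (rule ring_hom_closed[OF const_hom])
  have "hev R (hev R c u) x P = eval (poly_of_const ?b) x \<otimes> eval ?I x"
    using u.eval_lift_poly[OF x, of P] BP(2) ring_hom_mult[OF eval_hom[OF x] const[OF b] I_carrier] by simp
  hence root: "hev R (hev R c u) x P = \<zero>"
    using x b by (simp add: I(2) eval_const)
  moreover have "hev R (hev R c u) x (pderiv P) \<noteq> \<zero>"
  proof
    assume "hev R (hev R c u) x (pderiv P) = \<zero>"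
    hence sq: "[\<one>, \<ominus> x] [^]\<^bsub>poly_ring R\<^esub> (2::nat) pdivides u.lift_poly P"
      using u.square_divides_iff[OF x root] by simp
    have inv_b: "inv ?b \<in> carrier R" "inv ?b \<otimes> ?b = \<one>"
      using b BP(1) field_Units by auto
    have "poly_of_const (inv ?b) \<otimes>\<^bsub>poly_ring R\<^esub> u.lift_poly P =
        (poly_of_const (inv ?b) \<otimes>\<^bsub>poly_ring R\<^esub> poly_of_const ?b) \<otimes>\<^bsub>poly_ring R\<^esub> ?I"
      using const inv_b b I_carrier by (simp add: BP(2) UP.m_assoc)
    also have "poly_of_const (inv ?b) \<otimes>\<^bsub>poly_ring R\<^esub> poly_of_const ?b = \<one>\<^bsub>poly_ring R\<^esub>"
      using inv_b b by (simp add: ring_hom_mult[OF const_hom, symmetric] ring_hom_one[OF const_hom])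
    finally have "?I = u.lift_poly P \<otimes>\<^bsub>poly_ring R\<^esub> poly_of_const (inv ?b)"
      using I_carrier const[OF inv_b(1)] by (simp add: UP.m_comm)
    hence "u.lift_poly P pdivides ?I"
      using const[OF inv_b(1)] unfolding pdivides_def factor_def by blast
    hence "[\<one>, \<ominus> x] [^]\<^bsub>poly_ring R\<^esub> (2::nat) pdivides ?I"
      using sq unfolding pdivides_def
      using UP.divides_trans[OF _ _ UP.nat_pow_closed[OF linear_closed[OF x]]] by blast
    hence "2 \<le> alg_mult ?I x"
      by (rule alg_multE(2)[OF x I_carrier I_ne])
    thus False using mult by simp
  qed
  ultimately show ?thesis by blast
qed

lemma algebraic_imp_relation:
  assumes u: "u \<in> carrier R" and x: "x \<in> carrier R"
    and alg: "(algebraic over (generate_field R (insert u (range c)))) x"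
  shows "\<exists>P. P \<noteq> 0 \<and> hev R (hev R c u) x P = \<zero>"
proof -
  interpret u: type_into_field R "hev R c u"
    by (rule hev_type_into_field[OF u])
  interpret UP: domain "poly_ring R"
    using univ_poly_is_domain[OF carrier_is_subring] .
  let ?E = "generate_field R (insert u (range c))"
  have E: "subfield ?E R"
    using u by (intro generate_field_is_subfield) auto
  obtain p where p: "p \<in> carrier (?E[X])" "p \<noteq> []" "eval p x = \<zero>"
    using algebraicE[OF subfieldE(1)[OF E] x alg] by blast
  have p_carrier: "p \<in> carrier (poly_ring R)"
    using p(1) subfieldE(3)[OF E] unfolding univ_poly_carrier[symmetric] polynomial_def by auto
  obtain B P where BP: "hev R c u B \<noteq> \<zero>"
    "u.lift_poly P = poly_of_const (hev R c u B) \<otimes>\<^bsub>poly_ring R\<^esub> p"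
    using clear_denominators[OF u p(1)] by blast
  let ?b = "hev R c u B"
  have b: "?b \<in> carrier R" using u by blast
  have const: "poly_of_const ?b \<in> carrier (poly_ring R)"
    using b by (rule ring_hom_closed[OF const_hom])
  have "poly_of_const ?b \<noteq> \<zero>\<^bsub>poly_ring R\<^esub>"
    using BP(1) by (simp add: poly_of_const_def univ_poly_zero)
  hence "u.lift_poly P \<noteq> []"
    using UP.integral[OF _ const p_carrier] p(2) unfolding BP(2) univ_poly_zero[of R "carrier R", symmetric]
    by (auto simp: univ_poly_zero)
  hence "P \<noteq> 0"
    using u.lift_poly_0 by auto
  moreover have "hev R (hev R c u) x P = eval (poly_of_const ?b) x \<otimes> eval p x"
    using u.eval_lift_poly[OF x, of P] BP(2) ring_hom_mult[OF eval_hom[OF x] const p_carrier] by simp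
  hence "hev R (hev R c u) x P = \<zero>"
    using x b by (simp add: p(3) eval_const)
  ultimately show ?thesis by blast
qed

text \<open>
  For algebraic \<open>u\<close> all coefficients of \<open>P\<close> might vanish at \<open>u\<close>, and the relation would say nothing about
  \<open>x\<close>.
\<close>

lemma relation_imp_algebraic:
  assumes u: "u \<in> carrier R" and x: "x \<in> carrier R"
    and transc: "\<And>A. hev R c u A = \<zero> \<Longrightarrow> A = 0"
    and P: "P \<noteq> 0" "hev R (hev R c u) x P = \<zero>"
  shows "(algebraic over (generate_field R (insert u (range c)))) x"
proof -
  interpret u: type_into_field R "hev R c u"
    by (rule hev_type_into_field[OF u])
  let ?E = "generate_field R (insert u (range c))"
  have E: "subfield ?E R"
    using u by (intro generate_field_is_subfield) auto
  have "u.lift_poly P \<in> carrier (?E[X])"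
    by (rule u.lift_poly_over[OF subfieldE(1)[OF E] hev_in_generate_field[OF u]])
  moreover have "u.lift_poly P \<noteq> []"
    using u.lift_poly_eq_Nil_imp transc P(1) by blast
  moreover have "eval (u.lift_poly P) x = \<zero>"
    using u.eval_lift_poly[OF x] P(2) by simp
  ultimately show ?thesis
    by (rule algebraicI)
qed

text \<open>
  If \<open>z\<close> is transcendental over the constants, the relation between \<open>\<zeta>\<close> and \<open>z\<close> makes \<open>\<zeta>\<close> algebraic over
  the field generated by \<open>z\<close>. Then \<open>x\<close>, being algebraic over the field generated by \<open>\<zeta>\<close>, is algebraic over
  the field generated by \<open>z\<close> too.
\<close>

lemma algebraic_dependence:
  assumes \<zeta>: "\<zeta> \<in> carrier R"
    and alg: "\<And>f. f \<in> carrier R \<Longrightarrow> (algebraic over (generate_field R (insert \<zeta> (range c)))) f"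
    and z: "z \<in> carrier R" and x: "x \<in> carrier R"
  shows "\<exists>P. P \<noteq> 0 \<and> hev R (hev R c z) x P = \<zero>"
proof (cases "\<exists>A. A \<noteq> 0 \<and> hev R c z A = \<zero>")
  case True
  then obtain A where A: "A \<noteq> 0" "hev R c z A = \<zero>" by blast
  have "hev R (hev R c z) x [:A:] = \<zero>"
    using type_into_cring.hev_const[OF hev_type_into_cring[OF z] x] A(2) by simp
  thus ?thesis
    using A(1) by (intro exI[of _ "[:A:]"]) simp
next
  case False
  let ?E = "generate_field R (insert z (range c))" and ?Z = "generate_field R (insert \<zeta> (range c))"
  have E: "subfield ?E R"
    using z by (intro generate_field_is_subfield) auto
  obtain Q where Q: "Q \<noteq> 0" "hev R (hev R c \<zeta>) z Q = \<zero>"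
    using algebraic_imp_relation[OF \<zeta> z alg[OF z]] by blast
  have "hev R (hev R c z) \<zeta> (swap_poly Q) = \<zero>"
    using hev_swap[OF \<zeta> z, of Q] Q(2) by simp
  hence alg_\<zeta>: "(algebraic over ?E) \<zeta>"
    using relation_imp_algebraic[OF z \<zeta>, of "swap_poly Q"] False Q(1) by auto
  let ?F = "simple_extension ?E \<zeta>"
  have F: "subfield ?F R"
    using simple_extension_is_subfield[OF E \<zeta>] alg_\<zeta> by blast
  have "?Z \<subseteq> ?F"
  proof (rule generate_field_min_subfield1[OF _ F])
    show "insert \<zeta> (range c) \<subseteq> carrier R"
      using \<zeta> by auto
    have "range c \<subseteq> ?E"
      by (auto intro: generate_field.incl)
    thus "insert \<zeta> (range c) \<subseteq> ?F"
      using simple_extension_incl[OF subfieldE(3)[OF E] \<zeta>] simple_extension_mem[OF subfieldE(1)[OF E] \<zeta>]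
      by auto
  qed
  hence alg_F: "(algebraic over ?F) x"
    using algebraic_mono alg[OF x] by blast
  let ?G = "simple_extension ?F x"
  have "finite_dimension ?E ?F" "finite_dimension ?F ?G"
    using finite_dimension_simple_extension[OF E \<zeta>] finite_dimension_simple_extension[OF F x] alg_\<zeta> alg_F
    by auto
  hence "finite_dimension ?E ?G"
    by (rule telescopic_base_dim(1)[OF E F])
  moreover have "x \<in> ?G"
    by (rule simple_extension_mem[OF subfieldE(1)[OF F] x])
  moreover have "subring ?G R"
    by (rule simple_extension_is_subring[OF subfieldE(1)[OF F] x])
  ultimately have "(algebraic over ?E) x"
    using finite_dimension_imp_algebraic[OF E] by blast
  thus ?thesis
    by (rule algebraic_imp_relation[OF z x])
qed

section \<open>Derivations\<close>

definition const_derivation :: "('b \<Rightarrow> 'b) \<Rightarrow> bool"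
  where "const_derivation \<delta> \<longleftrightarrow> \<delta> \<in> carrier R \<rightarrow> carrier R \<and>
    (\<forall>f\<in>carrier R. \<forall>g\<in>carrier R. \<delta> (f \<oplus> g) = \<delta> f \<oplus> \<delta> g) \<and>
    (\<forall>f\<in>carrier R. \<forall>g\<in>carrier R. \<delta> (f \<otimes> g) = \<delta> f \<otimes> g \<oplus> f \<otimes> \<delta> g) \<and>
    (\<forall>a. \<forall>f\<in>carrier R. \<delta> (c a \<otimes> f) = c a \<otimes> \<delta> f)"

context
  fixes \<delta> assumes \<delta>: "const_derivation \<delta>"
begin

lemma derivation_closed [simp]: "f \<in> carrier R \<Longrightarrow> \<delta> f \<in> carrier R"
  and derivation_add: "f \<in> carrier R \<Longrightarrow> g \<in> carrier R \<Longrightarrow> \<delta> (f \<oplus> g) = \<delta> f \<oplus> \<delta> g"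
  and derivation_mult: "f \<in> carrier R \<Longrightarrow> g \<in> carrier R \<Longrightarrow> \<delta> (f \<otimes> g) = \<delta> f \<otimes> g \<oplus> f \<otimes> \<delta> g"
  and derivation_smult: "f \<in> carrier R \<Longrightarrow> \<delta> (c a \<otimes> f) = c a \<otimes> \<delta> f"
  using \<delta> by (auto simp: const_derivation_def)

lemma derivation_0: "\<delta> \<zero> = \<zero>"
  using derivation_add[of \<zero> \<zero>] derivation_closed[OF zero_closed] by (metis add.r_cancel_one l_zero zero_closed)

lemma derivation_const: "\<delta> (c a) = \<zero>"
proof -
  have "\<delta> \<one> = \<delta> \<one> \<oplus> \<delta> \<one>"
    using derivation_mult[of \<one> \<one>] by simp
  hence "\<delta> \<one> = \<zero>"
    using derivation_closed[OF one_closed] by (metis add.r_cancel_one)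
  thus ?thesis
    using derivation_smult[of \<one> a] by simp
qed

text \<open>
  The chain rule. It is used twice: for constant coefficients, where \<open>d = 0\<close>, and for coefficients that
  are polynomials in some \<open>v\<close>, where \<open>d\<close> is the formal derivative and \<open>w = \<delta> v\<close>.
\<close>

lemma derivation_hev:
  assumes C: "type_into_cring R C" and d: "\<And>a. \<delta> (C a) = C (d a) \<otimes> w" "d 0 = 0"
    and w: "w \<in> carrier R" and u: "u \<in> carrier R"
  shows "\<delta> (hev R C u P) = hev R C u (map_poly d P) \<otimes> w \<oplus> hev R C u (pderiv P) \<otimes> \<delta> u"
proof (induction P)
  case 0
  interpret C: type_into_cring R C by fact
  show ?case
    using w u by (simp add: derivation_0)
next
  case (pCons a P)
  interpret C: type_into_cring R C by fact
  let ?h = "hev R C u"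
  have "\<delta> (?h (pCons a P)) = C (d a) \<otimes> w \<oplus> (\<delta> u \<otimes> ?h P \<oplus>
      u \<otimes> (?h (map_poly d P) \<otimes> w \<oplus> ?h (pderiv P) \<otimes> \<delta> u))"
    using u by (simp add: C.hev_pCons derivation_add derivation_mult d(1) pCons)
  also have "\<dots> = (C (d a) \<oplus> u \<otimes> ?h (map_poly d P)) \<otimes> w \<oplus> (?h P \<oplus> u \<otimes> ?h (pderiv P)) \<otimes> \<delta> u"
    using u w C.c_closed[of "d a"] C.hev_closed[OF u, of P] C.hev_closed[OF u, of "map_poly d P"]
      C.hev_closed[OF u, of "pderiv P"] derivation_closed[OF u] by algebra
  also have "C (d a) \<oplus> u \<otimes> ?h (map_poly d P) = ?h (map_poly d (pCons a P))"
    using u d(2) by (simp add: map_poly_pCons C.hev_pCons)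
  also have "?h P \<oplus> u \<otimes> ?h (pderiv P) = ?h (pderiv (pCons a P))"
    using u by (simp add: pderiv_pCons C.hev_add C.hev_pCons C.c_0)
  finally show ?case .
qed

lemma derivation_hev1:
  assumes u: "u \<in> carrier R"
  shows "\<delta> (hev R c u A) = hev R c u (pderiv A) \<otimes> \<delta> u"
proof -
  have "\<delta> (hev R c u A) = hev R c u (map_poly (\<lambda>_. 0) A) \<otimes> \<one> \<oplus> hev R c u (pderiv A) \<otimes> \<delta> u"
    using u by (intro derivation_hev type_into_cring_axioms) (auto simp: derivation_const c_0)
  also have "map_poly (\<lambda>_. 0) A = 0"
    by (simp add: poly_eq_iff coeff_map_poly)
  finally show ?thesis
    using u by simp
qed

lemma derivation_hev2:
  assumes u: "u \<in> carrier R" and x: "x \<in> carrier R"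
  shows "\<delta> (hev R (hev R c u) x P) = hev R (hev R c u) x (map_poly pderiv P) \<otimes> \<delta> u \<oplus>
    hev R (hev R c u) x (pderiv P) \<otimes> \<delta> x"
  using u x by (intro derivation_hev hev_type_into_cring) (auto simp: derivation_hev1)

text \<open>
  The element \<open>x\<close> is a simple root of some \<open>P(\<zeta>, _)\<close>. Differentiating \<open>P(\<zeta>, x) = 0\<close> leaves the derivative of \<open>P\<close>
  in the outer variable times \<open>\<delta> x\<close>, and the first factor is not zero.
\<close>

lemma derivation_eq_0:
  assumes \<zeta>: "\<zeta> \<in> carrier R" and x: "x \<in> carrier R"
    and sep: "separable_element R (generate_field R (insert \<zeta> (range c))) x"
    and "\<delta> \<zeta> = \<zero>"
  shows "\<delta> x = \<zero>"
proof -
  obtain P where P: "hev R (hev R c \<zeta>) x P = \<zero>" "hev R (hev R c \<zeta>) x (pderiv P) \<noteq> \<zero>"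
    using separable_elementD[OF \<zeta> x sep] by blast
  interpret u: type_into_field R "hev R c \<zeta>"
    by (rule hev_type_into_field[OF \<zeta>])
  have "hev R (hev R c \<zeta>) x (pderiv P) \<otimes> \<delta> x = \<zero>"
    using derivation_hev2[OF \<zeta> x, of P] assms(4) x by (simp add: P(1) derivation_0)
  thus ?thesis
    using P(2) x integral_iff by auto
qed

end

end

section \<open>Inseparability and derivations\<close>

text \<open>
  A vanishing derivative kills all coefficients whose index is prime to the characteristic. If the
  remaining ones are \<open>p\<close>-th powers, the binomial theorem in characteristic \<open>p\<close> gives the root.
\<close>

lemma poly_pth_root:
  fixes P :: "'r::idom poly"
  assumes "prime CHAR('r)" "pderiv P = 0" and root: "\<And>j. \<exists>s. s ^ CHAR('r) = coeff P j"
  shows "\<exists>Q. Q ^ CHAR('r) = P \<and> (\<forall>j. coeff Q j ^ CHAR('r) = coeff P (CHAR('r) * j)) \<and>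
    CHAR('r) * degree Q = degree P"
proof -
  let ?p = "CHAR('r)"
  have p: "?p > 0"
    using assms(1) by (simp add: prime_gt_0_nat)
  obtain s where s: "s j ^ ?p = coeff P j" for j
    using root by metis
  have zero: "coeff P j = 0" if "\<not> ?p dvd j" for j
  proof (cases j)
    case 0
    thus ?thesis using that by simp
  next
    case (Suc k)
    have "of_nat (Suc k) * coeff P (Suc k) = coeff (pderiv P) k"
      by (simp only: coeff_pderiv)
    also have "\<dots> = 0"
      using assms(2) by simp
    finally show ?thesis
      using that of_nat_eq_0_iff_char_dvd[of j, where ?'a = 'r] Suc by (auto simp del: of_nat_Suc)
  qed
  define Q where "Q = (\<Sum>j\<le>degree P. Polynomial.monom (s (?p * j)) j)"
  have "Q ^ ?p = (\<Sum>j\<le>degree P. Polynomial.monom (s (?p * j)) j ^ ?p)"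
    unfolding Q_def using assms(1) by (intro freshmans_dream_sum) simp_all
  also have "\<dots> = (\<Sum>j\<le>degree P. Polynomial.monom (coeff P (?p * j)) (?p * j))"
    by (simp add: Polynomial.monom_power s mult.commute)
  also have "\<dots> = P"
  proof (rule poly_eqI)
    fix m
    show "coeff (\<Sum>j\<le>degree P. Polynomial.monom (coeff P (?p * j)) (?p * j)) m = coeff P m"
    proof (cases "?p dvd m \<and> m \<le> degree P")
      case True
      then obtain k where k: "m = ?p * k" by auto
      have "k \<le> degree P"
        using True k p by (metis le_trans mult.commute mult_le_mono2 nat_mult_1_right One_nat_def Suc_leI)
      moreover have "(\<Sum>j\<le>degree P. coeff (Polynomial.monom (coeff P (?p * j)) (?p * j)) m) =
          (\<Sum>j\<le>degree P. if j = k then coeff P m else 0)"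
        using p k by (intro sum.cong) auto
      ultimately show ?thesis
        by (simp add: coeff_sum)
    next
      case False
      hence "coeff P m = 0"
        using zero by (auto simp: coeff_eq_0)
      moreover have "(\<Sum>j\<le>degree P. coeff (Polynomial.monom (coeff P (?p * j)) (?p * j)) m) = 0"
        using False \<open>coeff P m = 0\<close> by (intro sum.neutral) auto
      ultimately show ?thesis
        by (simp add: coeff_sum)
    qed
  qed
  finally have Q: "Q ^ ?p = P" .
  moreover have "coeff Q j ^ ?p = coeff P (?p * j)" for j
  proof (cases "j \<le> degree P")
    case True
    thus ?thesis
      by (simp add: Q_def coeff_sum s)
  next
    case False
    have "j \<le> ?p * j"
      using p by simp
    hence "coeff P (?p * j) = 0"
      using False by (intro coeff_eq_0) linarith
    thus ?thesis
      using False p by (simp add: Q_def coeff_sum zero_power)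
  qed
  moreover have "?p * degree Q = degree P"
    unfolding Q[symmetric] by (cases "Q = 0") (auto simp: degree_power_eq zero_power p)
  ultimately show ?thesis by blast
qed

lemma finite_field_pth_root:
  "\<exists>y. y ^ CHAR('a) = x" for x :: "'a::finite_field"
proof -
  have prime: "prime CHAR('a)"
    by (rule prime_CHAR_semidom) (rule CHAR_pos)
  have "inj (\<lambda>y :: 'a. y ^ CHAR('a))"
  proof (rule injI)
    fix y z :: 'a assume "y ^ CHAR('a) = z ^ CHAR('a)"
    moreover have "y ^ CHAR('a) = (y - z) ^ CHAR('a) + z ^ CHAR('a)"
      using freshmans_dream[OF prime refl, of "y - z" z] by simp
    ultimately show "y = z" by simp
  qed
  hence "surj (\<lambda>y :: 'a. y ^ CHAR('a))"
    by (rule finite_UNIV_inj_surj[OF finite])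
  thus ?thesis
    by (metis surjD)
qed

locale finite_type_into_field = type_into_field R c
  for R :: "('b, 'm) ring_scheme" (structure) and c :: "'a::finite_field \<Rightarrow> 'b"
begin

lemma c_eq_0_iff: "c a = \<zero> \<longleftrightarrow> a = 0"
proof
  assume a: "c a = \<zero>"
  show "a = 0"
  proof (rule ccontr)
    assume "a \<noteq> 0"
    hence "c a \<otimes> c (inverse a) = \<one>"
      by (simp add: c_1 flip: c_mult)
    thus False
      using a by simp
  qed
qed (simp add: c_0)

text \<open>
  Take a polynomial relation between \<open>z\<close> and \<open>x\<close> of minimal bidegree. If its derivative with respect to
  \<open>x\<close> vanished at \<open>(z, x)\<close>, applying \<open>\<delta>\<close> to the relation would show that its derivative with respect to
  \<open>z\<close> vanishes there as well. By minimality both partial derivatives would be zero as polynomials, and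
  over a finite field this makes the relation a \<open>p\<close>-th power, whose root is a smaller relation.
\<close>

lemma simple_root_if_derivation_nonzero:
  assumes \<delta>: "const_derivation \<delta>" and z: "z \<in> carrier R" and x: "x \<in> carrier R"
    and "\<delta> z \<noteq> \<zero>" and dep: "\<exists>P. P \<noteq> 0 \<and> hev R (hev R c z) x P = \<zero>"
  shows "\<exists>P. hev R (hev R c z) x P = \<zero> \<and> hev R (hev R c z) x (pderiv P) \<noteq> \<zero>"
proof -
  interpret z: type_into_field R "hev R c z"
    by (rule hev_type_into_field[OF z])
  let ?h = "hev R (hev R c z) x" and ?p = "CHAR('a)"
  define rel where "rel a b P \<longleftrightarrow> P \<noteq> 0 \<and> ?h P = \<zero> \<and>
      Polynomial.degree P \<le> a \<and> (\<forall>j. Polynomial.degree (poly.coeff P j) \<le> b)"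
    for a b and P :: "'a poly poly"
  obtain P0 where P0: "P0 \<noteq> 0" "?h P0 = \<zero>"
    using dep by blast
  have "Polynomial.degree (poly.coeff P0 j) \<le> (\<Sum>j\<le>Polynomial.degree P0. Polynomial.degree (poly.coeff P0 j))" for j
    by (cases "j \<le> Polynomial.degree P0") (auto intro: member_le_sum simp: coeff_eq_0)
  hence "rel (Polynomial.degree P0) (\<Sum>j\<le>Polynomial.degree P0. Polynomial.degree (poly.coeff P0 j)) P0"
    using P0 by (simp add: rel_def)
  hence ex: "\<exists>n a b P. n = a + b \<and> rel a b P" by blast
  \<comment> \<open>a partial derivative lowers one of the two bounds and keeps the other, a root halves both at least\<close>
  define n where "n = (LEAST n. \<exists>a b P. n = a + b \<and> rel a b P)"
  have "\<exists>a b P. n = a + b \<and> rel a b P"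
    unfolding n_def using ex by (rule LeastI_ex)
  then obtain a b P where ab: "n = a + b" and P: "rel a b P" by blast
  have minimal: "a + b \<le> a' + b'" if "rel a' b' P'" for a' b' P'
    unfolding ab[symmetric] n_def using that by (intro Least_le) blast
  have "?h (pderiv P) \<noteq> \<zero>"
  proof
    assume dT: "?h (pderiv P) = \<zero>"
    have "\<zero> = ?h (map_poly pderiv P) \<otimes> \<delta> z \<oplus> ?h (pderiv P) \<otimes> \<delta> x"
      using derivation_hev2[OF \<delta> z x, of P] P derivation_0[OF \<delta>] by (simp add: rel_def)
    hence "?h (map_poly pderiv P) \<otimes> \<delta> z = \<zero>"
      using dT x z derivation_closed[OF \<delta>] by simp
    hence dZ: "?h (map_poly pderiv P) = \<zero>"
      using assms(4) x z derivation_closed[OF \<delta>] integral_iff by auto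
    have pderiv_P: "pderiv P = 0"
    proof (rule ccontr)
      assume nz: "pderiv P \<noteq> 0"
      have "Polynomial.degree P \<noteq> 0"
      proof
        assume "Polynomial.degree P = 0"
        then obtain A where "P = [:A:]" by (metis degree_eq_zeroE)
        thus False using nz by (simp add: pderiv_pCons)
      qed
      hence a: "a \<noteq> 0"
        using P by (auto simp: rel_def)
      have "Polynomial.degree (pderiv P) \<le> a - 1"
      proof (rule degree_le, intro allI impI)
        fix i assume "a - 1 < i"
        hence "Polynomial.degree P < Suc i"
          using P a by (auto simp: rel_def)
        thus "poly.coeff (pderiv P) i = 0"
          by (simp add: coeff_pderiv coeff_eq_0)
      qed
      moreover have "Polynomial.degree (poly.coeff (pderiv P) j) \<le> b" for j
      proof -
        have "Polynomial.degree (poly.coeff (pderiv P) j) \<le>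
            Polynomial.degree (of_nat (Suc j) :: 'a poly) + Polynomial.degree (poly.coeff P (Suc j))"
          unfolding coeff_pderiv by (rule degree_mult_le)
        also have "\<dots> \<le> 0 + b"
          using P by (intro add_mono) (auto simp: rel_def simp del: of_nat_Suc)
        finally show ?thesis by simp
      qed
      ultimately have "rel (a - 1) b (pderiv P)"
        using nz dT by (simp add: rel_def)
      from minimal[OF this] a show False by simp
    qed
    have pderiv_coeff: "pderiv (poly.coeff P j) = 0" for j
    proof (rule ccontr)
      assume nz: "pderiv (poly.coeff P j) \<noteq> 0"
      have "Polynomial.degree (poly.coeff P j) \<noteq> 0"
      proof
        assume "Polynomial.degree (poly.coeff P j) = 0"
        then obtain t where "poly.coeff P j = [:t:]" by (metis degree_eq_zeroE)
        thus False using nz by (simp add: pderiv_pCons)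
      qed
      hence b: "b \<noteq> 0"
        using P by (metis le_zero_eq rel_def)
      have "Polynomial.degree (poly.coeff (map_poly pderiv P) i) \<le> b - 1" for i
      proof (rule degree_le, intro allI impI)
        fix k assume "b - 1 < k"
        moreover have "Polynomial.degree (poly.coeff P i) \<le> b"
          using P by (simp add: rel_def)
        ultimately have "Polynomial.degree (poly.coeff P i) < Suc k"
          using b by simp
        thus "poly.coeff (poly.coeff (map_poly pderiv P) i) k = 0"
          by (simp add: coeff_map_poly coeff_pderiv coeff_eq_0)
      qed
      moreover have "map_poly pderiv P \<noteq> 0"
        using nz by (metis coeff_0 coeff_map_poly pderiv_0)
      moreover have "Polynomial.degree (map_poly pderiv P) \<le> a"
        using P map_poly_degree_leq[of pderiv P] by (simp add: rel_def)
      ultimately have "rel a (b - 1) (map_poly pderiv P)"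
        using dZ by (simp add: rel_def)
      from minimal[OF this] b show False by simp
    qed
    have prime: "prime ?p"
      by (rule prime_CHAR_semidom) (rule CHAR_pos)
    have "\<exists>s. s ^ ?p = poly.coeff P j" for j
      using poly_pth_root[of "poly.coeff P j"] prime pderiv_coeff finite_field_pth_root by auto
    then obtain Q where Q: "Q ^ ?p = P" "\<And>j. poly.coeff Q j ^ ?p = poly.coeff P (?p * j)"
      "?p * Polynomial.degree Q = Polynomial.degree P"
      using poly_pth_root[of P] prime pderiv_P by auto
    have p2: "?p \<ge> 2"
      using prime by (rule prime_ge_2_nat)
    have pow: "?h (Q ^ k) = \<zero> \<Longrightarrow> ?h Q = \<zero>" for k
    proof (induction k)
      case 0
      thus ?case
        using x z by (simp add: one_pCons z.hev_const hev_const c_1)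
    next
      case (Suc k)
      thus ?case
        using x by (auto simp: z.hev_mult integral_iff)
    qed
    have "Polynomial.degree (poly.coeff Q j) \<le> b div 2" for j
    proof -
      have "?p * Polynomial.degree (poly.coeff Q j) = Polynomial.degree (poly.coeff P (?p * j))"
        unfolding Q(2)[symmetric] using p2
        by (cases "poly.coeff Q j = 0") (auto simp: degree_power_eq zero_power)
      also have "\<dots> \<le> b"
        using P by (simp add: rel_def)
      finally have "2 * Polynomial.degree (poly.coeff Q j) \<le> b"
        using mult_le_mono1[OF p2, of "Polynomial.degree (poly.coeff Q j)"] by linarith
      thus ?thesis by simp
    qed
    moreover have "Polynomial.degree Q \<le> a div 2"
    proof -
      have "2 * Polynomial.degree Q \<le> a"
        using Q(3) P mult_le_mono1[OF p2, of "Polynomial.degree Q"] unfolding rel_def by linarith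
      thus ?thesis by simp
    qed
    moreover have "?h Q = \<zero>"
      using pow[of ?p] P Q(1) by (simp add: rel_def)
    moreover have "Q \<noteq> 0"
      using P Q(1) p2 by (auto simp: rel_def zero_power)
    ultimately have "rel (a div 2) (b div 2) Q"
      by (simp add: rel_def)
    from minimal[OF this] have "a = 0" "b = 0"
      by linarith+
    then obtain A where A: "P = [:A:]"
      using P by (metis degree_eq_zeroE le_zero_eq rel_def)
    hence "Polynomial.degree A = 0"
      using P \<open>b = 0\<close> unfolding rel_def by (metis coeff_pCons_0 le_zero_eq)
    then obtain t where t: "A = [:t:]"
      by (metis degree_eq_zeroE)
    have "?h P = c t"
      using x z by (simp add: A t z.hev_const hev_const)
    thus False
      using P by (auto simp: rel_def A t c_eq_0_iff)
  qed
  thus ?thesis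
    using P unfolding rel_def by blast
qed

end

section \<open>Determinants\<close>

context cring
begin

lemma finsum_swap:
  assumes "finite J" "finite S" "\<And>x j. x \<in> S \<Longrightarrow> j \<in> J \<Longrightarrow> g x j \<in> carrier R"
  shows "(\<Oplus>x\<in>S. \<Oplus>j\<in>J. g x j) = (\<Oplus>j\<in>J. \<Oplus>x\<in>S. g x j)"
  using assms(1,3)
proof (induction J rule: finite_induct)
  case empty
  have "(\<Oplus>x\<in>S. \<zero>) = \<zero>"
    by (rule finsum_zero)
  thus ?case by simp
next
  case (insert j J)
  have "(\<Oplus>x\<in>S. \<Oplus>j\<in>insert j J. g x j) = (\<Oplus>x\<in>S. g x j \<oplus> (\<Oplus>j\<in>J. g x j))"
    using insert by (intro finsum_cong') (auto intro!: finsum_closed finsum_insert)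
  also have "\<dots> = (\<Oplus>x\<in>S. g x j) \<oplus> (\<Oplus>x\<in>S. \<Oplus>j\<in>J. g x j)"
    using insert by (intro finsum_addf) (auto intro!: finsum_closed)
  also have "\<dots> = (\<Oplus>j\<in>insert j J. \<Oplus>x\<in>S. g x j)"
    using insert by (subst finsum_insert) (auto intro!: finsum_closed)
  finally show ?case .
qed

definition replace_col :: "(nat \<Rightarrow> nat \<Rightarrow> 'a) \<Rightarrow> nat \<Rightarrow> (nat \<Rightarrow> 'a) \<Rightarrow> nat \<Rightarrow> nat \<Rightarrow> 'a"
  where "replace_col A k u = (\<lambda>i l. if l = k then u i else A i l)"

text \<open>
  The contribution of the permutation \<open>\<pi>\<close> to the determinant without the factor from column \<open>k\<close>.
\<close>

definition cofactor_term :: "nat \<Rightarrow> (nat \<Rightarrow> nat \<Rightarrow> 'a) \<Rightarrow> nat \<Rightarrow> (nat \<Rightarrow> nat) \<Rightarrow> 'a"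
  where "cofactor_term N A k \<pi> = [sign \<pi>] \<cdot> (\<Otimes>i\<in>{..<N} - {inv_into UNIV \<pi> k}. A i (\<pi> i))"

lemma cofactor_term_closed:
  assumes "\<And>i l. i < N \<Longrightarrow> l < N \<Longrightarrow> A i l \<in> carrier R" "\<pi> permutes {..<N}"
  shows "cofactor_term N A k \<pi> \<in> carrier R"
  unfolding cofactor_term_def
  using assms permutes_in_image[OF assms(2)] by (intro add.int_pow_closed finprod_closed) auto

lemma ring_det_replace_col:
  assumes A: "\<And>i l. i < N \<Longrightarrow> l < N \<Longrightarrow> A i l \<in> carrier R" and u: "\<And>i. i < N \<Longrightarrow> u i \<in> carrier R"
    and k: "k < N"
  shows "ring_det R N (replace_col A k u) =
    (\<Oplus>\<pi>\<in>{\<pi>. \<pi> permutes {..<N}}. u (inv_into UNIV \<pi> k) \<otimes> cofactor_term N A k \<pi>)"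
  unfolding ring_det_def
proof (rule finsum_cong')
  show "{\<pi>. \<pi> permutes {..<N}} = {\<pi>. \<pi> permutes {..<N}}" ..
  have inv_less: "inv_into UNIV \<pi> k < N" if "\<pi> permutes {..<N}" for \<pi>
    using permutes_in_image[OF permutes_inv[OF that], of k] k by simp
  show "(\<lambda>\<pi>. u (inv_into UNIV \<pi> k) \<otimes> cofactor_term N A k \<pi>) \<in> {\<pi>. \<pi> permutes {..<N}} \<rightarrow> carrier R"
    using u inv_less cofactor_term_closed[of N A] A by auto
  fix \<pi> assume "\<pi> \<in> {\<pi>. \<pi> permutes {..<N}}"
  hence \<pi>: "\<pi> permutes {..<N}" by simp
  let ?m = "inv_into UNIV \<pi> k"
  have m: "\<pi> ?m = k" "?m < N"
    using permutes_inverses(1)[OF \<pi>] inv_less[OF \<pi>] by auto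
  have \<pi>_less: "\<pi> i < N" if "i < N" for i
    using permutes_in_image[OF \<pi>, of i] that by simp
  have neq: "\<pi> i \<noteq> k" if "i \<noteq> ?m" for i
    using that permutes_inverses(2)[OF \<pi>] by metis
  have "(\<Otimes>i\<in>{..<N}. replace_col A k u i (\<pi> i)) =
      (\<Otimes>i\<in>insert ?m ({..<N} - {?m}). replace_col A k u i (\<pi> i))"
    using m by (simp add: insert_absorb)
  also have "\<dots> = replace_col A k u ?m (\<pi> ?m) \<otimes> (\<Otimes>i\<in>{..<N} - {?m}. replace_col A k u i (\<pi> i))"
    using A u m \<pi>_less by (intro finprod_insert) (auto simp: replace_col_def)
  also have "replace_col A k u ?m (\<pi> ?m) = u ?m"
    by (simp add: replace_col_def m)
  also have "(\<Otimes>i\<in>{..<N} - {?m}. replace_col A k u i (\<pi> i)) = (\<Otimes>i\<in>{..<N} - {?m}. A i (\<pi> i))"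
    using A \<pi>_less neq by (intro finprod_cong') (auto simp: replace_col_def)
  finally have eq: "(\<Otimes>i\<in>{..<N}. replace_col A k u i (\<pi> i)) = u ?m \<otimes> (\<Otimes>i\<in>{..<N} - {?m}. A i (\<pi> i))" .
  have "(\<Otimes>i\<in>{..<N} - {?m}. A i (\<pi> i)) \<in> carrier R"
    using A \<pi>_less by (intro finprod_closed) auto
  thus "[sign \<pi>] \<cdot> (\<Otimes>i\<in>{..<N}. replace_col A k u i (\<pi> i)) = u ?m \<otimes> cofactor_term N A k \<pi>"
    unfolding eq cofactor_term_def using u m by (simp add: add_pow_rdistr_int)
qed

text \<open>
  Composing permutations with the transposition of the two columns shows that the determinant is its own
  negative.
\<close>

lemma ring_det_equal_cols:
  assumes A: "\<And>i l. i < N \<Longrightarrow> l < N \<Longrightarrow> A i l \<in> carrier R"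
    and jk: "j < N" "k < N" "j \<noteq> k" and eq: "\<And>i. i < N \<Longrightarrow> A i j = A i k"
  shows "ring_det R N A \<oplus> ring_det R N A = \<zero>"
proof -
  let ?S = "{\<pi>. \<pi> permutes {..<N}}" and ?t = "\<lambda>\<pi>. Transposition.transpose j k \<circ> \<pi>"
  have tr: "Transposition.transpose j k permutes {..<N}"
    using jk by (intro permutes_swap_id) auto
  have image: "?t ` ?S = ?S"
  proof
    show "?t ` ?S \<subseteq> ?S"
      using permutes_compose[OF _ tr] by auto
    show "?S \<subseteq> ?t ` ?S"
    proof
      fix \<pi> assume "\<pi> \<in> ?S"
      hence "?t \<pi> \<in> ?S" "\<pi> = ?t (?t \<pi>)"
        using permutes_compose[OF _ tr] by (auto simp: fun_eq_iff)
      thus "\<pi> \<in> ?t ` ?S" by blast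
    qed
  qed
  have inj: "inj_on ?t ?S"
    by (rule inj_onI) (metis comp_assoc id_comp transpose_comp_involutory)
  let ?f = "\<lambda>\<pi>. [sign \<pi>] \<cdot> (\<Otimes>i\<in>{..<N}. A i (\<pi> i))"
  have less: "\<pi> i < N" if "\<pi> \<in> ?S" "i < N" for \<pi> i
    using that permutes_in_image[of \<pi> "{..<N}" i] by simp
  have prod_closed: "(\<Otimes>i\<in>{..<N}. A i (\<pi> i)) \<in> carrier R" if "\<pi> \<in> ?S" for \<pi>
    using A less[OF that] by (intro finprod_closed) auto
  have f: "?f \<in> ?S \<rightarrow> carrier R"
    using prod_closed by auto
  have "ring_det R N A = (\<Oplus>\<pi>\<in>?S. ?f (?t \<pi>))"
    unfolding ring_det_def using finsum_reindex[of ?f ?t ?S] f inj by (simp add: image)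
  also have "\<dots> = (\<Oplus>\<pi>\<in>?S. \<ominus> ?f \<pi>)"
  proof (rule finsum_cong')
    show "(\<lambda>\<pi>. \<ominus> ?f \<pi>) \<in> ?S \<rightarrow> carrier R"
      using f by auto
    fix \<pi> assume \<pi>: "\<pi> \<in> ?S"
    have "(\<Otimes>i\<in>{..<N}. A i (?t \<pi> i)) = (\<Otimes>i\<in>{..<N}. A i (\<pi> i))"
      using A eq less[OF \<pi>] by (intro finprod_cong') (auto simp: Transposition.transpose_def)
    moreover have "sign (?t \<pi>) = - sign \<pi>"
      using \<pi> jk by (subst sign_compose) (auto intro: permutation_swap_id permutation_permutes[THEN iffD2] simp: sign_swap_id)
    ultimately show "?f (?t \<pi>) = \<ominus> ?f \<pi>"
      using prod_closed[OF \<pi>] by (simp add: add.int_pow_neg)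
  qed simp
  finally have neg: "ring_det R N A = (\<Oplus>\<pi>\<in>?S. \<ominus> ?f \<pi>)" .
  have "ring_det R N A \<oplus> ring_det R N A = (\<Oplus>\<pi>\<in>?S. ?f \<pi>) \<oplus> (\<Oplus>\<pi>\<in>?S. \<ominus> ?f \<pi>)"
    using neg by (simp add: ring_det_def)
  also have "\<dots> = (\<Oplus>\<pi>\<in>?S. ?f \<pi> \<oplus> \<ominus> ?f \<pi>)"
    using f by (intro finsum_addf[symmetric]) auto
  also have "\<dots> = (\<Oplus>\<pi>\<in>?S. \<zero>)"
    using r_neg[OF funcset_mem[OF f]] by (intro finsum_cong') auto
  finally show ?thesis
    by (simp add: finsum_zero)
qed

end

text \<open>
  Multiplying the determinant by \<open>z k\<close> amounts to replacing column \<open>k\<close> by the combination of all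
  columns with coefficients \<open>z\<close>, up to determinants with two equal columns.
\<close>

lemma (in domain) ring_det_eq_0_if_kernel:
  assumes A: "\<And>i l. i < N \<Longrightarrow> l < N \<Longrightarrow> A i l \<in> carrier R"
    and z: "\<And>j. j < N \<Longrightarrow> z j \<in> carrier R"
    and kernel: "\<And>i. i < N \<Longrightarrow> (\<Oplus>j\<in>{..<N}. z j \<otimes> A i j) = \<zero>"
    and k: "k < N" "z k \<noteq> \<zero>"
    and char: "\<And>x. x \<in> carrier R \<Longrightarrow> x \<oplus> x = \<zero> \<Longrightarrow> x = \<zero>"
  shows "ring_det R N A = \<zero>"
proof -
  let ?S = "{\<pi>. \<pi> permutes {..<N}}" and ?c = "cofactor_term N A k"
  have fin: "finite ?S"
    by (intro finite_permutations) simp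
  have c: "?c \<pi> \<in> carrier R" if "\<pi> \<in> ?S" for \<pi>
    using cofactor_term_closed[OF A] that by simp
  have m: "inv_into UNIV \<pi> k < N" if "\<pi> \<in> ?S" for \<pi>
    using permutes_in_image[OF permutes_inv, of \<pi> "{..<N}" k] k that by simp
  have det_closed: "ring_det R N B \<in> carrier R" if "\<And>i l. i < N \<Longrightarrow> l < N \<Longrightarrow> B i l \<in> carrier R" for B
    unfolding ring_det_def
  proof (intro finsum_closed funcsetI add.int_pow_closed finprod_closed)
    fix \<pi> i assume "\<pi> \<in> ?S" "i \<in> {..<N}"
    thus "B i (\<pi> i) \<in> carrier R"
      using that permutes_in_image[of \<pi> "{..<N}" i] by simp
  qed
  have col: "z j \<otimes> ring_det R N (replace_col A k (\<lambda>i. A i j)) =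
      (\<Oplus>\<pi>\<in>?S. (z j \<otimes> A (inv_into UNIV \<pi> k) j) \<otimes> ?c \<pi>)" if j: "j < N" for j
  proof -
    have "z j \<otimes> ring_det R N (replace_col A k (\<lambda>i. A i j)) =
        z j \<otimes> (\<Oplus>\<pi>\<in>?S. A (inv_into UNIV \<pi> k) j \<otimes> ?c \<pi>)"
      using A j k(1) by (subst ring_det_replace_col) auto
    also have "\<dots> = (\<Oplus>\<pi>\<in>?S. z j \<otimes> (A (inv_into UNIV \<pi> k) j \<otimes> ?c \<pi>))"
      using A m c z j fin by (intro finsum_rdistr) auto
    also have "\<dots> = (\<Oplus>\<pi>\<in>?S. (z j \<otimes> A (inv_into UNIV \<pi> k) j) \<otimes> ?c \<pi>)"
      using A m c z j by (intro finsum_cong') (auto simp: m_assoc)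
    finally show ?thesis .
  qed
  have "(\<Oplus>j\<in>{..<N}. z j \<otimes> ring_det R N (replace_col A k (\<lambda>i. A i j))) =
      (\<Oplus>j\<in>{..<N}. \<Oplus>\<pi>\<in>?S. (z j \<otimes> A (inv_into UNIV \<pi> k) j) \<otimes> ?c \<pi>)"
    using A m c z by (intro finsum_cong') (auto simp: col intro!: finsum_closed)
  also have "\<dots> = (\<Oplus>\<pi>\<in>?S. \<Oplus>j\<in>{..<N}. (z j \<otimes> A (inv_into UNIV \<pi> k) j) \<otimes> ?c \<pi>)"
    using A m c z fin by (intro finsum_swap) auto
  also have "\<dots> = (\<Oplus>\<pi>\<in>?S. \<zero>)"
  proof (rule finsum_cong')
    fix \<pi> assume \<pi>: "\<pi> \<in> ?S"
    have "(\<Oplus>j\<in>{..<N}. (z j \<otimes> A (inv_into UNIV \<pi> k) j) \<otimes> ?c \<pi>) =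
        (\<Oplus>j\<in>{..<N}. z j \<otimes> A (inv_into UNIV \<pi> k) j) \<otimes> ?c \<pi>"
      using A m[OF \<pi>] c[OF \<pi>] z by (intro finsum_ldistr[symmetric]) auto
    thus "(\<Oplus>j\<in>{..<N}. (z j \<otimes> A (inv_into UNIV \<pi> k) j) \<otimes> ?c \<pi>) = \<zero>"
      using kernel[OF m[OF \<pi>]] c[OF \<pi>] by simp
  qed auto
  also have "\<dots> = \<zero>"
    by (rule finsum_zero)
  finally have sum0: "(\<Oplus>j\<in>{..<N}. z j \<otimes> ring_det R N (replace_col A k (\<lambda>i. A i j))) = \<zero>" .
  have "replace_col A k (\<lambda>i. A i k) = A"
    by (auto simp: replace_col_def fun_eq_iff)
  moreover have "ring_det R N (replace_col A k (\<lambda>i. A i j)) = \<zero>" if "j < N" "j \<noteq> k" for j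
  proof (rule char)
    have closed: "replace_col A k (\<lambda>i. A i j) i l \<in> carrier R" if "i < N" "l < N" for i l
      using A that \<open>j < N\<close> by (auto simp: replace_col_def)
    thus "ring_det R N (replace_col A k (\<lambda>i. A i j)) \<in> carrier R"
      by (rule det_closed)
    show "ring_det R N (replace_col A k (\<lambda>i. A i j)) \<oplus> ring_det R N (replace_col A k (\<lambda>i. A i j)) = \<zero>"
      using that k(1) closed by (intro ring_det_equal_cols[of N _ j k]) (auto simp: replace_col_def)
  qed
  ultimately have "(\<Oplus>j\<in>{..<N}. z j \<otimes> ring_det R N (replace_col A k (\<lambda>i. A i j))) =
      (\<Oplus>j\<in>{..<N}. if k = j then z k \<otimes> ring_det R N A else \<zero>)"
    using z k det_closed[OF A] by (intro finsum_cong') auto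
  also have "\<dots> = z k \<otimes> ring_det R N A"
    using finsum_singleton[of k "{..<N}" "\<lambda>_. z k \<otimes> ring_det R N A"] z k det_closed[OF A] by simp
  finally have "z k \<otimes> ring_det R N A = \<zero>"
    using sum0 by simp
  moreover have "ring_det R N A \<in> carrier R" "z k \<in> carrier R"
    using A k(1) z by (auto intro: det_closed)
  ultimately show ?thesis
    using integral[of "z k" "ring_det R N A"] k(2) by blast
qed

section \<open>Hasse derivatives\<close>

context finite_type_into_field
begin

context
  fixes D :: "nat \<Rightarrow> 'b \<Rightarrow> 'b" and \<zeta> :: 'b
  assumes D: "hasse_derivatives R (range c) \<zeta> D" and \<zeta>: "\<zeta> \<in> carrier R"
    and separating: "\<And>f. f \<in> carrier R \<Longrightarrow> separable_element R (generate_field R (insert \<zeta> (range c))) f"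
begin

lemma D_closed [simp]: "f \<in> carrier R \<Longrightarrow> D n f \<in> carrier R"
  and D_0: "f \<in> carrier R \<Longrightarrow> D 0 f = f"
  and D_add: "f \<in> carrier R \<Longrightarrow> g \<in> carrier R \<Longrightarrow> D n (f \<oplus> g) = D n f \<oplus> D n g"
  and D_smult: "f \<in> carrier R \<Longrightarrow> D n (c a \<otimes> f) = c a \<otimes> D n f"
  and D_mult: "f \<in> carrier R \<Longrightarrow> g \<in> carrier R \<Longrightarrow> D n (f \<otimes> g) = (\<Oplus>i\<in>{..n}. D i f \<otimes> D (n - i) g)"
  and D_1_\<zeta>: "D 1 \<zeta> = \<one>" and D_\<zeta>: "n \<ge> 2 \<Longrightarrow> D n \<zeta> = \<zero>"
  using D unfolding hasse_derivatives_def by auto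

lemma D_zero: "D n \<zero> = \<zero>"
proof -
  have "D n \<zero> \<oplus> D n \<zero> = D n \<zero>"
    using D_add[of \<zero> \<zero> n] by simp
  thus ?thesis
    using D_closed[OF zero_closed, of n] by (metis add.r_cancel_one)
qed

lemma D_finsum:
  "(\<And>i. i \<in> A \<Longrightarrow> f i \<in> carrier R) \<Longrightarrow> finite A \<Longrightarrow> D n (\<Oplus>i\<in>A. f i) = (\<Oplus>i\<in>A. D n (f i))"
proof (induction A rule: infinite_finite_induct)
  case (insert x A)
  have "D n (\<Oplus>i\<in>insert x A. f i) = D n (f x \<oplus> (\<Oplus>i\<in>A. f i))"
    using insert by (subst finsum_insert) auto
  also have "\<dots> = D n (f x) \<oplus> (\<Oplus>i\<in>A. D n (f i))"
    using insert by (subst D_add) auto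
  also have "\<dots> = (\<Oplus>i\<in>insert x A. D n (f i))"
    using insert by (subst finsum_insert) auto
  finally show ?case .
qed (auto simp: D_zero)

lemma const_derivation_D_1: "const_derivation (D 1)"
  unfolding const_derivation_def
proof (intro conjI ballI allI)
  fix f g assume fg: "f \<in> carrier R" "g \<in> carrier R"
  have "D 1 (f \<otimes> g) = (\<Oplus>i\<in>{..Suc 0}. D i f \<otimes> D (1 - i) g)"
    using D_mult[OF fg, of 1] by simp
  also have "\<dots> = D 1 f \<otimes> D 0 g \<oplus> D 0 f \<otimes> D 1 g"
    using fg by (subst finsum_Suc) auto
  finally show "D 1 (f \<otimes> g) = D 1 f \<otimes> g \<oplus> f \<otimes> D 1 g"
    using fg by (simp add: D_0)
qed (auto simp: D_add D_smult)

lemma add_minus_rearrange: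
  assumes "a \<in> carrier R" "b \<in> carrier R" "p \<in> carrier R" "q \<in> carrier R"
  shows "(a \<oplus> p) \<oplus> (b \<oplus> q) \<ominus> (a \<oplus> b) = p \<oplus> q"
  using assms by algebra

text \<open>
  Let \<open>\<delta>\<close> be the difference of the two sides. By the Leibniz rules, and because the identity holds in
  lower order, \<open>\<delta>\<close> is a derivation; splitting \<open>m + 1 = i + (m + 1 - i)\<close> in each term of the rule for
  \<open>D (m + 1)\<close> makes all but two terms cancel. It vanishes at the separating element, hence everywhere.
\<close>

lemma hasse_iterate: "f \<in> carrier R \<Longrightarrow> c (of_nat (Suc m)) \<otimes> D (Suc m) f = D 1 (D m f)"
proof (induction m arbitrary: f rule: less_induct)
  case (less m)
  let ?n = "Suc m"
  define \<delta> where "\<delta> f = c (of_nat ?n) \<otimes> D ?n f \<ominus> D 1 (D m f)" for f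
  note deriv = const_derivation_D_1
  have \<delta>_closed: "\<delta> f \<in> carrier R" if "f \<in> carrier R" for f
    using that by (simp add: \<delta>_def)
  have "const_derivation \<delta>"
    unfolding const_derivation_def
  proof (intro conjI ballI allI)
    show "\<delta> \<in> carrier R \<rightarrow> carrier R"
      using \<delta>_closed by blast
  next
    fix f g assume fg: "f \<in> carrier R" "g \<in> carrier R"
    have "c (of_nat ?n) \<otimes> (D ?n f \<oplus> D ?n g) \<ominus> (D 1 (D m f) \<oplus> D 1 (D m g)) =
        (c (of_nat ?n) \<otimes> D ?n f \<ominus> D 1 (D m f)) \<oplus> (c (of_nat ?n) \<otimes> D ?n g \<ominus> D 1 (D m g))"
      using fg c_closed[of "of_nat ?n"] D_closed[OF fg(1), of ?n] D_closed[OF fg(2), of ?n]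
        D_closed[OF D_closed[OF fg(1), of m], of 1] D_closed[OF D_closed[OF fg(2), of m], of 1]
      by algebra
    thus "\<delta> (f \<oplus> g) = \<delta> f \<oplus> \<delta> g"
      using fg by (simp add: \<delta>_def D_add)
  next
    fix a f assume f: "f \<in> carrier R"
    have "c (of_nat ?n) \<otimes> (c a \<otimes> D ?n f) \<ominus> c a \<otimes> D 1 (D m f) =
        c a \<otimes> (c (of_nat ?n) \<otimes> D ?n f \<ominus> D 1 (D m f))"
      using f c_closed[of "of_nat ?n"] c_closed[of a] D_closed[OF f, of ?n]
        D_closed[OF D_closed[OF f, of m], of 1] by algebra
    thus "\<delta> (c a \<otimes> f) = c a \<otimes> \<delta> f"
      using f by (simp add: \<delta>_def D_smult)
  next
    fix f g assume fg: "f \<in> carrier R" "g \<in> carrier R"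
    define S1 where "S1 = (\<Oplus>i\<in>{..m}. D 1 (D i f) \<otimes> D (m - i) g)"
    define S2 where "S2 = (\<Oplus>i\<in>{..m}. D i f \<otimes> D 1 (D (m - i) g))"
    define T1 where "T1 = (\<Oplus>i\<in>{..m}. c (of_nat (Suc i)) \<otimes> D (Suc i) f \<otimes> D (m - i) g)"
    define T2 where "T2 = (\<Oplus>i\<in>{..m}. D i f \<otimes> (c (of_nat (Suc (m - i))) \<otimes> D (Suc (m - i)) g))"
    have closed: "S1 \<in> carrier R" "S2 \<in> carrier R" "T1 \<in> carrier R" "T2 \<in> carrier R"
      unfolding S1_def S2_def T1_def T2_def using fg by (auto intro!: finsum_closed)
    have "D 1 (D m (f \<otimes> g)) = (\<Oplus>i\<in>{..m}. D 1 (D i f \<otimes> D (m - i) g))"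
      using fg by (simp add: D_mult D_finsum)
    also have "\<dots> = (\<Oplus>i\<in>{..m}. D 1 (D i f) \<otimes> D (m - i) g \<oplus> D i f \<otimes> D 1 (D (m - i) g))"
      using fg by (intro finsum_cong') (auto simp: derivation_mult[OF deriv] simp del: One_nat_def)
    also have "\<dots> = S1 \<oplus> S2"
      unfolding S1_def S2_def using fg by (intro finsum_addf) auto
    finally have lhs: "D 1 (D m (f \<otimes> g)) = S1 \<oplus> S2" .
    have "c (of_nat ?n) \<otimes> D ?n (f \<otimes> g) =
        (\<Oplus>i\<in>{..?n}. c (of_nat ?n) \<otimes> (D i f \<otimes> D (?n - i) g))"
      unfolding D_mult[OF fg] using fg by (intro finsum_rdistr) auto
    also have "\<dots> = (\<Oplus>i\<in>{..?n}. c (of_nat i) \<otimes> D i f \<otimes> D (?n - i) g \<oplus>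
        D i f \<otimes> (c (of_nat (?n - i)) \<otimes> D (?n - i) g))"
    proof (rule finsum_cong')
      fix i assume i: "i \<in> {..?n}"
      have "(of_nat ?n :: 'a) = of_nat i + of_nat (?n - i)"
        using i by (simp only: of_nat_add[symmetric]) simp
      hence "c (of_nat ?n) = c (of_nat i) \<oplus> c (of_nat (?n - i))"
        by (simp only: c_add)
      moreover have "(c (of_nat i) \<oplus> c (of_nat (?n - i))) \<otimes> (D i f \<otimes> D (?n - i) g) =
          c (of_nat i) \<otimes> D i f \<otimes> D (?n - i) g \<oplus> D i f \<otimes> (c (of_nat (?n - i)) \<otimes> D (?n - i) g)"
        using D_closed[OF fg(1), of i] D_closed[OF fg(2), of "?n - i"] c_closed[of "of_nat i"]
          c_closed[of "of_nat (?n - i)"] by algebra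
      ultimately show "c (of_nat ?n) \<otimes> (D i f \<otimes> D (?n - i) g) =
          c (of_nat i) \<otimes> D i f \<otimes> D (?n - i) g \<oplus> D i f \<otimes> (c (of_nat (?n - i)) \<otimes> D (?n - i) g)"
        by simp
    qed (use fg in auto)
    also have "\<dots> = (\<Oplus>i\<in>{..?n}. c (of_nat i) \<otimes> D i f \<otimes> D (?n - i) g) \<oplus>
        (\<Oplus>i\<in>{..?n}. D i f \<otimes> (c (of_nat (?n - i)) \<otimes> D (?n - i) g))"
      using fg by (intro finsum_addf) auto
    also have "(\<Oplus>i\<in>{..?n}. c (of_nat i) \<otimes> D i f \<otimes> D (?n - i) g) = T1"
      unfolding T1_def using fg by (subst finsum_Suc2) (auto simp: c_0 simp del: of_nat_Suc)
    also have "(\<Oplus>i\<in>{..?n}. D i f \<otimes> (c (of_nat (?n - i)) \<otimes> D (?n - i) g)) =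
        (\<Oplus>i\<in>{..m}. D i f \<otimes> (c (of_nat (?n - i)) \<otimes> D (?n - i) g))"
      using fg by (subst finsum_Suc) (auto simp: c_0 simp del: of_nat_Suc)
    also have "\<dots> = T2"
      unfolding T2_def using fg by (intro finsum_cong') (auto simp: Suc_diff_le simp del: of_nat_Suc)
    finally have rhs: "c (of_nat ?n) \<otimes> D ?n (f \<otimes> g) = T1 \<oplus> T2" .
    have T1_eq: "T1 = S1 \<oplus> \<delta> f \<otimes> g"
    proof -
      let ?e = "\<lambda>i. if m = i then \<delta> f \<otimes> g else \<zero>"
      have "T1 = (\<Oplus>i\<in>{..m}. D 1 (D i f) \<otimes> D (m - i) g \<oplus> ?e i)"
        unfolding T1_def
      proof (rule finsum_cong')
        fix i assume i: "i \<in> {..m}"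
        show "c (of_nat (Suc i)) \<otimes> D (Suc i) f \<otimes> D (m - i) g = D 1 (D i f) \<otimes> D (m - i) g \<oplus> ?e i"
        proof (cases "i = m")
          case True
          have "c (of_nat ?n) \<otimes> D ?n f \<otimes> g =
              D 1 (D m f) \<otimes> g \<oplus> (c (of_nat ?n) \<otimes> D ?n f \<ominus> D 1 (D m f)) \<otimes> g"
            using fg c_closed[of "of_nat ?n"] D_closed[OF fg(1), of ?n]
              D_closed[OF D_closed[OF fg(1), of m], of 1] by algebra
          thus ?thesis
            using True fg by (simp add: \<delta>_def D_0)
        next
          case False
          hence "c (of_nat (Suc i)) \<otimes> D (Suc i) f = D 1 (D i f)"
            using i fg by (intro less.IH) auto
          thus ?thesis
            using False fg by simp
        qed
      qed (use fg \<delta>_closed in auto)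
      also have "\<dots> = S1 \<oplus> (\<Oplus>i\<in>{..m}. ?e i)"
        unfolding S1_def using fg \<delta>_closed by (intro finsum_addf) auto
      also have "(\<Oplus>i\<in>{..m}. ?e i) = \<delta> f \<otimes> g"
        using fg \<delta>_closed by (intro finsum_singleton) auto
      finally show ?thesis .
    qed
    have T2_eq: "T2 = S2 \<oplus> f \<otimes> \<delta> g"
    proof -
      let ?e = "\<lambda>i. if 0 = i then f \<otimes> \<delta> g else \<zero>"
      have "T2 = (\<Oplus>i\<in>{..m}. D i f \<otimes> D 1 (D (m - i) g) \<oplus> ?e i)"
        unfolding T2_def
      proof (rule finsum_cong')
        fix i assume i: "i \<in> {..m}"
        show "D i f \<otimes> (c (of_nat (Suc (m - i))) \<otimes> D (Suc (m - i)) g) = D i f \<otimes> D 1 (D (m - i) g) \<oplus> ?e i"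
        proof (cases "i = 0")
          case True
          have "f \<otimes> (c (of_nat ?n) \<otimes> D ?n g) =
              f \<otimes> D 1 (D m g) \<oplus> f \<otimes> (c (of_nat ?n) \<otimes> D ?n g \<ominus> D 1 (D m g))"
            using fg c_closed[of "of_nat ?n"] D_closed[OF fg(2), of ?n]
              D_closed[OF D_closed[OF fg(2), of m], of 1] by algebra
          thus ?thesis
            using True fg by (simp add: \<delta>_def D_0)
        next
          case False
          hence "c (of_nat (Suc (m - i))) \<otimes> D (Suc (m - i)) g = D 1 (D (m - i) g)"
            using i fg by (intro less.IH) auto
          thus ?thesis
            using False fg by simp
        qed
      qed (use fg \<delta>_closed in auto)
      also have "\<dots> = S2 \<oplus> (\<Oplus>i\<in>{..m}. ?e i)"
        unfolding S2_def using fg \<delta>_closed by (intro finsum_addf) auto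
      also have "(\<Oplus>i\<in>{..m}. ?e i) = f \<otimes> \<delta> g"
        using fg \<delta>_closed by (intro finsum_singleton) auto
      finally show ?thesis .
    qed
    have "\<delta> (f \<otimes> g) = (S1 \<oplus> \<delta> f \<otimes> g) \<oplus> (S2 \<oplus> f \<otimes> \<delta> g) \<ominus> (S1 \<oplus> S2)"
      unfolding T1_eq[symmetric] T2_eq[symmetric] lhs[symmetric] rhs[symmetric] by (simp only: \<delta>_def)
    thus "\<delta> (f \<otimes> g) = \<delta> f \<otimes> g \<oplus> f \<otimes> \<delta> g"
      using closed fg \<delta>_closed by (simp add: add_minus_rearrange)
  qed
  moreover have "\<delta> \<zeta> = \<zero>"
  proof -
    consider "m = 0" | "m = 1" | "m \<ge> 2" by linarith
    thus ?thesis
    proof cases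
      case 1
      thus ?thesis
        using \<zeta> by (simp add: \<delta>_def D_0 D_1_\<zeta>[simplified] c_1 a_minus_def r_neg)
    next
      case 2
      have "D 1 \<one> = \<zero>"
        using derivation_const[OF deriv, of 1] by (simp add: c_1)
      thus ?thesis
        using 2 D_\<zeta>[of 2] by (simp add: \<delta>_def D_1_\<zeta>[simplified] a_minus_def numeral_2_eq_2)
    next
      case 3
      thus ?thesis
        using D_\<zeta>[of m] D_\<zeta>[of "Suc m"] D_zero[of 1] by (simp add: \<delta>_def a_minus_def)
    qed
  qed
  ultimately have "\<delta> f = \<zero>"
    using derivation_eq_0 \<zeta> less.prems separating by blast
  thus ?case
    using less.prems by (simp add: \<delta>_def del: of_nat_Suc)
qed

lemma hasse_eq_0:
  assumes f: "f \<in> carrier R" and "D 1 f = \<zero>" and "0 < n" "n < CHAR('a)"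
  shows "D n f = \<zero>"
  using assms(3,4)
proof (induction n)
  case (Suc n)
  have "D 1 (D n f) = \<zero>"
    using Suc assms(2) f D_zero[of 1] by (cases "n = 0") (simp_all add: D_0)
  hence "c (of_nat (Suc n)) \<otimes> D (Suc n) f = \<zero>"
    using hasse_iterate[OF f] by simp
  moreover have "c (of_nat (Suc n)) \<noteq> \<zero>"
    using Suc.prems by (auto simp: c_eq_0_iff of_nat_eq_0_iff_char_dvd simp del: of_nat_Suc dest: dvd_imp_le)
  ultimately show ?case
    using f integral_iff by auto
qed simp

lemma hasse_mult_const:
  assumes f: "f \<in> carrier R" and g: "g \<in> carrier R" and "D 1 f = \<zero>" "n < CHAR('a)"
  shows "D n (f \<otimes> g) = f \<otimes> D n g"
proof -
  have "D n (f \<otimes> g) = (\<Oplus>i\<in>{..n}. D i f \<otimes> D (n - i) g)"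
    using f g by (rule D_mult)
  also have "\<dots> = (\<Oplus>i\<in>{..n}. if 0 = i then f \<otimes> D n g else \<zero>)"
    using f g assms(3,4) hasse_eq_0[OF f] by (intro finsum_cong') (auto simp: D_0)
  also have "\<dots> = f \<otimes> D n g"
    using f g by (intro finsum_singleton) auto
  finally show ?thesis .
qed

end

end

section \<open>Partial derivatives of forms\<close>

lemma pderiv_superset:
  assumes "finite S" "keys G \<subseteq> S"
  shows "mp_pderiv i G = (\<Sum>m\<in>S. single (m - single i 1)
    (of_nat (lookup m i) * lookup G m))"
  unfolding mp_pderiv_def using assms by (intro sum.mono_neutral_left) (auto simp: in_keys_iff)

lemma pderiv_0 [simp]: "mp_pderiv i 0 = 0"
  by (simp add: mp_pderiv_def)

lemma pderiv_single: "mp_pderiv i (single m c) =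
    single (m - single i 1) (of_nat (lookup m i) * c)"
  by (subst pderiv_superset[of "{m}"]) (auto simp: keys_single)

lemma pderiv_add: "mp_pderiv i (A + B) = mp_pderiv i A + mp_pderiv i B"
proof -
  let ?S = "keys A \<union> keys B"
  have "keys (A + B) \<subseteq> ?S"
    by (rule keys_add)
  thus ?thesis
    by (simp add: pderiv_superset[of ?S] lookup_add distrib_left single_add sum.distrib)
qed

lemma var_mult_pderiv_single:
  fixes c :: "'c::comm_ring_1"
  shows "mp_var i * mp_pderiv i (single m c) =
    single m (of_nat (lookup m i) * c)"
proof (cases "lookup m i = 0")
  case False
  hence "single i 1 + (m - single i 1) = m"
    by (intro poly_mapping_eqI) (auto simp: lookup_add lookup_minus lookup_single when_def)
  thus ?thesis
    by (simp add: pderiv_single mp_var_def mult_single)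
qed (simp add: pderiv_single)

lemma pderiv_form:
  fixes G :: "'c::comm_ring_1 mpoly"
  assumes "G \<in> forms_in S d" shows "mp_pderiv i G \<in> forms_in S (d - 1)"
  using assms
proof (induction rule: forms_in_induct)
  case (single m c)
  show ?case
  proof (cases "lookup m i = 0")
    case False
    let ?m = "m - single i 1"
    have m: "single i 1 + ?m = m"
      using False by (intro poly_mapping_eqI) (auto simp: lookup_add lookup_minus lookup_single when_def)
    have "keys ?m \<subseteq> keys m"
      by (auto simp: in_keys_iff lookup_minus)
    moreover have "mdeg ?m = d - 1"
      using arg_cong[OF m, of mdeg] single by simp
    ultimately show ?thesis
      using single unfolding pderiv_single by (intro forms_in_single) auto
  qed (simp add: pderiv_single)
qed (auto simp: pderiv_add intro: forms_in_add)

lemma single_sum: "single m (sum f A) = (\<Sum>x\<in>A. single m (f x))"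
  by (induction A rule: infinite_finite_induct) (auto simp: single_add)

lemma euler_formula:
  fixes G :: "'c::comm_ring_1 mpoly"
  assumes "G \<in> forms_in {..n} d"
  shows "(\<Sum>i\<le>n. mp_pderiv i G * mp_var i) = of_nat d * G"
  using assms
proof (induction rule: forms_in_induct)
  case (single m c)
  have "d = (\<Sum>i\<le>n. lookup m i)"
    using single unfolding mdeg_def[of m, symmetric]
    by (subst single(2)[symmetric], unfold mdeg_def, intro sum.mono_neutral_left) (auto simp: in_keys_iff)
  hence "of_nat d * single m c =
      (\<Sum>i\<le>n. single m (of_nat (lookup m i) * c))"
    by (simp add: sum_distrib_right of_nat_single mult_single) (rule single_sum)
  also have "\<dots> = (\<Sum>i\<le>n. mp_pderiv i (single m c) * mp_var i)"
    by (simp only: var_mult_pderiv_single[symmetric] mult.commute[of "mp_var _"])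
  finally show ?case ..
next
  case (add A B)
  thus ?case
    by (simp add: pderiv_add distrib_right sum.distrib distrib_left)
qed simp

section \<open>The function field\<close>

locale proj_variety =
  fixes n :: nat and V :: "'a::field alg_closure point set"
  assumes irred: "irreducible_closed n V"
begin

abbreviation van where "van \<equiv> vanishes_on V"
abbreviation rf where "rf \<equiv> ratfun n V"
abbreviation Fr where "Fr \<equiv> fractions n V"
abbreviation K where "K \<equiv> function_field n V"

lemma van_0: "van 0"
  by (simp add: vanishes_on_def)

lemma van_add: "van A \<Longrightarrow> van B \<Longrightarrow> van (A + B)"
  by (simp add: vanishes_on_def)

lemma van_mult: "van A \<Longrightarrow> van (C * A)"
  by (simp add: vanishes_on_def type_ring_hom.h_mult[OF type_ring_hom_base_change])

lemma van_uminus: "van A \<Longrightarrow> van (- A)"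
  using van_mult[of A "-1"] by simp

lemma point_nonempty: "P \<in> V \<Longrightarrow> \<exists>v. v \<in> P"
proof -
  assume "P \<in> V"
  moreover obtain T where "V = zero_locus n T"
    using irred by (auto simp: irreducible_closed_def zariski_closed_def)
  ultimately have "P \<in> proj_space n"
    using zero_locus_subset by blast
  then obtain v where "P = proj_pt v"
    by (rule proj_spaceE)
  thus ?thesis
    using self_in_proj_pt by blast
qed

lemma not_van_1: "\<not> van 1"
proof -
  obtain P where "P \<in> V"
    using irred by (auto simp: irreducible_closed_def)
  moreover from this obtain v where "v \<in> P"
    using point_nonempty by blast
  ultimately show ?thesis
    by (auto simp: vanishes_on_def type_ring_hom.h_1[OF type_ring_hom_base_change])
qed

lemma van_prime:
  assumes "A \<in> forms_in {..n} a" "B \<in> forms_in {..n} b" "van (A * B)"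
  shows "van A \<or> van B"
  using irreducible_closed_prime[OF irred, of "base_change A" a "base_change B" b] assms
  by (simp add: vanishes_on_iff type_ring_hom.h_mult[OF type_ring_hom_base_change])

lemma Fr_iff: "(A, B) \<in> Fr \<longleftrightarrow> (\<exists>d. A \<in> forms_in {..n} d \<and> B \<in> forms_in {..n} d) \<and> \<not> van B"
  by (simp add: fractions_def forms_eq_forms_in)

lemma FrI: "A \<in> forms_in {..n} d \<Longrightarrow> B \<in> forms_in {..n} d \<Longrightarrow> \<not> van B \<Longrightarrow> (A, B) \<in> Fr"
  by (auto simp: Fr_iff)

lemma Fr_mult:
  assumes "(A, B) \<in> Fr" "(C, D) \<in> Fr" shows "(A * C, B * D) \<in> Fr"
proof -
  obtain d e where "A \<in> forms_in {..n} d" "B \<in> forms_in {..n} d"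
    "C \<in> forms_in {..n} e" "D \<in> forms_in {..n} e" "\<not> van B" "\<not> van D"
    using assms by (auto simp: Fr_iff)
  thus ?thesis
    using van_prime[of B d D e] by (auto intro!: FrI[of _ "d + e"] forms_in_mult)
qed

lemma Fr_add:
  assumes "(A, B) \<in> Fr" "(C, D) \<in> Fr" shows "(A * D + C * B, B * D) \<in> Fr"
proof -
  obtain d e where f: "A \<in> forms_in {..n} d" "B \<in> forms_in {..n} d"
    "C \<in> forms_in {..n} e" "D \<in> forms_in {..n} e" "\<not> van B" "\<not> van D"
    using assms by (auto simp: Fr_iff)
  have "C * B \<in> forms_in {..n} (d + e)"
    using forms_in_mult[OF f(3,2)] by (simp add: add.commute)
  thus ?thesis
    using f van_prime[of B d D e] by (auto intro!: FrI[of _ "d + e"] forms_in_mult forms_in_add)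
qed

lemma Fr_1: "(1, 1) \<in> Fr" and Fr_0: "(0, 1) \<in> Fr"
  using not_van_1 by (auto intro: FrI[of _ 0] forms_in_1)

lemma rf_self: "(A, B) \<in> Fr \<Longrightarrow> (A, B) \<in> rf A B"
  by (simp add: ratfun_def van_0)

lemma rf_memD: "(C, D) \<in> rf A B \<Longrightarrow> (C, D) \<in> Fr \<and> van (A * D - C * B)"
  by (simp add: ratfun_def)

text \<open>
  Multiplied by \<open>D\<close>, the difference becomes a combination of the two given ones; by primeness \<open>D\<close> can be
  cancelled.
\<close>

lemma van_trans:
  assumes "(A, B) \<in> Fr" "(C, D) \<in> Fr" "(E, F) \<in> Fr" "van (A * D - C * B)" "van (C * F - E * D)"
  shows "van (A * F - E * B)"
proof -
  obtain d e f where forms: "A \<in> forms_in {..n} d" "B \<in> forms_in {..n} d"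
    "C \<in> forms_in {..n} e" "D \<in> forms_in {..n} e" "\<not> van D"
    "E \<in> forms_in {..n} f" "F \<in> forms_in {..n} f"
    using assms(1-3) by (auto simp: Fr_iff)
  have "D * (A * F - E * B) = F * (A * D - C * B) + B * (C * F - E * D)"
    by (simp add: algebra_simps)
  hence "van (D * (A * F - E * B))"
    using van_add[OF van_mult van_mult, OF assms(4,5)] by simp
  moreover have "E * B \<in> forms_in {..n} (d + f)"
    using forms_in_mult[OF forms(6,2)] by (simp add: add.commute)
  hence "A * F - E * B \<in> forms_in {..n} (d + f)"
    by (rule forms_in_diff[OF forms_in_mult[OF forms(1,7)]])
  ultimately show ?thesis
    using van_prime[OF forms(4)] forms(5) by blast
qed

lemma van_sym: "van (A * D - C * B) \<Longrightarrow> van (C * B - A * D)"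
  using van_uminus[of "A * D - C * B"] by simp

lemma rf_eq_iff:
  assumes "(A, B) \<in> Fr" "(C, D) \<in> Fr"
  shows "rf A B = rf C D \<longleftrightarrow> van (A * D - C * B)"
proof
  assume "rf A B = rf C D"
  hence "(C, D) \<in> rf A B"
    using rf_self[OF assms(2)] by simp
  thus "van (A * D - C * B)"
    by (simp add: rf_memD)
next
  assume v: "van (A * D - C * B)"
  show "rf A B = rf C D"
  proof (rule equalityI; rule subrelI)
    fix E F assume "(E, F) \<in> rf A B"
    hence "(E, F) \<in> Fr" "van (A * F - E * B)"
      by (auto dest: rf_memD)
    thus "(E, F) \<in> rf C D"
      using van_trans[OF assms(2,1) _ van_sym[OF v]] by (auto simp: ratfun_def)
  next
    fix E F assume "(E, F) \<in> rf C D"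
    hence "(E, F) \<in> Fr" "van (C * F - E * D)"
      by (auto dest: rf_memD)
    thus "(E, F) \<in> rf A B"
      using van_trans[OF assms(1,2) _ v] by (auto simp: ratfun_def)
  qed
qed

lemma rf_memE:
  assumes "(A, B) \<in> Fr" "(A', B') \<in> rf A B"
  shows "(A', B') \<in> Fr" "rf A' B' = rf A B"
  using assms rf_memD[OF assms(2)] rf_eq_iff[OF assms(1), of A' B'] by auto

lemma rf_mult_cong:
  assumes Fr: "(A, B) \<in> Fr" "(C, D) \<in> Fr" "(A', B') \<in> Fr" "(C', D') \<in> Fr"
    and "rf A' B' = rf A B" "rf C' D' = rf C D"
  shows "rf (A' * C') (B' * D') = rf (A * C) (B * D)"
proof -
  have v: "van (A' * B - A * B')" "van (C' * D - C * D')"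
    using assms rf_eq_iff by auto
  have "A' * C' * (B * D) - A * C * (B' * D') = C' * D * (A' * B - A * B') + A * B' * (C' * D - C * D')"
    by (simp add: algebra_simps)
  hence "van (A' * C' * (B * D) - A * C * (B' * D'))"
    using v van_add van_mult by metis
  thus ?thesis
    using rf_eq_iff[OF Fr_mult[OF Fr(3,4)] Fr_mult[OF Fr(1,2)]] by simp
qed

lemma rf_add_cong:
  assumes Fr: "(A, B) \<in> Fr" "(C, D) \<in> Fr" "(A', B') \<in> Fr" "(C', D') \<in> Fr"
    and "rf A' B' = rf A B" "rf C' D' = rf C D"
  shows "rf (A' * D' + C' * B') (B' * D') = rf (A * D + C * B) (B * D)"
proof -
  have v: "van (A' * B - A * B')" "van (C' * D - C * D')"
    using assms rf_eq_iff by auto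
  have "(A' * D' + C' * B') * (B * D) - (A * D + C * B) * (B' * D') =
      D * D' * (A' * B - A * B') + B * B' * (C' * D - C * D')"
    by (simp add: algebra_simps)
  hence "van ((A' * D' + C' * B') * (B * D) - (A * D + C * B) * (B' * D'))"
    using v van_add van_mult by metis
  thus ?thesis
    using rf_eq_iff[OF Fr_add[OF Fr(3,4)] Fr_add[OF Fr(1,2)]] by simp
qed

lemma UN_pair_eq:
  assumes "x \<in> S" "y \<in> T" "\<And>A B C D. (A, B) \<in> S \<Longrightarrow> (C, D) \<in> T \<Longrightarrow> h A B C D = r"
  shows "(\<Union>(A, B)\<in>S. \<Union>(C, D)\<in>T. h A B C D) = r"
proof -
  have "h (fst p) (snd p) (fst q) (snd q) = r" if "p \<in> S" "q \<in> T" for p q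
    using assms(3)[of "fst p" "snd p" "fst q" "snd q"] that by simp
  hence "(\<Union>(A, B)\<in>S. \<Union>(C, D)\<in>T. h A B C D) = (\<Union>p\<in>S. \<Union>q\<in>T. r)"
    unfolding case_prod_beta by (intro SUP_cong refl) simp
  also have "\<dots> = r"
    using assms(1,2) by blast
  finally show ?thesis .
qed

lemma K_mult:
  assumes Fr: "(A, B) \<in> Fr" "(C, D) \<in> Fr"
  shows "rf A B \<otimes>\<^bsub>K\<^esub> rf C D = rf (A * C) (B * D)"
proof -
  have "(\<Union>(A', B')\<in>rf A B. \<Union>(C', D')\<in>rf C D. rf (A' * C') (B' * D')) = rf (A * C) (B * D)"
  proof (rule UN_pair_eq[OF rf_self[OF Fr(1)] rf_self[OF Fr(2)]])
    fix A' B' C' D' assume "(A', B') \<in> rf A B" "(C', D') \<in> rf C D"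
    note * = rf_memE[OF Fr(1) this(1)] rf_memE[OF Fr(2) this(2)]
    show "rf (A' * C') (B' * D') = rf (A * C) (B * D)"
      by (rule rf_mult_cong[OF Fr *(1,3,2,4)])
  qed
  thus ?thesis
    by (simp add: function_field_def)
qed

lemma K_add:
  assumes Fr: "(A, B) \<in> Fr" "(C, D) \<in> Fr"
  shows "rf A B \<oplus>\<^bsub>K\<^esub> rf C D = rf (A * D + C * B) (B * D)"
proof -
  have "(\<Union>(A', B')\<in>rf A B. \<Union>(C', D')\<in>rf C D. rf (A' * D' + C' * B') (B' * D')) = rf (A * D + C * B) (B * D)"
  proof (rule UN_pair_eq[OF rf_self[OF Fr(1)] rf_self[OF Fr(2)]])
    fix A' B' C' D' assume "(A', B') \<in> rf A B" "(C', D') \<in> rf C D"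
    note * = rf_memE[OF Fr(1) this(1)] rf_memE[OF Fr(2) this(2)]
    show "rf (A' * D' + C' * B') (B' * D') = rf (A * D + C * B) (B * D)"
      by (rule rf_add_cong[OF Fr *(1,3,2,4)])
  qed
  thus ?thesis
    by (simp add: function_field_def)
qed

lemma K_one: "\<one>\<^bsub>K\<^esub> = rf 1 1" and K_zero: "\<zero>\<^bsub>K\<^esub> = rf 0 1"
  by (simp_all add: function_field_def)

lemma K_carrier: "x \<in> carrier K \<longleftrightarrow> (\<exists>A B. (A, B) \<in> Fr \<and> x = rf A B)"
  by (auto simp: function_field_def)

lemma K_closed: "(A, B) \<in> Fr \<Longrightarrow> rf A B \<in> carrier K"
  by (auto simp: K_carrier)

lemma K_E:
  assumes "x \<in> carrier K" obtains A B where "(A, B) \<in> Fr" "x = rf A B"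
  using assms by (auto simp: K_carrier)

lemma rf_eqI: "(A, B) \<in> Fr \<Longrightarrow> (C, D) \<in> Fr \<Longrightarrow> A * D = C * B \<Longrightarrow> rf A B = rf C D"
  by (simp add: rf_eq_iff van_0)

lemma rf_eq_0_iff: "(A, B) \<in> Fr \<Longrightarrow> rf A B = \<zero>\<^bsub>K\<^esub> \<longleftrightarrow> van A"
  using rf_eq_iff[OF _ Fr_0, of A B] by (simp add: K_zero)

lemma field_K: "field K"
proof -
  have "abelian_group K"
  proof (rule abelian_groupI)
    fix x y assume "x \<in> carrier K" "y \<in> carrier K"
    then obtain A B C D where xy: "(A, B) \<in> Fr" "x = rf A B" "(C, D) \<in> Fr" "y = rf C D"
      by (metis K_E)
    show "x \<oplus>\<^bsub>K\<^esub> y \<in> carrier K"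
      using xy by (simp add: K_add K_closed Fr_add)
    show "x \<oplus>\<^bsub>K\<^esub> y = y \<oplus>\<^bsub>K\<^esub> x"
      using xy by (simp add: K_add) (intro rf_eqI Fr_add; simp add: algebra_simps)
    fix z assume "z \<in> carrier K"
    then obtain E F where z: "(E, F) \<in> Fr" "z = rf E F"
      by (metis K_E)
    show "x \<oplus>\<^bsub>K\<^esub> y \<oplus>\<^bsub>K\<^esub> z = x \<oplus>\<^bsub>K\<^esub> (y \<oplus>\<^bsub>K\<^esub> z)"
      using xy z by (simp add: K_add Fr_add) (intro rf_eqI Fr_add; simp add: algebra_simps)
  next
    show "\<zero>\<^bsub>K\<^esub> \<in> carrier K"
      using Fr_0 by (simp add: K_zero K_closed)
    fix x assume "x \<in> carrier K"
    then obtain A B where x: "(A, B) \<in> Fr" "x = rf A B"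
      by (rule K_E)
    show "\<zero>\<^bsub>K\<^esub> \<oplus>\<^bsub>K\<^esub> x = x"
      using x by (simp add: K_zero K_add Fr_0)
    have neg: "(- A, B) \<in> Fr"
      using x(1) by (auto simp: Fr_iff intro: forms_in_uminus)
    show "\<exists>y\<in>carrier K. y \<oplus>\<^bsub>K\<^esub> x = \<zero>\<^bsub>K\<^esub>"
    proof (rule bexI[of _ "rf (- A) B"])
      show "rf (- A) B \<oplus>\<^bsub>K\<^esub> x = \<zero>\<^bsub>K\<^esub>"
        unfolding x(2) K_add[OF neg x(1)] rf_eq_0_iff[OF Fr_add[OF neg x(1)]] by (simp add: van_0)
    qed (use neg K_closed in blast)
  qed
  moreover have "comm_monoid K"
  proof (rule comm_monoidI)
    show "\<one>\<^bsub>K\<^esub> \<in> carrier K"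
      using Fr_1 by (simp add: K_one K_closed)
    fix x y assume "x \<in> carrier K" "y \<in> carrier K"
    then obtain A B C D where xy: "(A, B) \<in> Fr" "x = rf A B" "(C, D) \<in> Fr" "y = rf C D"
      by (metis K_E)
    show "x \<otimes>\<^bsub>K\<^esub> y \<in> carrier K"
      using xy by (simp add: K_mult K_closed Fr_mult)
    show "x \<otimes>\<^bsub>K\<^esub> y = y \<otimes>\<^bsub>K\<^esub> x"
      using xy by (simp add: K_mult mult.commute)
    show "\<one>\<^bsub>K\<^esub> \<otimes>\<^bsub>K\<^esub> x = x"
      using xy by (simp add: K_one K_mult Fr_1)
    fix z assume "z \<in> carrier K"
    then obtain E F where z: "(E, F) \<in> Fr" "z = rf E F"
      by (metis K_E)
    show "x \<otimes>\<^bsub>K\<^esub> y \<otimes>\<^bsub>K\<^esub> z = x \<otimes>\<^bsub>K\<^esub> (y \<otimes>\<^bsub>K\<^esub> z)"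
      using xy z by (simp add: K_mult Fr_mult mult.assoc)
  qed
  moreover have "(x \<oplus>\<^bsub>K\<^esub> y) \<otimes>\<^bsub>K\<^esub> z = x \<otimes>\<^bsub>K\<^esub> z \<oplus>\<^bsub>K\<^esub> y \<otimes>\<^bsub>K\<^esub> z"
    if "x \<in> carrier K" "y \<in> carrier K" "z \<in> carrier K" for x y z
  proof -
    obtain A B C D E F where xyz: "(A, B) \<in> Fr" "x = rf A B" "(C, D) \<in> Fr" "y = rf C D"
      "(E, F) \<in> Fr" "z = rf E F"
      using \<open>x \<in> _\<close> \<open>y \<in> _\<close> \<open>z \<in> _\<close> by (metis K_E)
    show ?thesis
      using xyz by (simp add: K_mult K_add Fr_mult Fr_add)
        (intro rf_eqI Fr_add Fr_mult; simp add: algebra_simps)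
  qed
  ultimately interpret cring K
    by (rule cringI)
  show ?thesis
  proof (rule cring_fieldI2)
    show "\<zero>\<^bsub>K\<^esub> \<noteq> \<one>\<^bsub>K\<^esub>"
      using rf_eq_0_iff[OF Fr_1] not_van_1 by (auto simp: K_one)
    fix x assume "x \<in> carrier K" "x \<noteq> \<zero>\<^bsub>K\<^esub>"
    then obtain A B where x: "(A, B) \<in> Fr" "x = rf A B" "\<not> van A"
      by (metis K_E rf_eq_0_iff)
    have inv: "(B, A) \<in> Fr"
      using x by (auto simp: Fr_iff)
    moreover have "x \<otimes>\<^bsub>K\<^esub> rf B A = \<one>\<^bsub>K\<^esub>"
      using x inv by (simp add: K_one K_mult) (intro rf_eqI Fr_mult Fr_1; simp add: mult.commute)
    ultimately show "\<exists>y\<in>carrier K. x \<otimes>\<^bsub>K\<^esub> y = \<one>\<^bsub>K\<^esub>"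
      using K_closed by blast
  qed
qed

definition cst :: "'a \<Rightarrow> 'a ratfun" where "cst a = rf (mp_const a) 1"

lemma Fr_const: "(mp_const a, 1) \<in> Fr"
  using not_van_1 by (intro FrI[of _ 0] forms_in_const forms_in_1)

lemma range_cst: "range cst = constants n V"
  by (auto simp: cst_def constants_def)

sublocale K: field K
  by (rule field_K)

lemma type_into_K: "type_into_field K cst"
proof
  show "cst a \<in> carrier K" for a
    using Fr_const by (simp add: cst_def K_closed)
  show "cst 1 = \<one>\<^bsub>K\<^esub>"
    by (simp add: cst_def K_one)
  show "cst (a + b) = cst a \<oplus>\<^bsub>K\<^esub> cst b" for a b
    by (simp add: cst_def K_add Fr_const mp_const_add)
  show "cst (a * b) = cst a \<otimes>\<^bsub>K\<^esub> cst b" for a b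
    by (simp add: cst_def K_mult Fr_const mp_const_mult)
qed

lemma K_finsum:
  assumes "finite J" "B \<in> forms_in {..n} d" "\<not> van B" "\<And>j. j \<in> J \<Longrightarrow> N j \<in> forms_in {..n} d"
  shows "finsum K (\<lambda>j. rf (N j) B) J = rf (\<Sum>j\<in>J. N j) B"
  using assms(1,4)
proof (induction J rule: finite_induct)
  case empty
  have "(0, B) \<in> Fr"
    using assms by (intro FrI[of _ d]) auto
  thus ?case
    using rf_eq_0_iff[of 0 B] by (simp add: van_0)
next
  case (insert j J)
  have Fr: "(N i, B) \<in> Fr" if "i \<in> insert j J" for i
    using assms insert that by (intro FrI[of _ d]) auto
  have Fr_sum: "(\<Sum>j\<in>S. N j, B) \<in> Fr" if "S \<subseteq> insert j J" for S
    using assms insert that by (intro FrI[of _ d] forms_in_sum) auto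
  have "finsum K (\<lambda>j. rf (N j) B) (insert j J) = rf (N j) B \<oplus>\<^bsub>K\<^esub> finsum K (\<lambda>j. rf (N j) B) J"
    using insert Fr K_closed by (intro K.finsum_insert) auto
  also have "\<dots> = rf (N j * B + (\<Sum>j\<in>J. N j) * B) (B * B)"
    using insert Fr Fr_sum by (simp add: K_add subset_insertI)
  also have "\<dots> = rf (N j + (\<Sum>j\<in>J. N j)) B"
    using Fr_add[OF Fr Fr_sum, of j J] Fr_sum[of "insert j J"] insert
    by (intro rf_eqI) (auto simp: algebra_simps subset_insertI)
  finally show ?case
    using insert by simp
qed

lemma K_power: "(A, B) \<in> Fr \<Longrightarrow> rf A B [^]\<^bsub>K\<^esub> (m::nat) = rf (A ^ m) (B ^ m) \<and> (A ^ m, B ^ m) \<in> Fr"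
  by (induction m) (auto simp: K_one Fr_1 K_mult Fr_mult mult.commute)

end

section \<open>Frobenius nonclassicality of the curve\<close>

text \<open>
  The hypothesis concerns the regular points only. At a singular point every partial derivative
  vanishes, and with it every summand.
\<close>

lemma frobenius_nonclassical_vanishing:
  fixes F :: "'a::finite_field mpoly"
  assumes nonclassical: "frobenius_nonclassical_hypersurface n F" and V: "V \<subseteq> hypersurface n F"
  shows "vanishes_on V (\<Sum>i\<le>n. mp_pderiv i F * mp_var i ^ CARD('a))"
  unfolding vanishes_on_def
proof (intro ballI)
  fix P v assume P: "P \<in> V" "v \<in> P"
  have "mp_eval v (base_change (\<Sum>i\<le>n. mp_pderiv i F * mp_var i ^ CARD('a))) =
      (\<Sum>i\<le>n. mp_eval v (base_change (mp_pderiv i F)) * v i ^ CARD('a))"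
    by (simp add: type_ring_hom.h_sum[OF type_ring_hom_base_change]
        type_ring_hom.h_mult[OF type_ring_hom_base_change] type_ring_hom.h_power[OF type_ring_hom_base_change]
        type_ring_hom.subst_sum[OF type_ring_hom_id])
  also have "\<dots> = 0"
  proof (cases "P \<in> sing_locus n F")
    case True
    thus ?thesis
      using P by (intro sum.neutral) (auto simp: sing_locus_def)
  next
    case False
    hence "frobenius_map CARD('a) P \<in> tangent_hyperplane n F P"
      using nonclassical V P by (auto simp: frobenius_nonclassical_hypersurface_def reg_locus_def)
    hence *: "\<forall>v\<in>P. \<forall>w\<in>frobenius_map CARD('a) P.
        (\<Sum>i\<le>n. mp_eval v (base_change (mp_pderiv i F)) * w i) = 0"
      by (simp add: tangent_hyperplane_def)
    have "(\<lambda>i. v i ^ CARD('a)) \<in> frobenius_map CARD('a) P"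
      using P(2) self_in_proj_pt unfolding frobenius_map_def by blast
    from bspec[OF bspec[OF * P(2)] this] show ?thesis .
  qed
  finally show "mp_eval v (base_change (\<Sum>i\<le>n. mp_pderiv i F * mp_var i ^ CARD('a))) = 0" .
qed

text \<open>
  The part of the situation that the determinant depends on. As the ambient dimension is at least two,
  the characteristic is odd, and determinants with two equal columns vanish because they are their own
  negatives.
\<close>

locale curve_on_nonclassical_hypersurface = proj_variety n V
  for n :: nat and V :: "'a::finite_field alg_closure point set" +
  fixes F :: "'a mpoly" and d :: nat
  assumes F: "F \<in> forms n d"
    and V_F: "V \<subseteq> hypersurface n F"
    and nonclassical: "frobenius_nonclassical_hypersurface n F"
    and not_sing: "\<not> V \<subseteq> sing_locus n F"
    and nondeg: "nondegenerate n V"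
    and insep: "gauss_map_inseparable_on n F V"
    and char: "CHAR('a) > n" "n \<ge> 2"
begin

sublocale K: finite_type_into_field K cst
  by (intro finite_type_into_field.intro type_into_K)

lemma F_form: "F \<in> forms_in {..n} d"
  using F by (simp add: forms_eq_forms_in)

lemma pderiv_F_form: "mp_pderiv i F \<in> forms_in {..n} (d - 1)"
  using F_form by (rule pderiv_form)

lemma van_F: "van F"
  using V_F by (auto simp: vanishes_on_def hypersurface_def zero_locus_def)

lemma not_van_X0: "\<not> van (mp_var 0)"
proof
  assume van: "van (mp_var 0)"
  define a :: "nat \<Rightarrow> 'a alg_closure" where "a = (\<lambda>i. if i = 0 then 1 else 0)"
  have "a \<in> coord_vecs n"
    by (auto simp: a_def coord_vecs_def fun_eq_iff)
  moreover have "(\<Sum>i\<le>n. a i * v i) = 0" if "P \<in> V" "v \<in> P" for P v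
  proof -
    have "v 0 = 0"
      using van that by (auto simp: vanishes_on_def)
    hence "a i * v i = 0" for i
      by (simp add: a_def)
    thus ?thesis
      by (intro sum.neutral) blast
  qed
  ultimately show False
    using nondeg unfolding nondegenerate_def by blast
qed

definition k where "k = (SOME k. k \<le> n \<and> \<not> van (mp_pderiv k F))"

lemma k: "k \<le> n" "\<not> van (mp_pderiv k F)"
proof -
  obtain P where "P \<in> V" "P \<notin> sing_locus n F"
    using not_sing by blast
  moreover from this have "P \<in> hypersurface n F"
    using V_F by blast
  ultimately have "\<exists>k. k \<le> n \<and> \<not> van (mp_pderiv k F)"
    unfolding sing_locus_def vanishes_on_def by blast
  from someI_ex[OF this] show "k \<le> n" "\<not> van (mp_pderiv k F)"
    by (auto simp: k_def)
qed

text \<open>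
  Dividing by the fixed nonvanishing partial derivative makes the homogeneous coordinates of the Gauss map
  elements of the function field; the \<open>k\<close>-th one is \<open>1\<close>.
\<close>

definition gauss_coord where "gauss_coord j = rf (mp_pderiv j F) (mp_pderiv k F)"

lemma Fr_gauss: "(mp_pderiv j F, mp_pderiv k F) \<in> Fr"
  using pderiv_F_form k(2) by (intro FrI)

lemma Fr_coord: "j \<le> n \<Longrightarrow> (mp_var j, mp_var 0) \<in> Fr"
  using not_van_X0 by (intro FrI[of _ 1] forms_in_var) auto

lemma gauss_coord_closed: "gauss_coord j \<in> carrier K"
  using Fr_gauss by (simp add: gauss_coord_def K_closed)

lemma coord_fun_closed: "j \<le> n \<Longrightarrow> coord_fun n V j \<in> carrier K"
  using Fr_coord by (simp add: coord_fun_def K_closed)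

lemma gauss_coord_k: "gauss_coord k \<noteq> \<zero>\<^bsub>K\<^esub>"
  using rf_eq_0_iff[OF Fr_gauss] k(2) by (simp add: gauss_coord_def)

text \<open>
  The cases \<open>m = 1\<close> and \<open>m = q\<close> are needed: orthogonality of the tangent hyperplane to the point and to
  its Frobenius image.
\<close>

lemma weighted_sum_eq_0:
  assumes van: "van (\<Sum>j\<le>n. mp_pderiv j F * mp_var j ^ m)"
  shows "finsum K (\<lambda>j. gauss_coord j \<otimes>\<^bsub>K\<^esub> coord_fun n V j [^]\<^bsub>K\<^esub> m) {..<Suc n} = \<zero>\<^bsub>K\<^esub>"
proof -
  let ?B = "mp_pderiv k F * mp_var 0 ^ m"
  have forms: "mp_pderiv j F * mp_var j ^ m \<in> forms_in {..n} (d - 1 + m * 1)" if "j \<le> n" for j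
    using that by (intro forms_in_mult pderiv_F_form forms_in_power forms_in_var) auto
  have B: "?B \<in> forms_in {..n} (d - 1 + m * 1)"
    by (intro forms_in_mult pderiv_F_form forms_in_power forms_in_var) auto
  have summand: "gauss_coord j \<otimes>\<^bsub>K\<^esub> coord_fun n V j [^]\<^bsub>K\<^esub> m = rf (mp_pderiv j F * mp_var j ^ m) ?B"
    if "j \<le> n" for j
    using K_power[OF Fr_coord[OF that], of m] Fr_gauss
    by (simp add: gauss_coord_def coord_fun_def K_mult)
  have nB: "\<not> van ?B"
    using Fr_mult[OF Fr_gauss, of "mp_var 0 ^ m" "mp_var 0 ^ m"] K_power[OF Fr_coord[of 0], of m]
    by (auto simp: Fr_iff)
  have "finsum K (\<lambda>j. gauss_coord j \<otimes>\<^bsub>K\<^esub> coord_fun n V j [^]\<^bsub>K\<^esub> m) {..<Suc n} =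
      finsum K (\<lambda>j. rf (mp_pderiv j F * mp_var j ^ m) ?B) {..<Suc n}"
    using summand FrI[OF forms B nB] K_closed by (intro K.finsum_cong') auto
  also have "\<dots> = rf (\<Sum>j<Suc n. mp_pderiv j F * mp_var j ^ m) ?B"
    using forms B nB by (intro K_finsum[of _ _ "d - 1 + m * 1"]) auto
  also have "\<dots> = \<zero>\<^bsub>K\<^esub>"
    using van forms B nB
    by (subst rf_eq_0_iff) (auto intro!: FrI[of _ "d - 1 + m * 1"] forms_in_sum simp: lessThan_Suc_atMost)
  finally show ?thesis .
qed

lemma gauss_image_closed: "gauss_image_field n F V \<subseteq> carrier K"
proof
  fix x assume "x \<in> gauss_image_field n F V"
  then obtain A B e where AB: "A \<in> forms_in {..n} e" "B \<in> forms_in {..n} e"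
    "\<not> van (mp_subst mp_const (\<lambda>i. mp_pderiv i F) B)"
    "x = rf (mp_subst mp_const (\<lambda>i. mp_pderiv i F) A) (mp_subst mp_const (\<lambda>i. mp_pderiv i F) B)"
    by (auto simp: gauss_image_field_def Let_def forms_eq_forms_in)
  have "mp_subst mp_const (\<lambda>i. mp_pderiv i F) H \<in> forms_in {..n} (e * (d - 1))"
    if "H \<in> forms_in {..n} e" for H
    using that pderiv_F_form by (rule forms_in_subst)
  from FrI[OF this[OF AB(1)] this[OF AB(2)] AB(3)] show "x \<in> carrier K"
    unfolding AB(4) by (rule K_closed)
qed

lemma gauss_coord_in_image: "j \<le> n \<Longrightarrow> gauss_coord j \<in> gauss_image_field n F V"
  unfolding gauss_image_field_def Let_def gauss_coord_def forms_eq_forms_in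
  by (intro CollectI exI[of _ "mp_var j"] exI[of _ "mp_var k"])
    (use k forms_in_var[of j "{..n}"] forms_in_var[of k "{..n}"] in
      \<open>auto simp: type_ring_hom.subst_var[OF type_ring_hom_const]\<close>)

lemma cst_in_image: "cst a \<in> gauss_image_field n F V"
  unfolding gauss_image_field_def Let_def cst_def forms_eq_forms_in
  by (intro CollectI exI[of _ "mp_const a"] exI[of _ 1])
    (use forms_in_const[of a "{..n}"] forms_in_1[of "{..n}"] not_van_1 in
      \<open>auto simp: type_ring_hom.subst_const[OF type_ring_hom_const] type_ring_hom.subst_1[OF type_ring_hom_const]\<close>)

text \<open>
  If the derivative of one of these functions did not vanish, the whole function field of the curve
  would be separable over the field generated by this function, hence over the larger function field
  of the Gauss image. The empty set is then a separating transcendence basis.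
\<close>

lemma derivative_gauss_coord:
  assumes \<zeta>: "separating n V \<zeta>" and D: "hasse_derivatives K (constants n V) \<zeta> D" and j: "j \<le> n"
  shows "D 1 (gauss_coord j) = \<zero>\<^bsub>K\<^esub>"
proof (rule ccontr)
  assume nz: "D 1 (gauss_coord j) \<noteq> \<zero>\<^bsub>K\<^esub>"
  have \<zeta>_closed: "\<zeta> \<in> carrier K"
    and sep: "\<And>f. f \<in> carrier K \<Longrightarrow> separable_element K (generate_field K (insert \<zeta> (range cst))) f"
    using \<zeta> by (auto simp: separating_def range_cst)
  have D': "hasse_derivatives K (range cst) \<zeta> D"
    using D by (simp add: range_cst)
  let ?z = "gauss_coord j" and ?L = "gauss_image_field n F V"
  have z: "?z \<in> carrier K"
    by (rule gauss_coord_closed)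
  interpret z: type_into_field K "hev K cst ?z"
    by (rule K.hev_type_into_field[OF z])
  have E: "subfield (generate_field K ?L) K"
    by (rule K.generate_field_is_subfield[OF gauss_image_closed])
  have incl: "generate_field K (insert ?z (range cst)) \<subseteq> generate_field K ?L"
    using gauss_coord_in_image[OF j] cst_in_image by (intro K.mono_generate_field gauss_image_closed) auto
  have "separable_element K (generate_field K ?L) x" if x: "x \<in> carrier K" for x
  proof -
    have "\<exists>P. P \<noteq> 0 \<and> hev K (hev K cst ?z) x P = \<zero>\<^bsub>K\<^esub>"
      using sep by (intro K.algebraic_dependence[OF \<zeta>_closed _ z x])
        (auto simp: separable_element_def over_def)
    then obtain P where "hev K (hev K cst ?z) x P = \<zero>\<^bsub>K\<^esub>"
      "hev K (hev K cst ?z) x (pderiv P) \<noteq> \<zero>\<^bsub>K\<^esub>"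
      using K.simple_root_if_derivation_nonzero[OF K.const_derivation_D_1[OF D' \<zeta>_closed sep] z x nz] by blast
    thus ?thesis
      using z.separable_elementI[OF E _ x] K.hev_in_generate_field[OF z] incl by blast
  qed
  hence "separable_extension K ?L"
    unfolding separable_extension_def by (intro exI[of _ "{}"]) (auto simp: alg_independent_def)
  thus False
    using insep by (simp add: gauss_map_inseparable_on_def)
qed

text \<open>
  The vector of Gauss coordinates is in the kernel of the matrix. For the first row this is
  nonclassicality of the hypersurface; the other rows come from Euler's formula, to which the Hasse
  derivatives are applied, Gauss coordinates behaving as constants in orders below the characteristic.
\<close>

lemma frobenius_det_eq_0:
  assumes \<zeta>: "separating n V \<zeta>" and D: "hasse_derivatives K (constants n V) \<zeta> D"
  shows "frobenius_det n V D [0..<n] = \<zero>\<^bsub>K\<^esub>"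
proof -
  have \<zeta>_closed: "\<zeta> \<in> carrier K"
    and sep: "\<And>f. f \<in> carrier K \<Longrightarrow> separable_element K (generate_field K (insert \<zeta> (range cst))) f"
    using \<zeta> by (auto simp: separating_def range_cst)
  have D': "hasse_derivatives K (range cst) \<zeta> D"
    using D by (simp add: range_cst)
  note ctx = D' \<zeta>_closed sep
  let ?y = "coord_fun n V"
  have y: "?y j \<in> carrier K" if "j < Suc n" for j
    using that by (intro coord_fun_closed) simp
  let ?A = "\<lambda>i j. case i of 0 \<Rightarrow> ?y j [^]\<^bsub>K\<^esub> CARD('a) | Suc i' \<Rightarrow> D ([0..<n] ! i') (?y j)"
  show ?thesis
    unfolding frobenius_det_def
  proof (rule K.ring_det_eq_0_if_kernel[where z = gauss_coord and k = k])
    show "k < Suc n" "gauss_coord k \<noteq> \<zero>\<^bsub>K\<^esub>"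
      using k(1) gauss_coord_k by auto
    show "gauss_coord j \<in> carrier K" for j
      by (rule gauss_coord_closed)
    show "?A i l \<in> carrier K" if "i < Suc n" "l < Suc n" for i l
      using that y K.D_closed[OF ctx] by (auto split: nat.splits)
    show "x = \<zero>\<^bsub>K\<^esub>" if x: "x \<in> carrier K" "x \<oplus>\<^bsub>K\<^esub> x = \<zero>\<^bsub>K\<^esub>" for x
    proof -
      have "cst (1 + 1) \<otimes>\<^bsub>K\<^esub> x = x \<oplus>\<^bsub>K\<^esub> x"
        unfolding K.c_add K.c_1 using x(1) by (simp add: K.l_distr)
      hence "cst (of_nat 2) \<otimes>\<^bsub>K\<^esub> x = x \<oplus>\<^bsub>K\<^esub> x"
        by simp
      moreover have "cst (of_nat 2) \<noteq> \<zero>\<^bsub>K\<^esub>"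
        using char by (auto simp: K.c_eq_0_iff of_nat_eq_0_iff_char_dvd simp del: of_nat_numeral dest: dvd_imp_le)
      ultimately show ?thesis
        using x K.integral[of "cst (of_nat 2)" x] by auto
    qed
    fix i assume i: "i < Suc n"
    show "(\<Oplus>\<^bsub>K\<^esub>j\<in>{..<Suc n}. gauss_coord j \<otimes>\<^bsub>K\<^esub> ?A i j) = \<zero>\<^bsub>K\<^esub>"
    proof (cases i)
      case 0
      thus ?thesis
        using weighted_sum_eq_0[OF frobenius_nonclassical_vanishing[OF nonclassical V_F]] by simp
    next
      case (Suc i')
      hence i': "i' < n" using i by simp
      have "van (\<Sum>j\<le>n. mp_pderiv j F * mp_var j ^ 1)"
        using van_mult[OF van_F] by (simp add: euler_formula[OF F_form])
      from weighted_sum_eq_0[OF this]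
      have sum0: "finsum K (\<lambda>j. gauss_coord j \<otimes>\<^bsub>K\<^esub> ?y j [^]\<^bsub>K\<^esub> (1::nat)) {..<Suc n} = \<zero>\<^bsub>K\<^esub>" .
      have "finsum K (\<lambda>j. gauss_coord j \<otimes>\<^bsub>K\<^esub> ?y j) {..<Suc n} =
          finsum K (\<lambda>j. gauss_coord j \<otimes>\<^bsub>K\<^esub> ?y j [^]\<^bsub>K\<^esub> (1::nat)) {..<Suc n}"
        using y gauss_coord_closed by (intro K.finsum_cong') auto
      hence sum: "finsum K (\<lambda>j. gauss_coord j \<otimes>\<^bsub>K\<^esub> ?y j) {..<Suc n} = \<zero>\<^bsub>K\<^esub>"
        using sum0 by simp
      have "(\<Oplus>\<^bsub>K\<^esub>j\<in>{..<Suc n}. gauss_coord j \<otimes>\<^bsub>K\<^esub> ?A i j) =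
          (\<Oplus>\<^bsub>K\<^esub>j\<in>{..<Suc n}. D i' (gauss_coord j \<otimes>\<^bsub>K\<^esub> ?y j))"
      proof (rule K.finsum_cong')
        fix j assume j: "j \<in> {..<Suc n}"
        hence "D i' (gauss_coord j \<otimes>\<^bsub>K\<^esub> ?y j) = gauss_coord j \<otimes>\<^bsub>K\<^esub> D i' (?y j)"
          using i' char y derivative_gauss_coord[OF \<zeta> D, of j]
          by (intro K.hasse_mult_const[OF ctx] gauss_coord_closed) auto
        thus "gauss_coord j \<otimes>\<^bsub>K\<^esub> ?A i j = D i' (gauss_coord j \<otimes>\<^bsub>K\<^esub> ?y j)"
          using i' by (simp add: Suc)
      next
        show "(\<lambda>j. D i' (gauss_coord j \<otimes>\<^bsub>K\<^esub> ?y j)) \<in> {..<Suc n} \<rightarrow> carrier K"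
          using y gauss_coord_closed K.D_closed[OF ctx] by auto
      qed simp
      also have "\<dots> = D i' (finsum K (\<lambda>j. gauss_coord j \<otimes>\<^bsub>K\<^esub> ?y j) {..<Suc n})"
        using y gauss_coord_closed by (intro K.D_finsum[OF ctx, symmetric]) auto
      also have "\<dots> = \<zero>\<^bsub>K\<^esub>"
        unfolding sum by (rule K.D_zero[OF ctx])
      finally show ?thesis .
    qed
  qed
qed

end

theorem theorem3p13:
  fixes s M d :: nat
    and F :: "'a::finite_field mpoly"
    and V :: "'a alg_closure point set"
  assumes "s > 0"
    and "M = veronese_dim s"
    and "CHAR('a) > M"
    and "F \<in> forms M d"
    and "Factorial_Ring.irreducible (base_change F)"
    and "frobenius_nonclassical_hypersurface M F"
    and "\<not> CHAR('a) dvd d"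
    and "(\<Sum>i\<le>M. mp_pderiv i F * mp_var i ^ CARD('a)) \<noteq> 0"
    and "irreducible_component M (hypersurface M F \<inter> veronese s ` proj_space 2) V"
    and "irreducible_curve M V"
    and "closed_over_Fq M V"
    and "nondegenerate M V"
    and "\<not> V \<subseteq> sing_locus M F"
    and "gauss_map_inseparable_on M F V"
  shows "(\<exists>G :: 'a mpoly. (\<exists>e. G \<in> forms 2 e) \<and> Factorial_Ring.irreducible (base_change G) \<and>
            G dvd veronese_pullback s F \<and>
            veronese_preimage s V = zero_locus 2 {base_change G}) \<and>
         (plane_degree (veronese_preimage s V) > s \<longrightarrow>
            frobenius_nonclassical_wrt_curves_of_degree s (veronese_preimage s V))"
proof -
  have V: "V \<subseteq> hypersurface M F" "V \<subseteq> veronese s ` proj_space 2"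
    using assms(9) by (auto simp: irreducible_component_def)
  interpret C: veronese_curve s M V
    using assms V by unfold_locales
  have "3 \<le> (s + 2) choose 2"
    using assms(1) by (cases s) (auto simp: numeral_eq_Suc)
  hence M: "M \<ge> 2"
    using assms(2) by (simp add: veronese_dim_def)
  interpret G: curve_on_nonclassical_hypersurface M V F d
    using assms V M C.irred by unfold_locales
  have "vanishes_on V F"
    by (rule G.van_F)
  from C.preimage_is_plane_curve[OF assms(4) this] have i:
    "\<exists>G :: 'a mpoly. (\<exists>e. G \<in> forms 2 e) \<and> Factorial_Ring.irreducible (base_change G) \<and>
      G dvd veronese_pullback s F \<and> veronese_preimage s V = zero_locus 2 {base_change G}"
    by (simp only: C.C_def)
  have "veronese s ` veronese_preimage s V = V"
    using C.V_eq by (simp add: C.C_def)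
  moreover have "\<nu> \<noteq> [0..<M]"
    if "separating M V \<zeta>" "hasse_derivatives (function_field M V) (constants M V) \<zeta> D"
      "frobenius_order_sequence M V D \<nu>" for \<zeta> D \<nu>
    using G.frobenius_det_eq_0[OF that(1,2)] that(3)
    by (auto simp: frobenius_order_sequence_def frobenius_admissible_def)
  ultimately have "frobenius_nonclassical_wrt_curves_of_degree s (veronese_preimage s V)"
    using assms(10-12)
    unfolding frobenius_nonclassical_wrt_curves_of_degree_def frobenius_nonclassical_curve_def
      assms(2)[symmetric] by simp blast
  with i show ?thesis by blast
qed

end
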